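(* Let $M$ be a closed connected smooth manifold with $\dim M\ge 1$, let $g$ be a Riemannian metric on $M$, and let $F:M\to\mathbb{R}$ be a smooth Morse function such that the pair $(F,g)$ satisfies the Morse–Smale condition. Let $\phi^t$ be the negative gradient flow of $F$ with respect to $g$, and let $f=\phi^1:M\to M$ be its time-one map. Then the induced homeomorphism $C(f):C(M)\to C(M)$ on the hyperspace of subcontinua of $M$ does not have the shadowing property.
   Context: Closed manifold means compact without boundary. Morse gradient systems. The gradient $\nabla_g F$ is the vector field with $g_p((\nabla_g F)_p,\xi)=dF_p(\xi)$ for all $\xi\in T_pM$. $F$ is Morse if the Hessian of $F$ at every critical point is non-degenerate. The negative gradient flow $\phi^t$ is defined by $\frac{d}{dt}\phi^t(x)=-\nabla_g F(\phi^t(x))$, $\phi^0=\mathrm{Id}$. For a critical point $p$ of $F$, $W^u(p)=\{x\in M: \lim_{t\to-\infty}\phi^t(x)=p\}$ and $W^s(p)=\{x\in M:\lim_{t\to+\infty}\phi^t(x)=p\}$. The pair $(F,g)$ satisfies the Morse–Smale condition if for any two critical points $p,q$ the submanifolds $W^u(p)$ and $W^s(q)$ intersect transversally in $M$. Hyperspace. Let $d$ be a metric on $M$ inducing its topology (e.g. the Riemannian distance of $g$). $C(M)$ is the set of all nonempty closed connected subsets of $M$, equipped with the Hausdorff metric $d_H(A,B)=\inf\{\varepsilon>0: A\subset U_\varepsilon(B),\ B\subset U_\varepsilon(A)\}$, where $U_\varepsilon(A)=\{x\in M: d(x,A)<\varepsilon\}$. The induced map is $C(f)(A)=\{f(x):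 x\in A\}$; it is a homeomorphism when $f$ is. Shadowing. Let $(X,d)$ be a compact metric space and $h:X\to X$ a homeomorphism. A sequence $\{x_n\}_{n\in\mathbb{Z}}$ in $X$ is a $\delta$-pseudo-orbit if $d(x_{n+1},h(x_n))<\delta$ for all $n\in\mathbb{Z}$. The orbit of $x\in X$ $\varepsilon$-shadows $\{x_n\}_{n\in\mathbb{Z}}$ if $d(h^n(x),x_n)<\varepsilon$ for all $n\in\mathbb{Z}$. The system $(X,h)$ has the shadowing property if for every $\varepsilon>0$ there exists $\delta>0$ such that every $\delta$-pseudo-orbit $\{x_n\}_{n\in\mathbb{Z}}$ is $\varepsilon$-shadowed by the orbit of some $x\in X$. *)

theory Defs
  imports "HOL-Analysis.Analysis"
begin

section \<open>Smooth manifolds\<close>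

text \<open>\<open>Ck_on k S f\<close> is the class $C^k$, for functions on open subsets \<open>S\<close> of a Euclidean
  space. A function is of class $C^{k+1}$ if it is differentiable and all its directional
  derivatives are of class $C^k$.\<close>

fun Ck_on :: "nat \<Rightarrow> 'e::real_normed_vector set \<Rightarrow> ('e \<Rightarrow> 'f::real_normed_vector) \<Rightarrow> bool" where
  "Ck_on 0 S f \<longleftrightarrow> continuous_on S f"
| "Ck_on (Suc k) S f \<longleftrightarrow> (\<forall>x\<in>S. f differentiable (at x)) \<and>
     (\<forall>v. Ck_on k S (\<lambda>x. frechet_derivative f (at x) v))"

definition smooth_on :: "'e::real_normed_vector set \<Rightarrow> ('e \<Rightarrow> 'f::real_normed_vector) \<Rightarrow> bool" where
  "smooth_on S f \<longleftrightarrow> (\<forall>k. Ck_on k S f)"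

text \<open>A chart is a pair of a domain and a coordinate map. The values of the coordinate map
  outside the domain are irrelevant. The model space is an arbitrary Euclidean space \<open>'e\<close>, so
  the dimension of the manifold is \<open>DIM('e)\<close>, which is at least 1.\<close>

type_synonym ('a, 'e) chart = "'a set \<times> ('a \<Rightarrow> 'e)"

abbreviation chart_dom :: "('a, 'e) chart \<Rightarrow> 'a set" where
  "chart_dom \<equiv> fst"

abbreviation chart_map :: "('a, 'e) chart \<Rightarrow> 'a \<Rightarrow> 'e" where
  "chart_map \<equiv> snd"

definition chart_im :: "('a, 'e) chart \<Rightarrow> 'e set" where
  "chart_im c = chart_map c ` chart_dom c"

definition chart_inv :: "('a, 'e) chart \<Rightarrow> 'e \<Rightarrow> 'a" where
  "chart_inv c = inv_into (chart_dom c) (chart_map c)"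

definition transition :: "('a, 'e) chart \<Rightarrow> ('a, 'e) chart \<Rightarrow> 'e \<Rightarrow> 'e" where
  "transition c c' = chart_map c' \<circ> chart_inv c"

text \<open>The manifold is a subset \<open>M\<close> of a metric space, with the induced metric and topology;
  in particular it is Hausdorff, and second countable as soon as it is compact. Its smooth
  structure is the one generated by the atlas \<open>\<A>\<close>, which need not be maximal.\<close>

definition smooth_manifold ::
  "'a::metric_space set \<Rightarrow> ('a, 'e::euclidean_space) chart set \<Rightarrow> bool" where
  "smooth_manifold M \<A> \<longleftrightarrow>
     (\<Union>c\<in>\<A>. chart_dom c) = M \<and>
     (\<forall>c\<in>\<A>. openin (top_of_set M) (chart_dom c) \<and> open (chart_im c) \<and>
            homeomorphism (chart_dom c) (chart_im c) (chart_map c) (chart_inv c)) \<and>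
     (\<forall>c\<in>\<A>. \<forall>c'\<in>\<A>. smooth_on (chart_map c ` (chart_dom c \<inter> chart_dom c')) (transition c c'))"

definition smooth_fun ::
  "('a, 'e::euclidean_space) chart set \<Rightarrow> ('a \<Rightarrow> real) \<Rightarrow> bool" where
  "smooth_fun \<A> F \<longleftrightarrow> (\<forall>c\<in>\<A>. smooth_on (chart_im c) (F \<circ> chart_inv c))"

definition charts_at :: "('a, 'e) chart set \<Rightarrow> 'a \<Rightarrow> ('a, 'e) chart set" where
  "charts_at \<A> p = {c\<in>\<A>. p \<in> chart_dom c}"

definition chart_at :: "('a, 'e) chart set \<Rightarrow> 'a \<Rightarrow> ('a, 'e) chart" where
  "chart_at \<A> p = (SOME c. c \<in> charts_at \<A> p)"

section \<open>Tangent vectors and Riemannian metrics\<close>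

text \<open>A tangent vector at \<open>p\<close> is the family of its coordinate vectors in all charts
  around \<open>p\<close>; these correspond to each other under the derivatives of the transition maps.
  The family is set to 0 at all other charts, so that equality of tangent vectors is equality
  of functions. The vector space operations are pointwise.\<close>

type_synonym ('a, 'e) tvec = "('a, 'e) chart \<Rightarrow> 'e"

definition tangent_space ::
  "('a, 'e::euclidean_space) chart set \<Rightarrow> 'a \<Rightarrow> ('a, 'e) tvec set" where
  "tangent_space \<A> p = {v.
     (\<forall>c\<in>charts_at \<A> p. \<forall>c'\<in>charts_at \<A> p.
        v c' = frechet_derivative (transition c c') (at (chart_map c p)) (v c)) \<and>
     (\<forall>c. c \<notin> charts_at \<A> p \<longrightarrow> v c = 0)}"

text \<open>The tangent vector at \<open>p\<close> whose coordinate vector in the chart \<open>c\<close> is \<open>e\<close>.\<close>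

definition coord_tvec ::
  "('a, 'e::euclidean_space) chart set \<Rightarrow> ('a, 'e) chart \<Rightarrow> 'a \<Rightarrow> 'e \<Rightarrow> ('a, 'e) tvec" where
  "coord_tvec \<A> c p e = (\<lambda>c'. if c' \<in> charts_at \<A> p
     then frechet_derivative (transition c c') (at (chart_map c p)) e else 0)"

text \<open>Continuity at \<open>t\<close> ensures that the curve stays in the domain of each chart
  around \<open>\<gamma> t\<close> for parameters close to \<open>t\<close>.\<close>

definition has_velocity ::
  "('a::metric_space, 'e::euclidean_space) chart set \<Rightarrow> (real \<Rightarrow> 'a) \<Rightarrow> real \<Rightarrow> ('a, 'e) tvec \<Rightarrow> bool" where
  "has_velocity \<A> \<gamma> t v \<longleftrightarrow> isCont \<gamma> t \<and> v \<in> tangent_space \<A> (\<gamma> t) \<and>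
     (\<forall>c\<in>charts_at \<A> (\<gamma> t). ((chart_map c \<circ> \<gamma>) has_vector_derivative v c) (at t))"

definition riemannian_metric ::
  "'a set \<Rightarrow> ('a, 'e::euclidean_space) chart set \<Rightarrow>
     ('a \<Rightarrow> ('a, 'e) tvec \<Rightarrow> ('a, 'e) tvec \<Rightarrow> real) \<Rightarrow> bool" where
  "riemannian_metric M \<A> g \<longleftrightarrow>
     (\<forall>p\<in>M. \<forall>u\<in>tangent_space \<A> p. \<forall>v\<in>tangent_space \<A> p.
        g p u v = g p v u \<and>
        (\<forall>w\<in>tangent_space \<A> p. \<forall>a b.
           g p (\<lambda>c. a *\<^sub>R u c + b *\<^sub>R v c) w = a * g p u w + b * g p v w)) \<and>
     (\<forall>p\<in>M. \<forall>u\<in>tangent_space \<A> p. u \<noteq> (\<lambda>_. 0) \<longrightarrow> 0 < g p u u) \<and>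
     (\<forall>c\<in>\<A>. \<forall>v w. smooth_on (chart_im c)
        (\<lambda>x. g (chart_inv c x) (coord_tvec \<A> c (chart_inv c x) v) (coord_tvec \<A> c (chart_inv c x) w)))"

section \<open>Morse functions and gradient flows\<close>

text \<open>Neither the differential of a smooth function nor its Hessian at a critical point
  depends on the chart used to compute it.\<close>

definition differential ::
  "('a, 'e::euclidean_space) chart set \<Rightarrow> ('a \<Rightarrow> real) \<Rightarrow> 'a \<Rightarrow> ('a, 'e) tvec \<Rightarrow> real" where
  "differential \<A> F p \<xi> = (let c = chart_at \<A> p in
     frechet_derivative (F \<circ> chart_inv c) (at (chart_map c p)) (\<xi> c))"

definition critical_point ::
  "'a set \<Rightarrow> ('a, 'e::euclidean_space) chart set \<Rightarrow> ('a \<Rightarrow> real) \<Rightarrow> 'a \<Rightarrow> bool" where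
  "critical_point M \<A> F p \<longleftrightarrow> p \<in> M \<and> (\<forall>\<xi>\<in>tangent_space \<A> p. differential \<A> F p \<xi> = 0)"

definition hessian ::
  "('a, 'e::euclidean_space) chart set \<Rightarrow> ('a \<Rightarrow> real) \<Rightarrow> 'a \<Rightarrow>
     ('a, 'e) tvec \<Rightarrow> ('a, 'e) tvec \<Rightarrow> real" where
  "hessian \<A> F p \<xi> \<eta> = (let c = chart_at \<A> p in
     frechet_derivative (\<lambda>x. frechet_derivative (F \<circ> chart_inv c) (at x) (\<eta> c))
       (at (chart_map c p)) (\<xi> c))"

definition morse ::
  "'a set \<Rightarrow> ('a, 'e::euclidean_space) chart set \<Rightarrow> ('a \<Rightarrow> real) \<Rightarrow> bool" where
  "morse M \<A> F \<longleftrightarrow> (\<forall>p. critical_point M \<A> F p \<longrightarrow>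
     (\<forall>\<xi>\<in>tangent_space \<A> p. (\<forall>\<eta>\<in>tangent_space \<A> p. hessian \<A> F p \<xi> \<eta> = 0) \<longrightarrow> \<xi> = (\<lambda>_. 0)))"

definition gradient ::
  "('a, 'e::euclidean_space) chart set \<Rightarrow> ('a \<Rightarrow> ('a, 'e) tvec \<Rightarrow> ('a, 'e) tvec \<Rightarrow> real) \<Rightarrow>
     ('a \<Rightarrow> real) \<Rightarrow> 'a \<Rightarrow> ('a, 'e) tvec" where
  "gradient \<A> g F p = (THE v. v \<in> tangent_space \<A> p \<and>
     (\<forall>\<xi>\<in>tangent_space \<A> p. g p v \<xi> = differential \<A> F p \<xi>))"

text \<open>The values of a flow outside \<open>M\<close> are irrelevant.\<close>

definition negative_gradient_flow ::
  "'a::metric_space set \<Rightarrow> ('a, 'e::euclidean_space) chart set \<Rightarrow>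
     ('a \<Rightarrow> ('a, 'e) tvec \<Rightarrow> ('a, 'e) tvec \<Rightarrow> real) \<Rightarrow> ('a \<Rightarrow> real) \<Rightarrow> (real \<Rightarrow> 'a \<Rightarrow> 'a) \<Rightarrow> bool" where
  "negative_gradient_flow M \<A> g F \<phi> \<longleftrightarrow> (\<forall>x\<in>M. \<phi> 0 x = x \<and>
     (\<forall>t. \<phi> t x \<in> M \<and> has_velocity \<A> (\<lambda>s. \<phi> s x) t (\<lambda>c. - gradient \<A> g F (\<phi> t x) c)))"

definition unstable_manifold ::
  "'a::metric_space set \<Rightarrow> (real \<Rightarrow> 'a \<Rightarrow> 'a) \<Rightarrow> 'a \<Rightarrow> 'a set" where
  "unstable_manifold M \<phi> p = {x\<in>M. ((\<lambda>t. \<phi> t x) \<longlongrightarrow> p) at_bot}"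

definition stable_manifold ::
  "'a::metric_space set \<Rightarrow> (real \<Rightarrow> 'a \<Rightarrow> 'a) \<Rightarrow> 'a \<Rightarrow> 'a set" where
  "stable_manifold M \<phi> p = {x\<in>M. ((\<lambda>t. \<phi> t x) \<longlongrightarrow> p) at_top}"

section \<open>The Morse--Smale condition\<close>

definition smooth_curve_on ::
  "real set \<Rightarrow> 'a::metric_space set \<Rightarrow> ('a, 'e::euclidean_space) chart set \<Rightarrow> (real \<Rightarrow> 'a) \<Rightarrow> bool" where
  "smooth_curve_on J M \<A> \<gamma> \<longleftrightarrow> continuous_on J \<gamma> \<and> \<gamma> ` J \<subseteq> M \<and>
     (\<forall>c\<in>\<A>. smooth_on {t\<in>J. \<gamma> t \<in> chart_dom c} (chart_map c \<circ> \<gamma>))"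

text \<open>The tangent space at \<open>x\<close> of a submanifold \<open>S\<close> of \<open>M\<close>, as a subspace of the tangent
  space of \<open>M\<close>: the velocities at \<open>x\<close> of the smooth curves that run in \<open>S\<close>.\<close>

definition submanifold_tangent_space ::
  "'a::metric_space set \<Rightarrow> ('a, 'e::euclidean_space) chart set \<Rightarrow> 'a set \<Rightarrow> 'a \<Rightarrow> ('a, 'e) tvec set" where
  "submanifold_tangent_space M \<A> S x = {v. \<exists>\<gamma> r. 0 < r \<and>
     smooth_curve_on {-r<..<r} M \<A> \<gamma> \<and> \<gamma> ` {-r<..<r} \<subseteq> S \<and> \<gamma> 0 = x \<and> has_velocity \<A> \<gamma> 0 v}"

definition transversal ::
  "'a::metric_space set \<Rightarrow> ('a, 'e::euclidean_space) chart set \<Rightarrow> 'a set \<Rightarrow> 'a set \<Rightarrow> bool" where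
  "transversal M \<A> S S' \<longleftrightarrow> (\<forall>x\<in>S \<inter> S'. \<forall>v\<in>tangent_space \<A> x.
     \<exists>u\<in>submanifold_tangent_space M \<A> S x. \<exists>w\<in>submanifold_tangent_space M \<A> S' x.
       v = (\<lambda>c. u c + w c))"

text \<open>This is a condition on the pair of \<open>F\<close> and the Riemannian metric, stated in terms of
  the negative gradient flow \<open>\<phi>\<close> that they determine.\<close>

definition morse_smale ::
  "'a::metric_space set \<Rightarrow> ('a, 'e::euclidean_space) chart set \<Rightarrow> ('a \<Rightarrow> real) \<Rightarrow>
     (real \<Rightarrow> 'a \<Rightarrow> 'a) \<Rightarrow> bool" where
  "morse_smale M \<A> F \<phi> \<longleftrightarrow> (\<forall>p q. critical_point M \<A> F p \<longrightarrow> critical_point M \<A> F q \<longrightarrow>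
     transversal M \<A> (unstable_manifold M \<phi> p) (stable_manifold M \<phi> q))"

section \<open>The hyperspace of subcontinua\<close>

definition subcontinua :: "'a::metric_space set \<Rightarrow> 'a set set" where
  "subcontinua M = {A. A \<noteq> {} \<and> closedin (top_of_set M) A \<and> connected A}"

definition metric_nbhd :: "'a::metric_space set \<Rightarrow> real \<Rightarrow> 'a set \<Rightarrow> 'a set" where
  "metric_nbhd M \<epsilon> A = {x\<in>M. infdist x A < \<epsilon>}"

definition hausdorff_dist :: "'a::metric_space set \<Rightarrow> 'a set \<Rightarrow> 'a set \<Rightarrow> real" where
  "hausdorff_dist M A B = Inf {\<epsilon>. 0 < \<epsilon> \<and> A \<subseteq> metric_nbhd M \<epsilon> B \<and> B \<subseteq> metric_nbhd M \<epsilon> A}"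

definition induced_map :: "('a \<Rightarrow> 'a) \<Rightarrow> 'a set \<Rightarrow> 'a set" where
  "induced_map f A = f ` A"

section \<open>Shadowing\<close>

text \<open>Throughout, \<open>h\<close> is a homeomorphism of a compact metric space with carrier \<open>X\<close> and
  metric \<open>d\<close>.\<close>

definition int_iterate :: "'b set \<Rightarrow> ('b \<Rightarrow> 'b) \<Rightarrow> int \<Rightarrow> 'b \<Rightarrow> 'b" where
  "int_iterate X h n = (if 0 \<le> n then h ^^ nat n else inv_into X h ^^ nat (- n))"

definition pseudo_orbit ::
  "'b set \<Rightarrow> ('b \<Rightarrow> 'b \<Rightarrow> real) \<Rightarrow> ('b \<Rightarrow> 'b) \<Rightarrow> real \<Rightarrow> (int \<Rightarrow> 'b) \<Rightarrow> bool" where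
  "pseudo_orbit X d h \<delta> s \<longleftrightarrow> (\<forall>n. s n \<in> X) \<and> (\<forall>n. d (s (n + 1)) (h (s n)) < \<delta>)"

definition shadows ::
  "'b set \<Rightarrow> ('b \<Rightarrow> 'b \<Rightarrow> real) \<Rightarrow> ('b \<Rightarrow> 'b) \<Rightarrow> real \<Rightarrow> 'b \<Rightarrow> (int \<Rightarrow> 'b) \<Rightarrow> bool" where
  "shadows X d h \<epsilon> x s \<longleftrightarrow> (\<forall>n. d (int_iterate X h n x) (s n) < \<epsilon>)"

definition shadowing_property :: "'b set \<Rightarrow> ('b \<Rightarrow> 'b \<Rightarrow> real) \<Rightarrow> ('b \<Rightarrow> 'b) \<Rightarrow> bool" where
  "shadowing_property X d h \<longleftrightarrow> (\<forall>\<epsilon>>0. \<exists>\<delta>>0. \<forall>s. pseudo_orbit X d h \<delta> s \<longrightarrow>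
     (\<exists>x\<in>X. shadows X d h \<epsilon> x s))"

end

theory Submission
  imports Defs
begin

text \<open>A continuum that shadows a pseudo-orbit of the hyperspace is a connected set all of whose points have orbits
  that stay close to the pseudo-orbit. In the pseudo-orbits used here a small jump opens a gap next to a
  critical point, and the gap grows afterwards. A shadowing continuum cannot open a gap
  at that moment: it must have had the gap all along, and then it is not connected.

  Two different orbits that lead from the same critical point \<open>p\<close> to the same critical
  point \<open>q\<close> form, together with \<open>p\<close> and \<open>q\<close>, an invariant circle. An arc of this circle around
  \<open>p\<close> grows under the map until it is nearly the full circle. At this moment a
  small jump replaces it by an arc that misses a neighbourhood of \<open>p\<close>, and this arc shrinks
  to \<open>q\<close>. If a continuum \<open>A\<close> shadows this pseudo-orbit, then every point of \<open>A\<close> comes from \<open>p\<close>, goes to \<open>q\<close>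
  and stays near the circle, so it follows one of the two orbits; which one is a locally constant
  function on \<open>A\<close>. It takes both values, because \<open>A\<close> is close to both orbits at the time of
  the jump, and this contradicts the connectedness of \<open>A\<close>
  (\<open>two_connections_imp_not_shadowing\<close>). In dimension at least 2 such orbits exist: removing finitely
  many points does not disconnect a ball, hence some level set of \<open>F\<close> is infinite
  (\<open>infinite_level\<close>), whereas there are only finitely many pairs of critical points to
  connect.

  In dimension 1 the critical points alternate between sources and sinks on a circle and two
  such orbits may not exist, so the full circle is used instead. Take a source \<open>p\<close> and its two
  outgoing orbits \<open>\<gamma>\<close> and \<open>\<gamma>'\<close>. The complement of \<open>\<gamma>\<close>, enlarged by a piece of \<open>\<gamma>\<close> next to \<open>p\<close>, grows
  to nearly all of \<open>M\<close>; a small jump then opens a hole in \<open>\<gamma>'\<close> next to \<open>p\<close>, which grows until \<open>\<gamma>'\<close> is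
  lost. A shadowing continuum \<open>A\<close> meets \<open>\<gamma>\<close> only in a part
  bounded away from its sink, and \<open>\<gamma>'\<close> only in a part bounded away from \<open>p\<close>, so \<open>p\<close> together with
  \<open>\<gamma>\<close> cuts off an open and closed part of \<open>A\<close> (\<open>one_dimensional_not_shadowing\<close>). That the complement of
  an orbit is connected (\<open>connected_orbit_complement\<close>) is a parity argument: each critical point has
  exactly two orbits attached to it, and each orbit joins a source to a sink.

  Both arguments are about a continuous flow with finitely many rest points and a function
  that decreases strictly along all other orbits. That the negative gradient flow has
  these properties (\<open>gradient_like\<close>) follows from the local Lipschitz continuity of the gradient in charts,
  by Gronwall's inequality, and from the isolation of nondegenerate critical points.\<close>

section \<open>The hyperspace of subcontinua\<close>

lemma hausdorff_dist_lessI: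
  assumes "A \<subseteq> M" "B \<subseteq> M" "0 < \<delta>" "\<delta> < \<epsilon>"
    and "\<And>x. x \<in> A \<Longrightarrow> \<exists>y\<in>B. dist x y < \<delta>" and "\<And>y. y \<in> B \<Longrightarrow> \<exists>x\<in>A. dist y x < \<delta>"
  shows "hausdorff_dist M A B < \<epsilon>"
proof -
  have "hausdorff_dist M A B \<le> \<delta>"
    unfolding hausdorff_dist_def
  proof (rule cInf_lower)
    have "infdist x B < \<delta>" if "x \<in> A" for x
      using assms(5)[OF that] infdist_le by (meson le_less_trans)
    moreover have "infdist x A < \<delta>" if "x \<in> B" for x
      using assms(6)[OF that] infdist_le by (meson le_less_trans)
    ultimately show "\<delta> \<in> {\<epsilon>. 0 < \<epsilon> \<and> A \<subseteq> metric_nbhd M \<epsilon> B \<and> B \<subseteq> metric_nbhd M \<epsilon> A}"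
      using assms(1-3) by (auto simp: metric_nbhd_def)
    show "bdd_below {\<epsilon>. 0 < \<epsilon> \<and> A \<subseteq> metric_nbhd M \<epsilon> B \<and> B \<subseteq> metric_nbhd M \<epsilon> A}"
      by (rule bdd_belowI[of _ 0]) auto
  qed
  with assms(4) show ?thesis by simp
qed

text \<open>Boundedness of \<open>M\<close> makes the set of admissible radii nonempty; the infimum of the
  empty set would carry no information.\<close>

lemma hausdorff_dist_lessD:
  assumes "bounded M" "A \<subseteq> M" "B \<subseteq> M" "A \<noteq> {}" "B \<noteq> {}" "hausdorff_dist M A B < \<epsilon>"
  shows "\<And>x. x \<in> A \<Longrightarrow> \<exists>y\<in>B. dist x y < \<epsilon>" and "\<And>y. y \<in> B \<Longrightarrow> \<exists>x\<in>A. dist y x < \<epsilon>"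
proof -
  let ?E = "{\<epsilon>. 0 < \<epsilon> \<and> A \<subseteq> metric_nbhd M \<epsilon> B \<and> B \<subseteq> metric_nbhd M \<epsilon> A}"
  obtain d where d: "\<And>x y. x \<in> M \<Longrightarrow> y \<in> M \<Longrightarrow> dist x y \<le> d"
    using assms(1) unfolding bounded_two_points by blast
  have "infdist x C < \<bar>d\<bar> + 1" if "x \<in> M" "C \<subseteq> M" "C \<noteq> {}" for x C
  proof -
    from that obtain y where y: "y \<in> C" by blast
    have "infdist x C \<le> dist x y" by (rule infdist_le[OF y])
    also have "\<dots> \<le> d" using d that y by blast
    finally show ?thesis by linarith
  qed
  then have "\<bar>d\<bar> + 1 \<in> ?E"
    using assms(2-5) by (auto simp: metric_nbhd_def subset_iff)
  then obtain e where e: "e \<in> ?E" "e < \<epsilon>"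
    using cInf_lessD[of ?E \<epsilon>] assms(6) unfolding hausdorff_dist_def by auto
  have near: "\<exists>y\<in>C. dist x y < \<epsilon>" if "infdist x C < e" "C \<noteq> {}" for x C
  proof -
    have "Inf (dist x ` C) < \<epsilon>" using that e by (simp add: infdist_def)
    then show ?thesis using cInf_lessD[of "dist x ` C" \<epsilon>] that by auto
  qed
  show "\<exists>y\<in>B. dist x y < \<epsilon>" if "x \<in> A" for x
    using near[of x B] that e assms(5) by (auto simp: metric_nbhd_def)
  show "\<exists>x\<in>A. dist y x < \<epsilon>" if "y \<in> B" for y
    using near[of y A] that e assms(4) by (auto simp: metric_nbhd_def)
qed

lemma subcontinua_iff:
  "compact M \<Longrightarrow> A \<in> subcontinua M \<longleftrightarrow> A \<noteq> {} \<and> A \<subseteq> M \<and> compact A \<and> connected A"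
  unfolding subcontinua_def
  using closedin_imp_subset closedin_compact by (auto intro: closed_subset compact_imp_closed)

section \<open>Curves that converge\<close>

text \<open>Compact and closed disjoint sets have positive distance in every metric space, as the distance
  to the closed set attains its minimum on the compact one.\<close>

lemma compact_closed_apart:
  fixes S T :: "'a::metric_space set"
  assumes "compact S" "closed T" "S \<inter> T = {}"
  obtains d where "0 < d" "\<And>x y. x \<in> S \<Longrightarrow> y \<in> T \<Longrightarrow> d \<le> dist x y"
proof (cases "S = {} \<or> T = {}")
  case True
  then show ?thesis using that[of 1] by auto
next
  case False
  then obtain x0 where x0: "x0 \<in> S" "\<And>x. x \<in> S \<Longrightarrow> infdist x0 T \<le> infdist x T"
    using continuous_attains_inf[OF assms(1) _ continuous_on_infdist[OF continuous_on_id], of T] by blast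
  show ?thesis
  proof (rule that)
    show "0 < infdist x0 T" using x0(1) assms False by (intro infdist_pos_not_in_closed) auto
    show "infdist x0 T \<le> dist x y" if "x \<in> S" "y \<in> T" for x y
      using x0(2)[OF that(1)] infdist_le[OF that(2), of x] by linarith
  qed
qed

lemma compact_curve_with_limit:
  fixes c :: "real \<Rightarrow> 'a::topological_space"
  assumes "continuous_on {T..} c" "(c \<longlongrightarrow> q) at_top"
  shows "compact (insert q (c ` {T..}))"
proof (rule compactI)
  fix C assume C: "\<forall>t\<in>C. open t" "insert q (c ` {T..}) \<subseteq> \<Union>C"
  then obtain U where U: "U \<in> C" "q \<in> U" by blast
  then obtain T' where T': "\<And>t. t \<ge> T' \<Longrightarrow> c t \<in> U"
    using topological_tendstoD[OF assms(2), of U] C by (auto simp: eventually_at_top_linorder)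
  have "compact (c ` {T..T'})"
    by (rule compact_continuous_image) (auto intro: continuous_on_subset[OF assms(1)])
  then obtain D where D: "D \<subseteq> C" "finite D" "c ` {T..T'} \<subseteq> \<Union>D"
    using compactE[of "c ` {T..T'}" C] C by (metis (no_types, lifting) atLeastAtMost_iff atLeast_iff image_mono insert_subset subsetI subset_trans)
  have "c t \<in> \<Union>(insert U D)" if "t \<ge> T" for t
    using T'[of t] D(3) that by (cases "t \<le> T'") (auto simp: image_subset_iff)
  then have "insert q (c ` {T..}) \<subseteq> \<Union>(insert U D)"
    using U(2) by (simp add: image_subset_iff)
  then show "\<exists>C'\<subseteq>C. finite C' \<and> insert q (c ` {T..}) \<subseteq> \<Union>C'"
    using D(1,2) U(1) by (metis finite_insert insert_subset)
qed

lemma connected_curve_with_limit: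
  fixes c :: "real \<Rightarrow> 'a::topological_space"
  assumes "continuous_on {T..} c" "(c \<longlongrightarrow> q) at_top"
  shows "connected (insert q (c ` {T..}))"
proof (rule connected_intermediate_closure)
  show "connected (c ` {T..})" by (rule connected_continuous_image[OF assms(1)]) simp
  have "\<forall>\<^sub>F t in at_top. c t \<in> closure (c ` {T..})"
    by (rule eventually_at_top_linorderI[of T], rule subsetD[OF closure_subset]) simp
  then have "q \<in> closure (c ` {T..})"
    by (rule Lim_in_closed_set[OF closed_closure _ _ assms(2)]) simp
  then show "insert q (c ` {T..}) \<subseteq> closure (c ` {T..})"
    by (simp add: closure_subset)
qed auto

section \<open>Gradient-like flows\<close>

text \<open>All that the dynamical part of the argument uses of a gradient flow: \<open>Z\<close> is the set of rest
  points and \<open>F\<close> is a strict Lyapunov function.\<close>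

locale gradient_like_flow =
  fixes M :: "'a::metric_space set" and \<phi> :: "real \<Rightarrow> 'a \<Rightarrow> 'a" and F :: "'a \<Rightarrow> real" and Z :: "'a set"
  assumes compact_M: "compact M"
    and flow_continuous: "continuous_on (UNIV \<times> M) (\<lambda>(t, x). \<phi> t x)"
    and flow_in: "x \<in> M \<Longrightarrow> \<phi> t x \<in> M"
    and flow_0: "x \<in> M \<Longrightarrow> \<phi> 0 x = x"
    and flow_add: "x \<in> M \<Longrightarrow> \<phi> (s + t) x = \<phi> s (\<phi> t x)"
    and F_continuous: "continuous_on M F"
    and finite_Z: "finite Z"
    and Z_subset: "Z \<subseteq> M"
    and flow_Z: "z \<in> Z \<Longrightarrow> \<phi> t z = z"
    and F_decreasing: "x \<in> M \<Longrightarrow> x \<notin> Z \<Longrightarrow> 0 < t \<Longrightarrow> F (\<phi> t x) < F x"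
begin

abbreviation starts_at :: "'a \<Rightarrow> 'a \<Rightarrow> bool" where
  "starts_at x p \<equiv> ((\<lambda>t. \<phi> t x) \<longlongrightarrow> p) at_bot"

abbreviation ends_at :: "'a \<Rightarrow> 'a \<Rightarrow> bool" where
  "ends_at x q \<equiv> ((\<lambda>t. \<phi> t x) \<longlongrightarrow> q) at_top"

lemma flow_neg: "x \<in> M \<Longrightarrow> \<phi> (- t) (\<phi> t x) = x" "x \<in> M \<Longrightarrow> \<phi> t (\<phi> (- t) x) = x"
  using flow_add[of x "-t" t] flow_add[of x t "-t"] by (simp_all add: flow_0)

lemma flow_image: "\<phi> t ` M = M"
proof
  show "M \<subseteq> \<phi> t ` M"
    using flow_neg(2)[of _ t] flow_in[of _ "-t"] by (metis imageI subsetI)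
qed (use flow_in in auto)

lemma flow_inj: "x \<in> M \<Longrightarrow> y \<in> M \<Longrightarrow> \<phi> t x = \<phi> t y \<Longrightarrow> x = y"
  by (metis flow_neg(1))

lemma flow_notin_Z: "x \<in> M \<Longrightarrow> x \<notin> Z \<Longrightarrow> \<phi> t x \<notin> Z"
  by (metis flow_Z flow_neg(1))

lemma F_strict: "x \<in> M \<Longrightarrow> x \<notin> Z \<Longrightarrow> s < t \<Longrightarrow> F (\<phi> t x) < F (\<phi> s x)"
  using F_decreasing[of "\<phi> s x" "t - s"] flow_add[of x "t - s" s] flow_in flow_notin_Z by simp

lemma F_mono: "x \<in> M \<Longrightarrow> s \<le> t \<Longrightarrow> F (\<phi> t x) \<le> F (\<phi> s x)"
  using F_strict[of x s t] flow_Z[of x] by (cases "x \<in> Z"; cases "s = t") auto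

lemma flow_continuous_time: "x \<in> M \<Longrightarrow> continuous_on S (\<lambda>t. \<phi> t x)"
  by (rule continuous_on_compose2[OF flow_continuous, of _ "\<lambda>t. (t, x)", simplified])
     (auto intro!: continuous_intros)

lemma flow_continuous_space: "S \<subseteq> M \<Longrightarrow> continuous_on S (\<phi> t)"
  by (rule continuous_on_compose2[OF flow_continuous, of _ "\<lambda>x. (t, x)", simplified])
     (auto intro!: continuous_intros)

lemma F_flow_continuous: "x \<in> M \<Longrightarrow> continuous_on S (\<lambda>t. F (\<phi> t x))"
  by (rule continuous_on_compose2[OF F_continuous flow_continuous_time]) (auto simp: flow_in)

text \<open>Time reversal exchanges the two ends of every orbit; each statement about one end
  is transferred to the other end by this lemma.\<close>

lemma reversed: "gradient_like_flow M (\<lambda>t. \<phi> (- t)) (\<lambda>x. - F x) Z"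
proof unfold_locales
  have "continuous_on (UNIV \<times> M) ((\<lambda>(t, x). \<phi> t x) \<circ> (\<lambda>(t, x). (- t, x)))"
    by (rule continuous_on_compose)
       (auto simp: case_prod_unfold intro!: continuous_intros continuous_on_subset[OF flow_continuous[unfolded case_prod_unfold]])
  then show "continuous_on (UNIV \<times> M) (\<lambda>(t, x). \<phi> (- t) x)"
    by (simp add: case_prod_unfold comp_def)
  show "\<phi> (- (s + t)) x = \<phi> (- s) (\<phi> (- t) x)" if "x \<in> M" for x s t
    using flow_add[OF that, of "-s" "-t"] by simp
  show "- F (\<phi> (- t) x) < - F x" if "x \<in> M" "x \<notin> Z" "0 < t" for x t
    using F_strict[of x "-t" 0] that by (simp add: flow_0)
qed (auto intro: compact_M flow_in flow_0 finite_Z flow_Z continuous_intros F_continuous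
          simp: flow_0 flow_Z Z_subset[THEN subsetD])

lemma subcontinua_image:
  assumes "A \<in> subcontinua M" shows "\<phi> t ` A \<in> subcontinua M"
proof -
  have A: "A \<subseteq> M" "compact A" "connected A" "A \<noteq> {}"
    using assms by (auto simp: subcontinua_iff[OF compact_M])
  have "compact (\<phi> t ` A)" "connected (\<phi> t ` A)"
    by (intro compact_continuous_image connected_continuous_image flow_continuous_space A)+
  moreover have "\<phi> t ` A \<subseteq> M" using A flow_in by auto
  ultimately show ?thesis
    using A by (simp add: subcontinua_iff[OF compact_M])
qed

text \<open>On subcontinua the map has the inverse \<open>\<phi> (- 1)\<close>, so that the negative iterates, which are defined
  by a choice of preimages, are images under the flow as well.\<close>

lemma int_iterate_flow:
  assumes A: "A \<in> subcontinua M"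
  shows "int_iterate (subcontinua M) (induced_map (\<phi> 1)) n A = \<phi> (of_int n) ` A"
proof -
  let ?X = "subcontinua M" and ?h = "induced_map (\<phi> 1)"
  have AM: "A \<subseteq> M" using A by (auto simp: subcontinua_iff[OF compact_M])
  have inv: "inv_into ?X ?h B = \<phi> (- 1) ` B" if B: "B \<in> ?X" for B
  proof (rule inv_into_f_eq)
    show "inj_on ?h ?X"
    proof (rule inj_onI)
      fix C D assume "C \<in> ?X" "D \<in> ?X" and eq: "?h C = ?h D"
      then have "C \<subseteq> M" "D \<subseteq> M" by (auto simp: subcontinua_iff[OF compact_M])
      moreover have "inj_on (\<phi> 1) M" by (auto intro: inj_onI flow_inj)
      ultimately show "C = D" using eq unfolding induced_map_def by (simp add: inj_on_image_eq_iff)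
    qed
    show "\<phi> (- 1) ` B \<in> ?X" by (rule subcontinua_image[OF B])
    have "B \<subseteq> M" using B by (auto simp: subcontinua_iff[OF compact_M])
    then show "?h (\<phi> (- 1) ` B) = B"
      unfolding induced_map_def image_image using flow_neg(2)[of _ 1] by (auto simp: subset_iff image_iff)
  qed
  have comp: "\<phi> s ` \<phi> t ` A = \<phi> (s + t) ` A" for s t
    unfolding image_image using AM flow_add by (intro image_cong) auto
  have pos: "(?h ^^ k) A = \<phi> (real k) ` A" for k
  proof (induction k)
    case 0 then show ?case using AM flow_0 by (auto simp: subset_iff image_iff)
  next
    case (Suc k) then show ?case by (simp add: induced_map_def comp)
  qed
  have neg: "(inv_into ?X ?h ^^ k) A = \<phi> (- real k) ` A" for k
  proof (induction k)
    case 0 then show ?case using AM flow_0 by (auto simp: subset_iff image_iff)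
  next
    case (Suc k) then show ?case
      using inv[OF subcontinua_image[OF A, of "- real k"]] by (simp add: comp algebra_simps)
  qed
  show ?thesis
    unfolding int_iterate_def using pos[of "nat n"] neg[of "nat (- n)"] by auto
qed

text \<open>Both pseudo-orbits below consist of the first part of an orbit \<open>U\<close> and the last part of an orbit \<open>D\<close>
  of the hyperspace, with a jump at time 0. The jump is smaller than any given \<open>\<delta>\<close> if \<open>U\<close> is left late enough
  and \<open>D\<close> is entered early enough. Only points outside of the common part of the two sets have to
  be compared.\<close>

lemma shadowed_transition:
  fixes U D :: "int \<Rightarrow> 'a set"
  assumes shadowing: "shadowing_property (subcontinua M) (hausdorff_dist M) (induced_map (\<phi> 1))"
    and U: "\<And>n. U n \<in> subcontinua M" "\<And>n. \<phi> 1 ` U n = U (n + 1)"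
    and D: "\<And>n. D n \<in> subcontinua M" "\<And>n. \<phi> 1 ` D n = D (n + 1)"
    and jump: "\<And>\<delta>. 0 < \<delta> \<Longrightarrow> \<exists>K\<ge>0. (\<forall>x\<in>D (- K) - U K. \<exists>y\<in>U K. dist x y < \<delta>) \<and>
                                      (\<forall>y\<in>U K - D (- K). \<exists>x\<in>D (- K). dist y x < \<delta>)"
    and "0 < \<epsilon>"
  obtains A K where "A \<in> subcontinua M" "K \<ge> 0"
    "\<And>n a. n < 0 \<Longrightarrow> a \<in> A \<Longrightarrow> \<exists>u\<in>U (n + K). dist (\<phi> (of_int n) a) u < \<epsilon>"
    "\<And>n a. 0 \<le> n \<Longrightarrow> a \<in> A \<Longrightarrow> \<exists>d\<in>D (n - K). dist (\<phi> (of_int n) a) d < \<epsilon>"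
    "\<And>d. d \<in> D (- K) \<Longrightarrow> \<exists>a\<in>A. dist d a < \<epsilon>"
proof -
  let ?X = "subcontinua M" and ?h = "induced_map (\<phi> 1)"
  have X: "B \<subseteq> M" "B \<noteq> {}" if "B \<in> ?X" for B
    using that by (auto simp: subcontinua_iff[OF compact_M])
  obtain \<delta> where \<delta>: "\<delta> > 0"
    and sh: "\<And>s. pseudo_orbit ?X (hausdorff_dist M) ?h \<delta> s \<Longrightarrow> \<exists>A\<in>?X. shadows ?X (hausdorff_dist M) ?h \<epsilon> A s"
    using shadowing \<open>0 < \<epsilon>\<close> unfolding shadowing_property_def by blast
  obtain K where K: "K \<ge> 0" "\<forall>x\<in>D (- K). \<exists>y\<in>U K. dist x y < \<delta> / 2" "\<forall>y\<in>U K. \<exists>x\<in>D (- K). dist y x < \<delta> / 2"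
    using jump[of "\<delta> / 2"] \<delta> by (metis DiffI dist_self half_gt_zero)
  define s where "s n = (if n < 0 then U (n + K) else D (n - K))" for n :: int
  have sX: "s n \<in> ?X" for n by (simp add: s_def U D)
  have "hausdorff_dist M (s (n + 1)) (?h (s n)) < \<delta>" for n
  proof (rule hausdorff_dist_lessI[of _ _ _ "\<delta> / 2"])
    have "?h (s n) = (if n < 0 then U (n + 1 + K) else D (n + 1 - K))"
      by (simp add: induced_map_def s_def U D algebra_simps)
    moreover have "n + 1 < 0 \<or> n = - 1 \<or> n \<ge> 0" by linarith
    ultimately have "s (n + 1) = ?h (s n) \<or> (s (n + 1) = D (- K) \<and> ?h (s n) = U K)"
      by (auto simp: s_def)
    then show "\<exists>y\<in>?h (s n). dist x y < \<delta> / 2" if "x \<in> s (n + 1)" for x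
      using that K(2) \<delta> by (metis dist_self half_gt_zero)
    show "\<exists>y\<in>s (n + 1). dist x y < \<delta> / 2" if "x \<in> ?h (s n)" for x
      using \<open>s (n + 1) = ?h (s n) \<or> _\<close> that K(3) \<delta> by (metis dist_self half_gt_zero)
    show "s (n + 1) \<subseteq> M" "?h (s n) \<subseteq> M"
      using X sX subcontinua_image[OF sX[of n], of 1] by (auto simp: induced_map_def)
  qed (use \<delta> in auto)
  then have "pseudo_orbit ?X (hausdorff_dist M) ?h \<delta> s"
    by (simp add: pseudo_orbit_def sX)
  then obtain A where A: "A \<in> ?X" and "shadows ?X (hausdorff_dist M) ?h \<epsilon> A s"
    using sh by blast
  then have close: "hausdorff_dist M (\<phi> (of_int n) ` A) (s n) < \<epsilon>" for n
    by (simp add: shadows_def int_iterate_flow)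
  have near1: "\<exists>u\<in>s n. dist (\<phi> (of_int n) a) u < \<epsilon>" if "a \<in> A" for a n
    using hausdorff_dist_lessD(1)[OF compact_imp_bounded[OF compact_M] _ _ _ _ close, of n] X A that
      sX subcontinua_image by (metis imageI)
  have near2: "\<exists>a\<in>A. dist d a < \<epsilon>" if "d \<in> s 0" for d
  proof -
    have "\<exists>a\<in>\<phi> 0 ` A. dist d a < \<epsilon>"
      using hausdorff_dist_lessD(2)[OF compact_imp_bounded[OF compact_M] _ _ _ _ close, of 0] X A that
      sX subcontinua_image by (metis of_int_0)
    then show ?thesis using flow_0 X(1)[OF A] by (metis (no_types) imageE subsetD)
  qed
  show ?thesis
  proof (rule that[OF A K(1)])
    show "\<exists>u\<in>U (n + K). dist (\<phi> (of_int n) a) u < \<epsilon>" if "n < 0" "a \<in> A" for n a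
      using near1[OF that(2), of n] that(1) by (simp add: s_def)
    show "\<exists>d\<in>D (n - K). dist (\<phi> (of_int n) a) d < \<epsilon>" if "0 \<le> n" "a \<in> A" for n a
      using near1[OF that(2), of n] that(1) by (simp add: s_def)
    show "\<exists>a\<in>A. dist d a < \<epsilon>" if "d \<in> D (- K)" for d
      using near2[of d] that by (simp add: s_def)
  qed
qed

end

context gradient_like_flow
begin

text \<open>Shadowing controls orbits at integer times only; this lemma controls them at the times between.\<close>

lemma uniform_time_continuity:
  assumes "0 < e"
  obtains d where "0 < d" "\<And>x w t. x \<in> M \<Longrightarrow> w \<in> M \<Longrightarrow> t \<in> {a..b} \<Longrightarrow> dist x w < d \<Longrightarrow> dist (\<phi> t x) (\<phi> t w) < e"
proof -
  have "uniformly_continuous_on ({a..b} \<times> M) (\<lambda>(t, x). \<phi> t x)"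
    by (intro compact_uniformly_continuous continuous_on_subset[OF flow_continuous] compact_Times compact_M) auto
  from this[unfolded uniformly_continuous_on_def, rule_format, OF assms]
  obtain d where d: "d > 0" "\<forall>u\<in>{a..b} \<times> M. \<forall>v\<in>{a..b} \<times> M. dist v u < d \<longrightarrow>
      dist (case v of (t, x) \<Rightarrow> \<phi> t x) (case u of (t, x) \<Rightarrow> \<phi> t x) < e"
    by auto
  show ?thesis
  proof (rule that[OF d(1)])
    fix x w t assume "x \<in> M" "w \<in> M" "t \<in> {a..b}" "dist x w < d"
    then show "dist (\<phi> t x) (\<phi> t w) < e"
      using d(2)[rule_format, of "(t, w)" "(t, x)"] by (simp add: dist_Pair_Pair)
  qed
qed

text \<open>Along a divergent sequence of times an orbit accumulates only at rest points: at an accumulation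
  point \<open>y\<close> the values of \<open>F\<close> along the orbit have decreased to \<open>F y\<close>, so \<open>F\<close> cannot decrease any further
  along the orbit of \<open>y\<close>. Since rest points are isolated from each other, the orbit eventually avoids a
  small sphere around one of its accumulation points and is caught inside.\<close>

lemma converges_at_top:
  assumes x: "x \<in> M"
  shows "\<exists>q\<in>Z. ends_at x q"
proof -
  have no_escape: "y \<in> Z"
    if t: "filterlim t at_top sequentially" and lim: "(\<lambda>n. \<phi> (t n) x) \<longlonglongrightarrow> y" for t y
  proof (rule ccontr)
    assume "y \<notin> Z"
    have y: "y \<in> M"
      by (rule closed_sequentially[OF compact_imp_closed[OF compact_M] _ lim]) (simp add: flow_in x)
    have Flim: "(\<lambda>n. F (\<phi> s (\<phi> (t n) x))) \<longlonglongrightarrow> F (\<phi> s y)" for s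
    proof -
      have "continuous_on M (\<lambda>z. F (\<phi> s z))"
        by (rule continuous_on_compose2[OF F_continuous flow_continuous_space]) (auto simp: flow_in)
      then show ?thesis
        by (rule continuous_on_tendsto_compose[OF _ lim y]) (simp add: flow_in x)
    qed
    \<comment> \<open>The values of \<open>F\<close> along the orbit decrease and come close to \<open>F y\<close> at arbitrarily late times.\<close>
    have "F y \<le> F (\<phi> s x)" for s
    proof (rule tendsto_upperbound)
      show "(\<lambda>n. F (\<phi> (t n) x)) \<longlonglongrightarrow> F y" using Flim[of 0] x y by (simp add: flow_0 flow_in)
      show "\<forall>\<^sub>F n in sequentially. F (\<phi> (t n) x) \<le> F (\<phi> s x)"
        using t[unfolded filterlim_at_top, rule_format, of s] by eventually_elim (rule F_mono[OF x])
    qed simp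
    then have "F y \<le> F (\<phi> 1 (\<phi> (t n) x))" for n
      by (simp add: flow_add[OF x, symmetric])
    then have "F y \<le> F (\<phi> 1 y)"
      by (intro tendsto_lowerbound[OF Flim[of 1]]) auto
    with F_decreasing[OF y \<open>y \<notin> Z\<close>, of 1] show False by simp
  qed
  obtain y r where r: "strict_mono (r :: nat \<Rightarrow> nat)" and lim: "((\<lambda>n. \<phi> (real n) x) \<circ> r) \<longlonglongrightarrow> y"
    using compact_M[unfolded compact_def, rule_format, of "\<lambda>n. \<phi> (real n) x"] flow_in x by blast
  have r_top: "filterlim (\<lambda>n. real (r n)) at_top sequentially"
    by (rule filterlim_compose[OF filterlim_real_sequentially filterlim_subseq[OF r]])
  have y: "y \<in> Z" using no_escape[OF r_top] lim by (simp add: comp_def)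
  have "\<forall>\<^sub>F t in at_top. dist (\<phi> t x) y < \<epsilon>" if "\<epsilon> > 0" for \<epsilon>
  proof -
    obtain d where d: "d > 0" "\<forall>z\<in>Z. z \<noteq> y \<longrightarrow> d \<le> dist y z"
      using finite_set_avoid[OF finite_Z] by blast
    define \<rho> where "\<rho> = min \<epsilon> d / 2"
    have \<rho>: "0 < \<rho>" "\<rho> < \<epsilon>" "\<rho> < d" using that d by (auto simp: \<rho>_def)
    \<comment> \<open>Otherwise the orbit would accumulate on the sphere of radius \<open>\<rho>\<close>, which contains no rest points.\<close>
    have "\<exists>T. \<forall>t\<ge>T. dist y (\<phi> t x) \<noteq> \<rho>"
    proof (rule ccontr)
      assume "\<not> ?thesis"
      then have "\<forall>n. \<exists>t. t \<ge> real n \<and> dist y (\<phi> t x) = \<rho>" by auto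
      then obtain t where t: "\<And>n. t n \<ge> real n" "\<And>n. dist y (\<phi> (t n) x) = \<rho>" by metis
      obtain w k where k: "strict_mono (k :: nat \<Rightarrow> nat)" and w: "((\<lambda>n. \<phi> (t n) x) \<circ> k) \<longlonglongrightarrow> w"
        using compact_M[unfolded compact_def, rule_format, of "\<lambda>n. \<phi> (t n) x"] flow_in x by blast
      have "filterlim t at_top sequentially"
        by (rule filterlim_at_top_mono[OF filterlim_real_sequentially]) (simp add: t)
      then have "filterlim (\<lambda>n. t (k n)) at_top sequentially"
        by (rule filterlim_compose[OF _ filterlim_subseq[OF k]])
      then have "w \<in> Z" using no_escape[of "\<lambda>n. t (k n)" w] w by (simp add: comp_def)
      moreover have "(\<lambda>n. dist y (\<phi> (t (k n)) x)) \<longlonglongrightarrow> dist y w"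
        using w by (intro tendsto_intros) (simp add: comp_def)
      then have "dist y w = \<rho>" using t(2) by (simp add: LIMSEQ_const_iff)
      ultimately show False using d \<rho> by fastforce
    qed
    then obtain T where T: "\<And>t. t \<ge> T \<Longrightarrow> dist y (\<phi> t x) \<noteq> \<rho>" by blast
    have cont: "continuous_on {T..} (\<lambda>t. dist y (\<phi> t x))"
      by (intro continuous_intros flow_continuous_time x)
    have conn: "connected ((\<lambda>t. dist y (\<phi> t x)) ` {T..})"
      by (rule connected_continuous_image[OF cont]) simp
    obtain n where n: "dist (\<phi> (real (r n)) x) y < \<rho>" "real (r n) \<ge> T"
      using eventually_conj[OF tendstoD[OF lim \<rho>(1)] r_top[unfolded filterlim_at_top, rule_format, of T]]
      by (auto simp: eventually_sequentially)
    have "dist y (\<phi> t x) < \<rho>" if "t \<ge> T" for t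
    proof (rule ccontr)
      assume "\<not> ?thesis"
      then have "\<rho> \<in> (\<lambda>t. dist y (\<phi> t x)) ` {T..}"
        using connectedD_interval[OF conn, of "dist y (\<phi> (real (r n)) x)" "dist y (\<phi> t x)" \<rho>] n that
        by (auto simp: dist_commute)
      with T show False by auto
    qed
    then have "dist (\<phi> t x) y < \<epsilon>" if "t \<ge> T" for t
      using \<rho>(2) that by (metis dist_commute less_trans)
    then show ?thesis by (rule eventually_at_top_linorderI)
  qed
  then show ?thesis using y by (auto simp: tendsto_iff)
qed

lemma converges_at_bot:
  assumes x: "x \<in> M"
  shows "\<exists>p\<in>Z. starts_at x p"
  using gradient_like_flow.converges_at_top[OF reversed x] by (simp add: filterlim_at_bot_mirror)

lemma F_limit_less:
  assumes "x \<in> M" "x \<notin> Z" "q \<in> M" "ends_at x q"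
  shows "F q < F (\<phi> t x)"
proof -
  have "((\<lambda>s. F (\<phi> s x)) \<longlongrightarrow> F q) at_top"
    by (rule continuous_on_tendsto_compose[OF F_continuous assms(4,3)]) (simp add: flow_in assms)
  then have "F q \<le> F (\<phi> (t + 1) x)"
    by (rule tendsto_upperbound)
       (auto intro!: eventually_at_top_linorderI[of "t + 1"] F_mono[OF assms(1)])
  also have "\<dots> < F (\<phi> t x)" using assms by (intro F_strict) auto
  finally show ?thesis .
qed

lemma F_limit_greater:
  assumes "x \<in> M" "x \<notin> Z" "p \<in> M" "starts_at x p"
  shows "F (\<phi> t x) < F p"
  using gradient_like_flow.F_limit_less[OF reversed assms(1-3), of "- t"] assms(4)
  by (simp add: filterlim_at_bot_mirror)

definition forward :: "'a \<Rightarrow> real \<Rightarrow> 'a set" where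
  "forward x T = (\<lambda>t. \<phi> t x) ` {T..}"

definition backward :: "'a \<Rightarrow> real \<Rightarrow> 'a set" where
  "backward x T = (\<lambda>t. \<phi> t x) ` {..T}"

lemma image_forward: "x \<in> M \<Longrightarrow> \<phi> s ` forward x T = forward x (T + s)"
proof -
  assume x: "x \<in> M"
  have "\<phi> s ` forward x T = (\<lambda>t. \<phi> t x) ` ((+) s ` {T..})"
    unfolding forward_def image_image by (intro image_cong) (simp_all add: flow_add x)
  then show ?thesis by (simp only: forward_def image_add_atLeast add.commute)
qed

lemma reversed_forward: "gradient_like_flow.forward (\<lambda>t. \<phi> (- t)) x T = backward x (- T)"
proof -
  have "(\<lambda>t. \<phi> (- t) x) ` {T..} = (\<lambda>t. \<phi> t x) ` (uminus ` {T..})"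
    by (simp only: image_image)
  then show ?thesis
    by (simp add: gradient_like_flow.forward_def[OF reversed] backward_def)
qed

lemma image_backward: "x \<in> M \<Longrightarrow> \<phi> s ` backward x T = backward x (T + s)"
  using gradient_like_flow.image_forward[OF reversed, of x "-s" "-T"] by (simp add: reversed_forward add.commute)

lemma forward_limit:
  assumes "x \<in> M" "ends_at x q"
  shows "compact (insert q (forward x T))" "connected (insert q (forward x T))"
  unfolding forward_def
  by (intro compact_curve_with_limit connected_curve_with_limit flow_continuous_time assms)+

lemma backward_limit:
  assumes "x \<in> M" "starts_at x p"
  shows "compact (insert p (backward x T))" "connected (insert p (backward x T))"
  using gradient_like_flow.forward_limit[OF reversed assms(1), of p "- T"] assms(2)
  by (simp_all add: filterlim_at_bot_mirror reversed_forward)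

lemma forward_subset: "x \<in> M \<Longrightarrow> forward x T \<subseteq> M" and backward_subset: "x \<in> M \<Longrightarrow> backward x T \<subseteq> M"
  by (auto simp: forward_def backward_def flow_in)

end

section \<open>Two connecting orbits with common ends\<close>

context gradient_like_flow
begin

lemma crossing:
  assumes a: "a \<in> M" and "c < F (\<phi> s a)" "F (\<phi> t a) < c"
  obtains u where "F (\<phi> u a) = c"
proof -
  have "s \<le> t" using F_mono[OF a, of t s] assms by linarith
  then show ?thesis
    using IVT2'[of "\<lambda>u. F (\<phi> u a)" t c s] F_flow_continuous[OF a] assms that by auto
qed

text \<open>In unit time an orbit that starts near \<open>y1\<close> leaves the level of \<open>y1\<close> for good. It can
  therefore be near \<open>y2\<close> only at times of absolute value at most 1, when it is still near the orbit of
  \<open>y1\<close>, and this orbit meets the level of \<open>y1\<close> and \<open>y2\<close> in \<open>y1\<close> alone.\<close>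

lemma no_orbit_near_both:
  assumes y: "y1 \<in> M" "y1 \<notin> Z" "y2 \<in> M" "y1 \<noteq> y2" "F y1 = F y2"
  obtains r where "0 < r"
    "\<And>x t. x \<in> M \<Longrightarrow> dist x y1 < r \<Longrightarrow> dist (\<phi> t x) y2 < r \<Longrightarrow> False"
proof -
  let ?c = "F y1"
  have "F (\<phi> 1 y1) < ?c" "?c < F (\<phi> (- 1) y1)"
    using F_strict[OF y(1,2), of 0 1] F_strict[OF y(1,2), of "-1" 0] y(1) by (simp_all add: flow_0)
  then obtain e where e: "e > 0" "F (\<phi> 1 y1) < ?c - e" "?c + e < F (\<phi> (- 1) y1)"
    by (intro that[of "min (?c - F (\<phi> 1 y1)) (F (\<phi> (- 1) y1) - ?c) / 2"]) (auto simp: min_def field_simps)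
  have cont: "continuous_on M (\<lambda>x. F (\<phi> t x))" for t
    by (rule continuous_on_compose2[OF F_continuous flow_continuous_space]) (auto simp: flow_in)
  obtain r1 where r1: "r1 > 0" "\<And>x. x \<in> M \<Longrightarrow> dist x y1 < r1 \<Longrightarrow> dist (F (\<phi> 1 x)) (F (\<phi> 1 y1)) < ?c - e - F (\<phi> 1 y1)"
    using cont[of 1] y(1) e unfolding continuous_on_iff by (metis diff_gt_0_iff_gt)
  obtain r2 where r2: "r2 > 0" "\<And>x. x \<in> M \<Longrightarrow> dist x y1 < r2 \<Longrightarrow> dist (F (\<phi> (- 1) x)) (F (\<phi> (- 1) y1)) < F (\<phi> (- 1) y1) - (?c + e)"
    using cont[of "- 1"] y(1) e unfolding continuous_on_iff by (metis diff_gt_0_iff_gt)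
  obtain r3 where r3: "r3 > 0" "\<And>x. x \<in> M \<Longrightarrow> dist x y2 < r3 \<Longrightarrow> dist (F x) (F y2) < e"
    using F_continuous y(3) e(1) unfolding continuous_on_iff by metis
  have "compact ((\<lambda>t. \<phi> t y1) ` {-1..1})"
    by (rule compact_continuous_image[OF flow_continuous_time]) (auto simp: y)
  moreover have "y2 \<notin> (\<lambda>t. \<phi> t y1) ` {-1..1}"
  proof
    assume "y2 \<in> (\<lambda>t. \<phi> t y1) ` {-1..1}"
    then obtain t where t: "y2 = \<phi> t y1" by auto
    have "t \<noteq> 0" using y(1,4) t flow_0 by metis
    then have "F (\<phi> t y1) \<noteq> F y1"
      using F_strict[OF y(1,2), of 0 t] F_strict[OF y(1,2), of t 0]
      by (cases t "0 :: real" rule: linorder_cases) (simp_all add: flow_0 y(1))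
    with t y(5) show False by simp
  qed
  ultimately obtain d where d: "d > 0" "\<And>t. t \<in> {-1..1} \<Longrightarrow> d \<le> dist y2 (\<phi> t y1)"
    using compact_closed_apart[OF _ closed_singleton, of "(\<lambda>t. \<phi> t y1) ` {-1..1}" y2]
    by (metis Int_insert_right_if0 dist_commute image_eqI inf_bot_right insertI1)
  obtain r4 where r4: "r4 > 0" "\<And>x w t. x \<in> M \<Longrightarrow> w \<in> M \<Longrightarrow> t \<in> {-1..1} \<Longrightarrow> dist x w < r4 \<Longrightarrow> dist (\<phi> t x) (\<phi> t w) < d / 2"
    using uniform_time_continuity[of "d / 2" "-1" 1] d(1) by (metis half_gt_zero)
  define r where "r = Min {r1, r2, r3, r4, d / 2}"
  have r: "r > 0" "r \<le> r1" "r \<le> r2" "r \<le> r3" "r \<le> r4" "r \<le> d / 2"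
    using r1(1) r2(1) r3(1) r4(1) d(1) by (auto simp: r_def)
  show ?thesis
  proof (rule that[OF r(1)])
    fix x t assume x: "x \<in> M" "dist x y1 < r" and t: "dist (\<phi> t x) y2 < r"
    have *: "F (\<phi> 1 x) < ?c - e" "?c + e < F (\<phi> (- 1) x)"
      using r1(2)[of x] r2(2)[of x] x r unfolding dist_real_def by linarith+
    have **: "?c - e < F (\<phi> t x)" "F (\<phi> t x) < ?c + e"
      using r3(2)[of "\<phi> t x"] t r flow_in[OF x(1)] y(5) unfolding dist_real_def by fastforce+
    have "t \<in> {-1..1}"
      using F_mono[OF x(1), of 1 t] F_mono[OF x(1), of t "-1"] * ** by force
    then have "dist (\<phi> t x) (\<phi> t y1) < d / 2" "d \<le> dist y2 (\<phi> t y1)"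
      using r4(2)[of x y1 t] d(2) x r y by auto
    with t r show False using dist_triangle[of y2 "\<phi> t y1" "\<phi> t x"] by (simp add: dist_commute)
  qed
qed

text \<open>The limit exists and is a rest point, so it suffices to know it up to half the distance to the other
  rest points.\<close>

lemma limit_near_point:
  assumes "p \<in> Z" "\<And>z. z \<in> Z \<Longrightarrow> z \<noteq> p \<Longrightarrow> e \<le> dist p z" "a \<in> M"
    and near: "\<And>n. n \<ge> N \<Longrightarrow> dist (\<phi> (real n) a) p < e / 2"
  shows "ends_at a p"
proof -
  obtain q where q: "q \<in> Z" "ends_at a q" using converges_at_top[OF assms(3)] by blast
  have "(\<lambda>n. dist p (\<phi> (real n) a)) \<longlonglongrightarrow> dist p q"
    by (intro tendsto_intros filterlim_compose[OF q(2) filterlim_real_sequentially])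
  moreover have "\<forall>\<^sub>F n in sequentially. dist p (\<phi> (real n) a) \<le> e / 2"
    using near unfolding eventually_sequentially by (metis dist_commute less_imp_le)
  ultimately have "dist p q \<le> e / 2"
    by (rule tendsto_upperbound) simp
  moreover have "0 < e" using near[of N] zero_le_dist[of "\<phi> (real N) a" p] by linarith
  ultimately show ?thesis using assms(2)[OF q(1)] q(2) by (cases "q = p") auto
qed

lemma limit_near_point_at_bot:
  assumes "p \<in> Z" "\<And>z. z \<in> Z \<Longrightarrow> z \<noteq> p \<Longrightarrow> e \<le> dist p z" "a \<in> M"
    and near: "\<And>n. n \<ge> N \<Longrightarrow> dist (\<phi> (- real n) a) p < e / 2"
  shows "starts_at a p"
  using gradient_like_flow.limit_near_point[OF reversed assms] by (simp add: filterlim_at_bot_mirror)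

text \<open>The sets \<open>U n\<close> and \<open>D n\<close> are the growing arc around \<open>p\<close> and the shrinking arc
  around \<open>q\<close> in the circle \<open>\<Gamma>\<close> formed by the two orbits. A point of a shadowing continuum goes from \<open>p\<close> to \<open>q\<close>
  and hence crosses the level \<open>c\<close> of \<open>y1\<close> and \<open>y2\<close>. As \<open>\<Gamma>\<close> meets this level in \<open>y1\<close> and \<open>y2\<close> only, the crossing takes
  place near one of them, and never near both.\<close>

theorem two_connections_imp_not_shadowing:
  assumes y: "y1 \<in> M" "y1 \<notin> Z" "y2 \<in> M" "y2 \<notin> Z" "y1 \<noteq> y2" "F y1 = F y2"
    and p: "p \<in> Z" "starts_at y1 p" "starts_at y2 p"
    and q: "q \<in> Z" "ends_at y1 q" "ends_at y2 q"
  shows "\<not> shadowing_property (subcontinua M) (hausdorff_dist M) (induced_map (\<phi> 1))"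
proof
  assume shadowing: "shadowing_property (subcontinua M) (hausdorff_dist M) (induced_map (\<phi> 1))"
  define c where "c = F y1"
  have pM: "p \<in> M" "q \<in> M" using p q Z_subset by auto
  have Fp: "F (\<phi> t y1) < F p" "F (\<phi> t y2) < F p" and Fq: "F q < F (\<phi> t y1)" "F q < F (\<phi> t y2)" for t
    using F_limit_greater F_limit_less y p q pM by blast+
  have c: "F q < c" "c < F p" using Fp[of 0] Fq[of 0] y by (simp_all add: flow_0 c_def)
  obtain ep where ep: "ep > 0" "\<And>z. z \<in> Z \<Longrightarrow> z \<noteq> p \<Longrightarrow> ep \<le> dist p z"
    using finite_set_avoid[OF finite_Z] by metis
  obtain eq where eq: "eq > 0" "\<And>z. z \<in> Z \<Longrightarrow> z \<noteq> q \<Longrightarrow> eq \<le> dist q z"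
    using finite_set_avoid[OF finite_Z] by metis
  define U where "U n = insert p (backward y1 (of_int n)) \<union> insert p (backward y2 (of_int n))" for n
  define D where "D n = insert q (forward y1 (of_int n)) \<union> insert q (forward y2 (of_int n))" for n
  define \<Gamma> where "\<Gamma> = U 0 \<union> D 0"
  have U: "U n \<in> subcontinua M" "\<phi> 1 ` U n = U (n + 1)" for n
  proof -
    show "U n \<in> subcontinua M"
      unfolding U_def subcontinua_iff[OF compact_M]
      using backward_limit[OF y(1) p(2)] backward_limit[OF y(3) p(3)] pM y backward_subset
      by (auto simp del: Un_insert_left Un_insert_right intro!: connected_Un)
    show "\<phi> 1 ` U n = U (n + 1)"
      using y p by (simp add: U_def image_Un image_backward flow_Z)
  qed
  have D: "D n \<in> subcontinua M" "\<phi> 1 ` D n = D (n + 1)" for n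
  proof -
    show "D n \<in> subcontinua M"
      unfolding D_def subcontinua_iff[OF compact_M]
      using forward_limit[OF y(1) q(2)] forward_limit[OF y(3) q(3)] pM y forward_subset
      by (auto simp del: Un_insert_left Un_insert_right intro!: connected_Un)
    show "\<phi> 1 ` D n = D (n + 1)"
      using y q by (simp add: D_def image_Un image_forward flow_Z)
  qed
  have mem_U: "x \<in> U n \<longleftrightarrow> x = p \<or> (\<exists>t\<le>of_int n. x = \<phi> t y1 \<or> x = \<phi> t y2)" for x n
    by (auto simp: U_def backward_def)
  have mem_D: "x \<in> D n \<longleftrightarrow> x = q \<or> (\<exists>t\<ge>of_int n. x = \<phi> t y1 \<or> x = \<phi> t y2)" for x n
    by (auto simp: D_def forward_def)
  have mem_\<Gamma>: "x \<in> \<Gamma> \<longleftrightarrow> x = p \<or> x = q \<or> (\<exists>t. x = \<phi> t y1 \<or> x = \<phi> t y2)" for x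
    unfolding \<Gamma>_def Un_iff mem_U mem_D by (metis linorder_le_cases of_int_0)
  have U_sub: "U n \<subseteq> \<Gamma>" and D_sub: "D n \<subseteq> \<Gamma>" for n
    by (auto simp: mem_U mem_D mem_\<Gamma>)
  have \<Gamma>_inv: "\<phi> s w \<in> \<Gamma>" if "w \<in> \<Gamma>" for s w
    using that p q y unfolding mem_\<Gamma> by (metis flow_Z flow_add)
  have \<Gamma>: "compact \<Gamma>" "\<Gamma> \<subseteq> M"
    using U(1)[of 0] D(1)[of 0] by (auto simp: \<Gamma>_def subcontinua_iff[OF compact_M])
  have \<Gamma>_level: "w = y1 \<or> w = y2" if w: "w \<in> \<Gamma>" "F w = c" for w
  proof -
    have "t = 0" if "F (\<phi> t y) = c" "y = y1 \<or> y = y2" for t y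
      using that y F_strict[of y 0 t] F_strict[of y t 0]
      by (cases t "0 :: real" rule: linorder_cases) (auto simp: c_def flow_0)
    with w c y show ?thesis unfolding mem_\<Gamma> by (metis flow_0 order_less_irrefl)
  qed
  obtain r where r: "r > 0" "\<And>x t. x \<in> M \<Longrightarrow> dist x y1 < r \<Longrightarrow> dist (\<phi> t x) y2 < r \<Longrightarrow> False"
    using no_orbit_near_both[OF y(1-3,5,6)] by metis
  define K where "K = {z\<in>M. F z = c} - ball y1 r - ball y2 r"
  have "closed {z\<in>M. F z = c}"
    using continuous_closed_preimage[OF F_continuous compact_imp_closed[OF compact_M], of "{c}"]
    by (simp add: vimage_def Int_def)
  then have "closed K" by (simp add: K_def closed_Diff)
  moreover have "\<Gamma> \<inter> K = {}" using \<Gamma>_level r(1) by (fastforce simp: K_def)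
  ultimately obtain e' where e': "e' > 0" "\<And>w z. w \<in> \<Gamma> \<Longrightarrow> z \<in> K \<Longrightarrow> e' \<le> dist w z"
    using compact_closed_apart[OF \<Gamma>(1)] by metis
  obtain e0 where e0: "e0 > 0" "\<And>x w t. x \<in> M \<Longrightarrow> w \<in> M \<Longrightarrow> t \<in> {0..1} \<Longrightarrow> dist x w < e0 \<Longrightarrow> dist (\<phi> t x) (\<phi> t w) < e'"
    using uniform_time_continuity[OF e'(1), of 0 1] by metis
  define \<epsilon> where "\<epsilon> = Min {ep / 4, eq / 4, r, e0}"
  have \<epsilon>: "\<epsilon> > 0" "\<epsilon> \<le> ep / 4" "\<epsilon> \<le> eq / 4" "\<epsilon> \<le> r" "\<epsilon> \<le> e0"
    using ep(1) eq(1) r(1) e0(1) by (auto simp: \<epsilon>_def)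
  have near_p: "\<exists>N. \<forall>t\<le>-N. dist (\<phi> t y1) p < \<delta> \<and> dist (\<phi> t y2) p < \<delta>" if "\<delta> > 0" for \<delta>
  proof -
    have "\<forall>\<^sub>F t in at_bot. dist (\<phi> t y1) p < \<delta> \<and> dist (\<phi> t y2) p < \<delta>"
      using p(2,3)[THEN tendstoD, OF that] by (rule eventually_conj)
    then show ?thesis by (auto simp: eventually_at_bot_linorder) (metis minus_minus)
  qed
  have near_q: "\<exists>N. \<forall>t\<ge>N. dist (\<phi> t y1) q < \<delta> \<and> dist (\<phi> t y2) q < \<delta>" if "\<delta> > 0" for \<delta>
    using eventually_conj[OF q(2,3)[THEN tendstoD, OF that]] by (simp add: eventually_at_top_linorder)
  have jump: "\<exists>k\<ge>0. (\<forall>x\<in>D (- k) - U k. \<exists>y\<in>U k. dist x y < \<delta>) \<and>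
      (\<forall>y\<in>U k - D (- k). \<exists>x\<in>D (- k). dist y x < \<delta>)" if "\<delta> > 0" for \<delta>
  proof -
    obtain N1 where N1: "\<And>t. t \<le> - N1 \<Longrightarrow> dist (\<phi> t y1) p < \<delta> / 2 \<and> dist (\<phi> t y2) p < \<delta> / 2"
      using near_p[of "\<delta> / 2"] \<open>\<delta> > 0\<close> by auto
    obtain N2 where N2: "\<And>t. t \<ge> N2 \<Longrightarrow> dist (\<phi> t y1) q < \<delta> / 2 \<and> dist (\<phi> t y2) q < \<delta> / 2"
      using near_q[of "\<delta> / 2"] \<open>\<delta> > 0\<close> by auto
    define k where "k = max 0 (max \<lceil>N1\<rceil> \<lceil>N2\<rceil>)"
    have k: "k \<ge> 0" "of_int k \<ge> N1" "of_int k \<ge> N2"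
      unfolding k_def by (simp_all add: max_def) linarith+
    have close: "dist u v < \<delta>" if "dist u w < \<delta> / 2" "dist v w < \<delta> / 2" for u v w
      using dist_triangle2[of u v w] that by linarith
    have "\<exists>y\<in>U k. dist x y < \<delta>" if x: "x \<in> D (- k) - U k" for x
    proof -
      have "\<phi> (of_int k) y1 \<in> U k" by (auto simp: mem_U)
      moreover have "dist x q < \<delta> / 2"
        using x N2 k \<open>\<delta> > 0\<close> unfolding Diff_iff mem_U mem_D
        by (metis dist_self half_gt_zero linorder_le_cases order_trans)
      ultimately show ?thesis using close[of x q] N2[of "of_int k"] k(3) by blast
    qed
    moreover have "\<exists>x\<in>D (- k). dist y x < \<delta>" if y: "y \<in> U k - D (- k)" for y
    proof -
      have "\<phi> (of_int (- k)) y1 \<in> D (- k)" by (auto simp: mem_D)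
      moreover have "dist y p < \<delta> / 2"
      proof (cases "y = p")
        case False
        then obtain t where t: "t \<le> of_int k" "y = \<phi> t y1 \<or> y = \<phi> t y2" using y by (auto simp: mem_U)
        then have "t < of_int (- k)" using y unfolding Diff_iff mem_D by (metis not_le)
        then show ?thesis using N1[of t] t k by auto
      qed (use \<open>\<delta> > 0\<close> in auto)
      ultimately show ?thesis using close[of y p] N1[of "of_int (- k)"] k(2) by auto
    qed
    ultimately show ?thesis using k(1) by blast
  qed
  obtain A k where A: "A \<in> subcontinua M" "k \<ge> 0"
    and A_neg: "\<And>n a. n < 0 \<Longrightarrow> a \<in> A \<Longrightarrow> \<exists>u\<in>U (n + k). dist (\<phi> (of_int n) a) u < \<epsilon>"
    and A_pos: "\<And>n a. 0 \<le> n \<Longrightarrow> a \<in> A \<Longrightarrow> \<exists>d\<in>D (n - k). dist (\<phi> (of_int n) a) d < \<epsilon>"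
    and A_0: "\<And>d. d \<in> D (- k) \<Longrightarrow> \<exists>a\<in>A. dist d a < \<epsilon>"
    using shadowed_transition[OF shadowing U D jump \<epsilon>(1)] by metis
  have AM: "A \<subseteq> M" "connected A" using A by (auto simp: subcontinua_iff[OF compact_M])
  have A_\<Gamma>: "\<exists>w\<in>\<Gamma>. dist (\<phi> (of_int n) a) w < \<epsilon>" if "a \<in> A" for a n
    using A_neg[of n a] A_pos[of n a] that U_sub D_sub by (cases "n < 0") (auto simp: subset_iff)
  have lim_p: "starts_at a p" if a: "a \<in> A" for a
  proof -
    obtain N where N: "\<And>t. t \<le> - N \<Longrightarrow> dist (\<phi> t y1) p < ep / 4 \<and> dist (\<phi> t y2) p < ep / 4"
      using near_p[of "ep / 4"] ep(1) by auto
    have "dist (\<phi> (- real n) a) p < ep / 2" if n: "n \<ge> nat (\<lceil>N\<rceil> + k) + 1" for n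
    proof -
      obtain u where u: "u \<in> U (- int n + k)" "dist (\<phi> (- real n) a) u < \<epsilon>"
        using A_neg[OF _ a, of "- int n"] n by auto
      have "dist u p < ep / 4"
      proof (cases "u = p")
        case False
        then obtain t where t: "t \<le> of_int (- int n + k)" "u = \<phi> t y1 \<or> u = \<phi> t y2" using u by (auto simp: mem_U)
        have "t \<le> - N" using t(1) n by linarith
        with N[of t] t(2) show ?thesis by auto
      qed (use ep in auto)
      then show ?thesis using u(2) \<epsilon>(2) dist_triangle[of "\<phi> (- real n) a" p u] by linarith
    qed
    then show ?thesis using limit_near_point_at_bot[OF p(1) ep(2)] a AM by blast
  qed
  have lim_q: "ends_at a q" if a: "a \<in> A" for a
  proof -
    obtain N where N: "\<And>t. t \<ge> N \<Longrightarrow> dist (\<phi> t y1) q < eq / 4 \<and> dist (\<phi> t y2) q < eq / 4"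
      using near_q[of "eq / 4"] eq(1) by auto
    have "dist (\<phi> (real n) a) q < eq / 2" if n: "n \<ge> nat (\<lceil>N\<rceil> + k)" for n
    proof -
      obtain u where u: "u \<in> D (int n - k)" "dist (\<phi> (real n) a) u < \<epsilon>"
        using A_pos[OF _ a, of "int n"] by auto
      have "dist u q < eq / 4"
      proof (cases "u = q")
        case False
        then obtain t where t: "t \<ge> of_int (int n - k)" "u = \<phi> t y1 \<or> u = \<phi> t y2" using u by (auto simp: mem_D)
        have "t \<ge> N" using t(1) n by linarith
        with N[of t] t(2) show ?thesis by auto
      qed (use eq in auto)
      then show ?thesis using u(2) \<epsilon>(3) dist_triangle[of "\<phi> (real n) a" q u] by linarith
    qed
    then show ?thesis using limit_near_point[OF q(1) eq(2)] a AM by blast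
  qed
  define E where "E y = (\<Union>t. {a\<in>A. \<phi> t a \<in> ball y r})" for y
  have E_open: "openin (top_of_set A) (E y)" for y
  proof -
    have "openin (top_of_set A) (A \<inter> \<phi> t -` ball y r)" for t
      by (rule continuous_openin_preimage_gen[OF flow_continuous_space[OF AM(1)]]) simp
    moreover have "A \<inter> \<phi> t -` ball y r = {a\<in>A. \<phi> t a \<in> ball y r}" for t by auto
    ultimately show ?thesis unfolding E_def by (intro openin_Union) auto
  qed
  have "a \<in> E y1 \<union> E y2" if a: "a \<in> A" for a
  proof -
    have F_lim: "((\<lambda>t. F (\<phi> t a)) \<longlongrightarrow> F p) at_bot" "((\<lambda>t. F (\<phi> t a)) \<longlongrightarrow> F q) at_top"
      by (rule continuous_on_tendsto_compose[OF F_continuous]; use lim_p lim_q a AM pM flow_in in force)+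
    have "\<exists>s. c < F (\<phi> s a)" "\<exists>t. F (\<phi> t a) < c"
      using eventually_happens'[OF _ order_tendstoD(1)[OF F_lim(1) c(2)]]
        eventually_happens'[OF _ order_tendstoD(2)[OF F_lim(2) c(1)]] by simp_all
    then obtain u where u: "F (\<phi> u a) = c" using crossing[of a c] a AM by blast
    \<comment> \<open>The crossing time \<open>u\<close> need not be an integer; the point is followed from the preceding integer time.\<close>
    define n \<theta> where "n = \<lfloor>u\<rfloor>" and "\<theta> = u - of_int \<lfloor>u\<rfloor>"
    have \<theta>: "\<theta> \<in> {0..1}" by (simp add: \<theta>_def) linarith
    have u_eq: "\<phi> u a = \<phi> \<theta> (\<phi> (of_int n) a)"
      using flow_add[of a \<theta> "of_int n"] a AM by (auto simp: n_def \<theta>_def)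
    obtain w where w: "w \<in> \<Gamma>" "dist (\<phi> (of_int n) a) w < \<epsilon>" using A_\<Gamma>[OF a] by blast
    have "dist (\<phi> u a) (\<phi> \<theta> w) < e'"
      unfolding u_eq using w \<Gamma> a AM \<theta> \<epsilon>(5) by (intro e0(2)) (auto intro: flow_in)
    then have "\<phi> u a \<notin> K" using e'(2)[OF \<Gamma>_inv[OF w(1)], of "\<phi> u a" \<theta>] by (force simp: dist_commute)
    then have "\<phi> u a \<in> ball y1 r \<union> ball y2 r" using u a AM flow_in by (auto simp: K_def)
    then show ?thesis using a by (auto simp: E_def)
  qed
  then have "A \<subseteq> E y1 \<union> E y2" by blast
  moreover have "E y1 \<inter> E y2 = {}"
  proof -
    have False if a: "a \<in> A" "dist (\<phi> s a) y1 < r" "dist (\<phi> t a) y2 < r" for a s t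
      using r(2)[of "\<phi> s a" "t - s"] a AM flow_in flow_add[of a "t - s" s] by auto
    then show ?thesis by (fastforce simp: E_def dist_commute)
  qed
  moreover have "E y1 \<noteq> {}" "E y2 \<noteq> {}"
  proof -
    have "y1 \<in> D (- k)" "y2 \<in> D (- k)" using A(2) y flow_0 by (auto simp: mem_D intro!: exI[of _ 0])
    then obtain a1 a2 where "a1 \<in> A" "dist y1 a1 < r" "a2 \<in> A" "dist y2 a2 < r"
      using A_0 \<epsilon>(4) by (metis less_le_trans)
    then have "a1 \<in> E y1" "a2 \<in> E y2" using AM flow_0 by (auto simp: E_def subset_iff intro!: exI[of _ 0])
    then show "E y1 \<noteq> {}" "E y2 \<noteq> {}" by auto
  qed
  ultimately show False using AM(2) E_open unfolding connected_openin by blast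
qed

text \<open>By the pigeonhole principle, since there are only finitely many pairs of rest points.\<close>

corollary infinite_level_imp_not_shadowing:
  assumes "infinite {x\<in>M. F x = c}"
  shows "\<not> shadowing_property (subcontinua M) (hausdorff_dist M) (induced_map (\<phi> 1))"
proof -
  have "\<exists>pq\<in>Z \<times> Z. ((\<lambda>t. \<phi> t x) \<longlongrightarrow> fst pq) at_bot \<and> ((\<lambda>t. \<phi> t x) \<longlongrightarrow> snd pq) at_top" if "x \<in> M" for x
    using converges_at_bot[OF that] converges_at_top[OF that] by fastforce
  then obtain l where l: "\<And>x. x \<in> M \<Longrightarrow> l x \<in> Z \<times> Z \<and> ((\<lambda>t. \<phi> t x) \<longlongrightarrow> fst (l x)) at_bot \<and> ((\<lambda>t. \<phi> t x) \<longlongrightarrow> snd (l x)) at_top"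
    by metis
  let ?L = "{x\<in>M. F x = c} - Z"
  have "infinite ?L" using assms finite_Z by (simp add: Diff_infinite_finite)
  moreover have "finite (l ` ?L)" using l finite_Z by (intro finite_subset[OF _ finite_cartesian_product[OF finite_Z finite_Z]]) blast
  ultimately have "\<not> inj_on l ?L" using finite_imageD by blast
  then obtain y1 y2 where "y1 \<in> ?L" "y2 \<in> ?L" "y1 \<noteq> y2" "l y1 = l y2" by (auto simp: inj_on_def)
  then show ?thesis
    using two_connections_imp_not_shadowing[of y1 y2 "fst (l y1)" "snd (l y1)"] l[of y1] l[of y2]
    by (auto simp: mem_Times_iff)
qed

end

section \<open>One-dimensional gradient-like flows\<close>

lemma connected_subset_openin:
  assumes "connected S" "openin (top_of_set T) U" "openin (top_of_set T) V"
    and "S \<subseteq> U \<union> V" "U \<inter> V = {}" "S \<inter> U \<noteq> {}"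
  shows "S \<subseteq> U"
proof -
  obtain A B where AB: "open A" "U = T \<inter> A" "open B" "V = T \<inter> B"
    using assms(2,3) by (auto simp: openin_open)
  have "S \<subseteq> A \<union> B" "A \<inter> B \<inter> S = {}" "A \<inter> S \<noteq> {}" "S \<subseteq> T" using assms(4-6) AB(2,4) by blast+
  then have "B \<inter> S = {}" using connectedD[OF assms(1) AB(1,3)] by blast
  then show ?thesis using assms(4) AB by blast
qed

context gradient_like_flow
begin

definition orbit :: "'a \<Rightarrow> 'a set" where
  "orbit x = range (\<lambda>t. \<phi> t x)"

lemma flow_in_orbit: "\<phi> t x \<in> orbit x"
  by (simp add: orbit_def)

lemma orbit_refl: "x \<in> M \<Longrightarrow> x \<in> orbit x"
  using flow_in_orbit[of 0 x] by (simp add: flow_0)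

lemma orbit_subset: "x \<in> M \<Longrightarrow> orbit x \<subseteq> M"
  by (auto simp: orbit_def flow_in)

lemma orbit_flow: assumes "x \<in> M" shows "orbit (\<phi> s x) = orbit x"
proof -
  have "(\<lambda>t. \<phi> t (\<phi> s x)) ` UNIV = (\<lambda>t. \<phi> t x) ` ((\<lambda>t. t + s) ` UNIV)"
    unfolding image_image by (simp add: flow_add assms)
  then show ?thesis by (simp add: orbit_def)
qed

lemma orbit_eq: "x \<in> M \<Longrightarrow> y \<in> orbit x \<Longrightarrow> orbit y = orbit x"
  using orbit_flow[of x] unfolding orbit_def[of x] by auto

lemma orbit_disjoint: "x \<in> M \<Longrightarrow> y \<in> M \<Longrightarrow> orbit x \<noteq> orbit y \<Longrightarrow> orbit x \<inter> orbit y = {}"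
  using orbit_eq by blast

lemma orbit_disjoint_Z: "x \<in> M \<Longrightarrow> x \<notin> Z \<Longrightarrow> orbit x \<inter> Z = {}"
  using flow_notin_Z by (auto simp: orbit_def)

lemma connected_orbit: "x \<in> M \<Longrightarrow> connected (orbit x)"
  unfolding orbit_def by (rule connected_continuous_image[OF flow_continuous_time]) simp_all

lemma orbit_forward_backward: "orbit x = backward x T \<union> forward x T"
  unfolding orbit_def backward_def forward_def image_Un[symmetric] by (intro arg_cong[of _ _ "image _"]) auto

text \<open>The closure of an orbit adds only its two ends.\<close>

lemma closed_orbit_with_limits:
  assumes "x \<in> M" "starts_at x p" "ends_at x q"
  shows "closed (insert p (insert q (orbit x)))"
proof -
  have "insert p (insert q (orbit x)) = insert p (backward x 0) \<union> insert q (forward x 0)"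
    using orbit_forward_backward[of x 0] by auto
  then show ?thesis
    using backward_limit(1)[OF assms(1,2), of 0] forward_limit(1)[OF assms(1,3), of 0]
    by (simp add: closed_Un compact_imp_closed del: Un_insert_left Un_insert_right)
qed

lemma limit_in_closed:
  assumes "x \<in> M" "orbit x \<subseteq> C" "closed C"
  shows "((\<lambda>t. \<phi> t x) \<longlongrightarrow> p) at_bot \<Longrightarrow> p \<in> C" "((\<lambda>t. \<phi> t x) \<longlongrightarrow> q) at_top \<Longrightarrow> q \<in> C"
proof -
  have ev: "\<forall>\<^sub>F t in G. \<phi> t x \<in> C" for G
    using assms(2) by (intro always_eventually) (auto simp: orbit_def)
  show "p \<in> C" if "starts_at x p"
    using Lim_in_closed_set[OF assms(3) ev _ that] by simp
  show "q \<in> C" if "ends_at x q"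
    using Lim_in_closed_set[OF assms(3) ev _ that] by simp
qed

lemma limit_at_top_flow:
  assumes "x \<in> M" "ends_at x q"
  shows "ends_at (\<phi> s x) q"
proof -
  have "filterlim (\<lambda>t::real. s + t) at_top at_top"
    by (rule filterlim_tendsto_add_at_top[OF tendsto_const filterlim_ident])
  from filterlim_compose[OF assms(2) this] show ?thesis
    by (simp add: flow_add[OF assms(1), symmetric] add.commute)
qed

text \<open>The rest points and the other orbits form a graph; orbits are treated as sets so that they
  can be counted as its edges.\<close>

definition outgoing :: "'a \<Rightarrow> 'a set set" where
  "outgoing p = {orbit x |x. x \<in> M - Z \<and> starts_at x p}"

definition incoming :: "'a \<Rightarrow> 'a set set" where
  "incoming q = {orbit x |x. x \<in> M - Z \<and> ends_at x q}"

text \<open>A strict local maximum of \<open>F\<close>, named for its role in the flow.\<close>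

definition source :: "'a \<Rightarrow> bool" where
  "source p \<longleftrightarrow> (\<exists>N. openin (top_of_set M) N \<and> p \<in> N \<and> (\<forall>x\<in>N - {p}. F x < F p))"

definition sink :: "'a \<Rightarrow> bool" where
  "sink q \<longleftrightarrow> (\<exists>N. openin (top_of_set M) N \<and> q \<in> N \<and> (\<forall>x\<in>N - {q}. F q < F x))"

lemma orbit_in_incoming_iff:
  assumes "x \<in> M" "x \<notin> Z"
  shows "orbit x \<in> incoming q \<longleftrightarrow> ends_at x q"
proof
  assume "orbit x \<in> incoming q"
  then obtain y where y: "orbit x = orbit y" "y \<in> M" "ends_at y q"
    by (auto simp: incoming_def)
  then obtain s where "x = \<phi> s y" using orbit_refl[OF assms(1)] by (auto simp: orbit_def)
  then show "ends_at x q" using limit_at_top_flow y by simp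
qed (use assms in \<open>auto simp: incoming_def\<close>)

lemma reversed_orbit: "gradient_like_flow.orbit (\<lambda>t. \<phi> (- t)) x = orbit x"
proof -
  have "(\<lambda>t. \<phi> (- t) x) ` UNIV = (\<lambda>t. \<phi> t x) ` (uminus ` UNIV)" by (simp only: image_image)
  then show ?thesis by (simp add: gradient_like_flow.orbit_def[OF reversed] orbit_def)
qed

lemma reversed_incoming: "gradient_like_flow.incoming M (\<lambda>t. \<phi> (- t)) Z p = outgoing p"
  by (simp add: gradient_like_flow.incoming_def[OF reversed] outgoing_def reversed_orbit filterlim_at_bot_mirror)

lemma reversed_outgoing: "gradient_like_flow.outgoing M (\<lambda>t. \<phi> (- t)) Z p = incoming p"
  by (simp add: gradient_like_flow.outgoing_def[OF reversed] incoming_def reversed_orbit filterlim_at_bot_mirror)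

lemma orbit_in_outgoing_iff:
  assumes "x \<in> M" "x \<notin> Z"
  shows "orbit x \<in> outgoing p \<longleftrightarrow> starts_at x p"
  using gradient_like_flow.orbit_in_incoming_iff[OF reversed assms, of p]
  by (simp add: reversed_orbit reversed_incoming filterlim_at_bot_mirror)

end

text \<open>In a one-dimensional manifold a nondegenerate critical point cuts a small interval around it into two
  halves, and \<open>F\<close> is a strict local maximum or minimum.\<close>

definition two_sided :: "'a::metric_space set \<Rightarrow> ('a \<Rightarrow> real) \<Rightarrow> 'a set \<Rightarrow> 'a \<Rightarrow> bool" where
  "two_sided M F Z z \<longleftrightarrow> (\<exists>J1 J2. openin (top_of_set M) J1 \<and> openin (top_of_set M) J2 \<and>
     connected J1 \<and> connected J2 \<and> J1 \<inter> J2 = {} \<and> (J1 \<union> J2) \<inter> Z = {} \<and>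
     z \<in> closure J1 \<and> z \<in> closure J2 \<and> openin (top_of_set M) (insert z (J1 \<union> J2)) \<and>
     ((\<forall>x\<in>J1 \<union> J2. F x < F z) \<or> (\<forall>x\<in>J1 \<union> J2. F z < F x)))"

text \<open>One-dimensionality enters through two facts only: near a regular point \<open>F\<close> is a coordinate,
  and the rest points are two-sided.\<close>

locale one_dimensional_flow = gradient_like_flow +
  assumes connected_M: "connected M" and nonempty_M: "M \<noteq> {}"
    and regular: "x \<in> M \<Longrightarrow> x \<notin> Z \<Longrightarrow> \<exists>N. openin (top_of_set M) N \<and> x \<in> N \<and> inj_on F N"
    and two_sided: "z \<in> Z \<Longrightarrow> two_sided M F Z z"
begin

lemma reversed_one_dimensional: "one_dimensional_flow M (\<lambda>t. \<phi> (- t)) (\<lambda>x. - F x) Z"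
proof (intro one_dimensional_flow.intro reversed one_dimensional_flow_axioms.intro connected_M nonempty_M)
  show "\<exists>N. openin (top_of_set M) N \<and> x \<in> N \<and> inj_on (\<lambda>x. - F x) N" if "x \<in> M" "x \<notin> Z" for x
    using regular[OF that] by (auto simp: inj_on_def)
  show "two_sided M (\<lambda>x. - F x) Z z" if "z \<in> Z" for z
    using two_sided[OF that] unfolding two_sided_def neg_less_iff_less by meson
qed

text \<open>The values of \<open>F\<close> along the orbit fill a neighbourhood of \<open>F y\<close>, and near \<open>y\<close> a point is determined
  by its value.\<close>

lemma orbit_open:
  assumes x: "x \<in> M" "x \<notin> Z"
  shows "openin (top_of_set M) (orbit x)"
proof (subst openin_subopen, intro ballI)
  fix y assume y: "y \<in> orbit x"
  have yM: "y \<in> M" "y \<notin> Z" using y orbit_subset orbit_disjoint_Z x by blast+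
  obtain N where N: "openin (top_of_set M) N" "y \<in> N" "inj_on F N" using regular[OF yM] by blast
  have "openin (top_of_set UNIV) (UNIV \<inter> (\<lambda>t. \<phi> t y) -` N)"
    by (rule continuous_openin_preimage[OF flow_continuous_time[OF yM(1)] _ N(1)]) (auto simp: flow_in yM)
  then have "open ((\<lambda>t. \<phi> t y) -` N)" by simp
  moreover have "0 \<in> (\<lambda>t. \<phi> t y) -` N" using N(2) yM by (simp add: flow_0)
  ultimately obtain \<tau> where \<tau>: "\<tau> > 0" "cball 0 \<tau> \<subseteq> (\<lambda>t. \<phi> t y) -` N"
    unfolding open_contains_cball by blast
  define W where "W = N \<inter> (M \<inter> F -` {F (\<phi> \<tau> y) <..< F (\<phi> (- \<tau>) y)})"
  have "openin (top_of_set M) W"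
    unfolding W_def by (intro openin_Int N(1) continuous_openin_preimage_gen[OF F_continuous]) simp
  moreover have "y \<in> W"
    using N yM F_strict[OF yM, of 0 \<tau>] F_strict[OF yM, of "- \<tau>" 0] \<tau> by (simp add: W_def flow_0)
  moreover have "W \<subseteq> orbit x"
  proof
    fix z assume z: "z \<in> W"
    then obtain t where t: "- \<tau> \<le> t" "t \<le> \<tau>" "F (\<phi> t y) = F z"
      using IVT2'[of "\<lambda>t. F (\<phi> t y)" \<tau> "F z" "- \<tau>"] F_flow_continuous[OF yM(1)] \<tau>(1) by (auto simp: W_def)
    then have "t \<in> cball 0 \<tau>" by auto
    then have "\<phi> t y \<in> N" using \<tau>(2) by blast
    then have "z = \<phi> t y" using N(3) t(3) z by (auto simp: W_def inj_on_def)
    then show "z \<in> orbit x" using flow_in_orbit[of t y] orbit_eq[OF x(1) y] by simp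
  qed
  ultimately show "\<exists>T. openin (top_of_set M) T \<and> y \<in> T \<and> T \<subseteq> orbit x" by blast
qed

text \<open>Orbits form a partition into open sets, and a connected set cannot meet two of its members.\<close>

lemma connected_subset_orbit:
  assumes J: "connected J" "J \<subseteq> M" "J \<inter> Z = {}" and x: "x \<in> J"
  shows "J \<subseteq> orbit x"
proof (rule ccontr)
  assume nsub: "\<not> J \<subseteq> orbit x"
  define R where "R = (\<Union>y\<in>J - orbit x. orbit y)"
  have JM: "y \<in> M" "y \<notin> Z" if "y \<in> J" for y using J that by auto
  have "openin (top_of_set M) R"
    unfolding R_def using JM orbit_open by (intro openin_Union) auto
  moreover have "orbit x \<inter> R = {}"
  proof -
    have "orbit x \<inter> orbit y = {}" if "y \<in> J - orbit x" for y
      using that orbit_refl JM[of y] JM[OF x] orbit_disjoint[of x y] by auto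
    then show ?thesis by (auto simp: R_def)
  qed
  moreover have "J \<subseteq> orbit x \<union> R" "J \<inter> orbit x \<noteq> {}"
    using x orbit_refl JM by (auto simp: R_def)
  ultimately show False
    using connected_subset_openin[OF J(1) orbit_open[OF JM[OF x]], of R] nsub by blast
qed

lemma source_or_sink: "z \<in> Z \<Longrightarrow> source z \<or> sink z"
proof -
  assume "z \<in> Z"
  then obtain J where "openin (top_of_set M) (insert z J)" "(\<forall>x\<in>J. F x < F z) \<or> (\<forall>x\<in>J. F z < F x)"
    using two_sided[of z] unfolding two_sided_def by meson
  then show ?thesis
    unfolding source_def sink_def by (metis DiffE insertE insertI1 singletonI)
qed

text \<open>Each of the two half-neighbourhoods is connected and hence part of a single orbit. This orbit comes
  from \<open>z\<close>, because \<open>z\<close> lies in its closure and above its values of \<open>F\<close>; conversely, an orbit that has \<open>z\<close> as an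
  end passes through one of the two halves. The two orbits are different, because
  the final piece of a backward orbit cannot change from one half to the other.\<close>

lemma outgoing_source:
  assumes z: "z \<in> Z" "source z"
  shows "card (outgoing z) = 2" and "incoming z = {}"
    and "openin (top_of_set M) (insert z (\<Union>(outgoing z)))"
proof -
  obtain J1 J2 where J: "openin (top_of_set M) J1" "openin (top_of_set M) J2" "connected J1" "connected J2"
      "J1 \<inter> J2 = {}" "(J1 \<union> J2) \<inter> Z = {}" "z \<in> closure J1" "z \<in> closure J2"
      "openin (top_of_set M) (insert z (J1 \<union> J2))"
      "(\<forall>x\<in>J1 \<union> J2. F x < F z) \<or> (\<forall>x\<in>J1 \<union> J2. F z < F x)"
    using two_sided[OF z(1)] unfolding two_sided_def by metis
  have zM: "z \<in> M" using z Z_subset by auto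
  have JM: "J1 \<subseteq> M" "J2 \<subseteq> M" using openin_imp_subset[OF J(1)] openin_imp_subset[OF J(2)] by simp_all
  have meets: "\<exists>x\<in>J. x \<in> N" if N: "openin (top_of_set M) N" "z \<in> N" "z \<in> closure J" "J \<subseteq> M" for J N
  proof -
    obtain O' where O': "open O'" "N = M \<inter> O'" using N(1) by (metis openin_open)
    then have "J \<inter> O' \<noteq> {}" using N(2,3) open_Int_closure_eq_empty[OF O'(1), of J] by blast
    then show ?thesis using N(4) O'(2) by blast
  qed
  have F_J: "F x < F z" if "x \<in> J1 \<union> J2" for x
  proof -
    obtain N where N: "openin (top_of_set M) N" "z \<in> N" "\<forall>x\<in>N - {z}. F x < F z"
      using z(2) unfolding source_def by auto
    obtain x' where "x' \<in> J1" "x' \<in> N" using meets[OF N(1,2) J(7) JM(1)] by blast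
    moreover have "x' \<noteq> z" using J(6) z(1) \<open>x' \<in> J1\<close> by blast
    ultimately have "F x' < F z" using N(3) by blast
    with \<open>x' \<in> J1\<close> J(10) that show ?thesis by (meson UnI1 less_asym)
  qed
  have from_z: "starts_at x z" if x: "x \<in> J" "z \<in> closure J" "connected J" "J \<subseteq> J1 \<union> J2" for x J
  proof -
    have JM': "J \<subseteq> M" "J \<inter> Z = {}" using x(4) JM J(6) by blast+
    then have xM: "x \<in> M" "x \<notin> Z" using x(1) by blast+
    obtain p q where p: "p \<in> Z" "starts_at x p" and q: "q \<in> Z" "ends_at x q"
      using converges_at_bot converges_at_top xM by meson
    have "J \<subseteq> orbit x" by (rule connected_subset_orbit[OF x(3) JM' x(1)])
    then have "z \<in> insert p (insert q (orbit x))"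
      using x(2) closure_minimal[OF _ closed_orbit_with_limits[OF xM(1) p(2) q(2)], of J] by auto
    moreover have "z \<notin> orbit x" using orbit_disjoint_Z[OF xM] z(1) by blast
    moreover have "F q < F x"
      using F_limit_less[OF xM _ q(2), of 0] q(1) Z_subset xM(1) by (simp add: flow_0 subset_iff)
    moreover have "F x < F z" using F_J x(1,4) by blast
    ultimately show ?thesis using p(2) by auto
  qed
  obtain x1 x2 where x12: "x1 \<in> J1" "x2 \<in> J2" using J(7,8) by (metis all_not_in_conv closure_empty)
  have xM: "x1 \<in> M" "x1 \<notin> Z" "x2 \<in> M" "x2 \<notin> Z" using x12 JM J(6) by blast+
  have lim: "starts_at x1 z" "starts_at x2 z"
    using from_z[OF x12(1) J(7,3)] from_z[OF x12(2) J(8,4)] by simp_all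
  have J_orbit: "J1 \<subseteq> orbit x1" "J2 \<subseteq> orbit x2"
    using connected_subset_orbit[OF J(3) JM(1) _ x12(1)] connected_subset_orbit[OF J(4) JM(2) _ x12(2)] J(6)
    by blast+
  have enters: "\<forall>\<^sub>F t in G. \<phi> t x \<in> J1 \<union> J2"
    if "x \<in> M" "x \<notin> Z" "((\<lambda>t. \<phi> t x) \<longlongrightarrow> z) G" for x G
  proof -
    obtain O' where O': "open O'" "insert z (J1 \<union> J2) = M \<inter> O'" using J(9) by (metis openin_open)
    then have "\<forall>\<^sub>F t in G. \<phi> t x \<in> O'" using that(3) by (intro topological_tendstoD) auto
    then show ?thesis
    proof eventually_elim
      case (elim t)
      then have "\<phi> t x \<in> insert z (J1 \<union> J2)" using O'(2) flow_in[OF that(1)] by blast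
      moreover have "\<phi> t x \<noteq> z" using flow_notin_Z[OF that(1,2), of t] z(1) by auto
      ultimately show ?case by simp
    qed
  qed
  show out_open: "openin (top_of_set M) (insert z (\<Union>(outgoing z)))"
  proof -
    have out: "orbit x1 \<in> outgoing z" "orbit x2 \<in> outgoing z"
      using orbit_in_outgoing_iff lim xM by auto
    then have "insert z (\<Union>(outgoing z)) = insert z (J1 \<union> J2) \<union> \<Union>(outgoing z)"
      using J_orbit by auto
    moreover have "openin (top_of_set M) (\<Union>(outgoing z))"
      using orbit_open by (intro openin_Union) (auto simp: outgoing_def)
    ultimately show ?thesis using J(9) by (metis openin_Un)
  qed
  have "outgoing z = {orbit x1, orbit x2}"
  proof
    show "{orbit x1, orbit x2} \<subseteq> outgoing z" using orbit_in_outgoing_iff lim xM by auto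
    show "outgoing z \<subseteq> {orbit x1, orbit x2}"
    proof
      fix e assume "e \<in> outgoing z"
      then obtain x where x: "e = orbit x" "x \<in> M" "x \<notin> Z" "starts_at x z"
        by (auto simp: outgoing_def)
      obtain t where "\<phi> t x \<in> J1 \<union> J2"
        using eventually_happens[OF enters[OF x(2-4)]] by auto
      then have "\<phi> t x \<in> orbit x1 \<or> \<phi> t x \<in> orbit x2" using J_orbit by blast
      then have "orbit (\<phi> t x) = orbit x1 \<or> orbit (\<phi> t x) = orbit x2"
        using orbit_eq[OF xM(1)] orbit_eq[OF xM(3)] by blast
      then show "e \<in> {orbit x1, orbit x2}" by (simp add: orbit_flow[OF x(2)] x(1))
    qed
  qed
  moreover have "orbit x1 \<noteq> orbit x2"
  proof
    assume same: "orbit x1 = orbit x2"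
    obtain T where T: "\<And>t. t \<le> T \<Longrightarrow> \<phi> t x1 \<in> J1 \<union> J2"
      using enters[OF xM(1,2) lim(1)] by (auto simp: eventually_at_bot_linorder)
    have conn: "connected (backward x1 T)"
      unfolding backward_def by (rule connected_continuous_image[OF flow_continuous_time[OF xM(1)]]) simp
    have "backward x1 T \<subseteq> J1 \<or> backward x1 T \<subseteq> J2"
    proof (rule ccontr)
      assume "\<not> ?thesis"
      moreover have "backward x1 T \<subseteq> J1 \<union> J2" using T by (auto simp: backward_def)
      ultimately show False
        using connected_subset_openin[OF conn J(1,2)] J(5) by blast
    qed
    then obtain J where J': "J = J1 \<or> J = J2" "backward x1 T \<inter> J = {}" using J(5) by blast
    have Tz: "F (\<phi> T x1) < F z" using T[of T] F_J by simp
    have "openin (top_of_set M) (M \<inter> F -` {F (\<phi> T x1) <..})"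
      by (rule continuous_openin_preimage_gen[OF F_continuous]) simp
    then obtain w where w: "w \<in> J" "F (\<phi> T x1) < F w"
      using meets[of "M \<inter> F -` {F (\<phi> T x1) <..}" J] zM Tz J(7,8) J'(1) JM by auto
    then have "w \<in> orbit x1" using J_orbit J'(1) same by auto
    then obtain t where t: "w = \<phi> t x1" by (auto simp: orbit_def)
    have "t \<le> T" using F_mono[OF xM(1), of T t] w(2) t by (cases "t \<le> T") auto
    then have "w \<in> backward x1 T" by (auto simp: backward_def t)
    with J'(2) w show False by auto
  qed
  ultimately show "card (outgoing z) = 2" by simp
  show "incoming z = {}"
  proof (rule ccontr)
    assume "incoming z \<noteq> {}"
    then obtain x where x: "x \<in> M" "x \<notin> Z" "ends_at x z"
      by (auto simp: incoming_def)
    obtain t where "\<phi> t x \<in> J1 \<union> J2" using eventually_happens[OF enters[OF x]] by auto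
    then show False using F_J F_limit_less[OF x(1,2) zM x(3), of t] by fastforce
  qed
qed

lemma incoming_sink:
  assumes z: "z \<in> Z" "sink z"
  shows "card (incoming z) = 2" and "outgoing z = {}"
proof -
  interpret rev: one_dimensional_flow M "\<lambda>t. \<phi> (- t)" "\<lambda>x. - F x" Z by (rule reversed_one_dimensional)
  have "rev.source z" using z(2) by (simp add: rev.source_def sink_def)
  from rev.outgoing_source(1,2)[OF z(1) this]
  show "card (incoming z) = 2" "outgoing z = {}"
    by (simp_all add: reversed_incoming reversed_outgoing)
qed

end

section \<open>Orbits in a one-dimensional manifold do not separate\<close>

context one_dimensional_flow
begin

lemma outgoing_disjoint: "p \<noteq> p' \<Longrightarrow> outgoing p \<inter> outgoing p' = {}"
proof -
  assume ne: "p \<noteq> p'"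
  have False if e: "e \<in> outgoing p" "e \<in> outgoing p'" for e
  proof -
    obtain x where x: "e = orbit x" "x \<in> M" "x \<notin> Z" using e(1) by (auto simp: outgoing_def)
    then have "starts_at x p" "starts_at x p'"
      using e orbit_in_outgoing_iff by simp_all
    then show False using ne tendsto_unique[OF trivial_limit_at_bot_linorder] by blast
  qed
  then show ?thesis by blast
qed

lemma closed_orbit_complement:
  assumes "x \<in> M" "x \<notin> Z"
  shows "closed (M - orbit x)"
proof -
  obtain O' where "open O'" "orbit x = M \<inter> O'" using orbit_open[OF assms] by (metis openin_open)
  then show ?thesis using compact_imp_closed[OF compact_M] by (simp add: Diff_Int closed_Diff)
qed

text \<open>A source contributes 2 and a sink contributes 0, without overlaps.\<close>

lemma even_outgoing: "finite (\<Union>z\<in>Z \<inter> U. outgoing z) \<and> even (card (\<Union>z\<in>Z \<inter> U. outgoing z))"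
proof -
  have card: "card (outgoing z) = 2 \<or> outgoing z = {}" if "z \<in> Z" for z
    using source_or_sink[OF that] outgoing_source(1)[OF that] incoming_sink(2)[OF that] by blast
  then have fin: "finite (outgoing z)" if "z \<in> Z" for z
    using that by (metis card_ge_0_finite finite.emptyI zero_less_numeral)
  have "card (\<Union>z\<in>Z \<inter> U. outgoing z) = (\<Sum>z\<in>Z \<inter> U. card (outgoing z))"
    using finite_Z fin outgoing_disjoint by (intro card_UN_disjoint) auto
  moreover have "even (card (outgoing z))" if "z \<in> Z" for z using card[OF that] by auto
  then have "even (\<Sum>z\<in>Z \<inter> U. card (outgoing z))" by (intro dvd_sum) blast
  ultimately show ?thesis using finite_Z fin by auto
qed

lemma even_incoming: "finite (\<Union>z\<in>Z \<inter> U. incoming z) \<and> even (card (\<Union>z\<in>Z \<inter> U. incoming z))"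
  using one_dimensional_flow.even_outgoing[OF reversed_one_dimensional] by (simp add: reversed_outgoing)

text \<open>Suppose that removing \<open>orbit x\<close> separates its ends. Let \<open>E\<close> be the set of the remaining orbits on
  the side \<open>U\<close> of \<open>p\<close>. They are the orbits that end in \<open>U\<close>, so their number is even. Together with \<open>orbit x\<close>
  they are the orbits that start in \<open>U\<close>, and this number is even, too.\<close>

lemma no_separation_of_ends:
  assumes x: "x \<in> M" "x \<notin> Z" "starts_at x p" "ends_at x q"
    and UV: "closed U" "closed V" "M - orbit x = U \<union> V" "U \<inter> V = {}" and "p \<in> U" "q \<in> V"
  shows False
proof -
  let ?\<gamma> = "orbit x"
  define E where "E = {e \<in> orbit ` (M - Z). e \<noteq> ?\<gamma> \<and> e \<subseteq> U}"
  have side: "orbit y \<subseteq> U \<or> orbit y \<subseteq> V" if y: "y \<in> M" "y \<notin> Z" "orbit y \<noteq> ?\<gamma>" for y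
  proof -
    have "orbit y \<subseteq> U \<union> V" using orbit_subset[OF y(1)] orbit_disjoint[OF y(1) x(1) y(3)] UV(3) by blast
    then show ?thesis
      using connected_closedD[OF connected_orbit[OF y(1)], of U V] UV(1,2,4) by blast
  qed
  have E_in: "E = (\<Union>z\<in>Z \<inter> U. incoming z)"
  proof (intro equalityI subsetI)
    fix e assume "e \<in> E"
    then obtain y where y: "e = orbit y" "y \<in> M" "y \<notin> Z" "orbit y \<subseteq> U" by (auto simp: E_def)
    obtain z where z: "z \<in> Z" "ends_at y z" using converges_at_top[OF y(2)] by blast
    then have "e \<in> incoming z" using orbit_in_incoming_iff y by simp
    then show "e \<in> (\<Union>z\<in>Z \<inter> U. incoming z)" using z limit_in_closed(2)[OF y(2,4) UV(1) z(2)] by blast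
  next
    fix e assume "e \<in> (\<Union>z\<in>Z \<inter> U. incoming z)"
    then obtain z where z: "z \<in> Z" "z \<in> U" "e \<in> incoming z" by blast
    then obtain y where y: "e = orbit y" "y \<in> M" "y \<notin> Z" by (auto simp: incoming_def)
    then have lim: "ends_at y z" using z(3) orbit_in_incoming_iff by simp
    have "e \<noteq> ?\<gamma>"
    proof
      assume "e = ?\<gamma>"
      then have "ends_at x z" using z(3) orbit_in_incoming_iff x by simp
      then have "z = q" using x(4) tendsto_unique[OF trivial_limit_at_top_linorder] by blast
      then show False using z(2) \<open>q \<in> V\<close> UV(4) by blast
    qed
    moreover have "\<not> orbit y \<subseteq> V" using limit_in_closed(2)[OF y(2) _ UV(2) lim] z(2) UV(4) by blast
    ultimately show "e \<in> E" using side[OF y(2,3)] y by (auto simp: E_def)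
  qed
  have E_out: "insert ?\<gamma> E = (\<Union>z\<in>Z \<inter> U. outgoing z)"
  proof (intro equalityI subsetI)
    fix e assume e: "e \<in> insert ?\<gamma> E"
    then obtain y where y: "e = orbit y" "y \<in> M" "y \<notin> Z" using x by (auto simp: E_def)
    obtain z where z: "z \<in> Z" "starts_at y z" using converges_at_bot[OF y(2)] by blast
    then have out: "e \<in> outgoing z" using orbit_in_outgoing_iff y by simp
    have "z \<in> U"
    proof (cases "e = ?\<gamma>")
      case True
      then have "starts_at x z" using out orbit_in_outgoing_iff x by simp
      then have "z = p" using x(3) tendsto_unique[OF trivial_limit_at_bot_linorder] by blast
      then show ?thesis using \<open>p \<in> U\<close> by simp
    next
      case False
      then have "orbit y \<subseteq> U" using e y(1) by (auto simp: E_def)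
      then show ?thesis using limit_in_closed(1)[OF y(2) _ UV(1) z(2)] by blast
    qed
    then show "e \<in> (\<Union>z\<in>Z \<inter> U. outgoing z)" using z(1) out by blast
  next
    fix e assume "e \<in> (\<Union>z\<in>Z \<inter> U. outgoing z)"
    then obtain z where z: "z \<in> Z" "z \<in> U" "e \<in> outgoing z" by blast
    then obtain y where y: "e = orbit y" "y \<in> M" "y \<notin> Z" by (auto simp: outgoing_def)
    then have lim: "starts_at y z" using z(3) orbit_in_outgoing_iff by simp
    have "\<not> orbit y \<subseteq> V" using limit_in_closed(1)[OF y(2) _ UV(2) lim] z(2) UV(4) by blast
    then show "e \<in> insert ?\<gamma> E" using side[OF y(2,3)] y by (auto simp: E_def)
  qed
  have "?\<gamma> \<notin> E" by (simp add: E_def)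
  then have "card (insert ?\<gamma> E) = Suc (card E)" using even_incoming[of U] by (simp add: E_in[symmetric])
  then show False using even_incoming[of U] even_outgoing[of U] by (simp add: E_in[symmetric] E_out[symmetric])
qed

text \<open>If the ends of the orbit are on the same side of a separation of its complement, the orbit can be added
  to this side, which separates \<open>M\<close>. If they are on different sides, the parity argument applies.\<close>

lemma connected_orbit_complement:
  assumes x: "x \<in> M" "x \<notin> Z"
  shows "connected (M - orbit x)"
proof (rule ccontr)
  assume nc: "\<not> connected (M - orbit x)"
  obtain p q where p: "p \<in> Z" "starts_at x p" and q: "q \<in> Z" "ends_at x q"
    using converges_at_bot[OF x(1)] converges_at_top[OF x(1)] by blast
  have closed_L: "closed (M - orbit x)" by (rule closed_orbit_complement[OF x])
  obtain A B where AB: "closed A" "closed B" "M - orbit x \<subseteq> A \<union> B" "A \<inter> B \<inter> (M - orbit x) = {}"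
      "A \<inter> (M - orbit x) \<noteq> {}" "B \<inter> (M - orbit x) \<noteq> {}"
    using nc unfolding connected_closed by blast
  define U V where "U = A \<inter> (M - orbit x)" and "V = B \<inter> (M - orbit x)"
  have UV: "closed U" "closed V" "M - orbit x = U \<union> V" "U \<inter> V = {}" "U \<noteq> {}" "V \<noteq> {}"
    using AB closed_L by (auto simp: U_def V_def)
  have pq: "p \<in> U \<union> V" "q \<in> U \<union> V"
    using p(1) q(1) Z_subset orbit_disjoint_Z[OF x] UV(3)[symmetric] by auto
  \<comment> \<open>Stated for arbitrary sets, as it is used for \<open>U\<close> and \<open>V\<close> in both orders.\<close>
  have not_same: False
    if *: "closed U" "closed V" "M - orbit x = U \<union> V" "U \<inter> V = {}" "V \<noteq> {}" "p \<in> U" "q \<in> U" for U V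
  proof -
    have "U \<union> orbit x = U \<union> insert p (insert q (orbit x))" using *(6,7) by blast
    then have "closed (U \<union> orbit x)"
      using *(1) closed_orbit_with_limits[OF x(1) p(2) q(2)] by (metis closed_Un)
    moreover have "M \<subseteq> (U \<union> orbit x) \<union> V" "(U \<union> orbit x) \<inter> V = {}" using *(3,4) by blast+
    moreover have "x \<in> U \<union> orbit x" using orbit_refl[OF x(1)] by blast
    moreover have "V \<inter> M \<noteq> {}" using *(3,5) by blast
    ultimately show False
      using connected_closedD[OF connected_M, of "U \<union> orbit x" V] *(2) x(1) by blast
  qed
  show False
    using pq not_same[OF UV(1-4,6)] not_same[OF UV(2,1)] UV
      no_separation_of_ends[OF x p(2) q(2) UV(1-4)] no_separation_of_ends[OF x p(2) q(2) UV(2,1)]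
    by (metis Int_commute Un_commute Un_iff)
qed

lemma image_orbit_complement: "x \<in> M \<Longrightarrow> \<phi> s ` (M - orbit x) = M - orbit x"
proof -
  assume x: "x \<in> M"
  have "\<phi> s ` (M - orbit x) = \<phi> s ` M - \<phi> s ` orbit x"
    using orbit_subset[OF x] flow_inj by (intro inj_on_image_set_diff[of _ M]) (auto intro: inj_onI)
  also have "\<phi> s ` orbit x = orbit x"
  proof -
    have "\<phi> s ` orbit x = \<phi> s ` backward x 0 \<union> \<phi> s ` forward x 0"
      using orbit_forward_backward[of x 0] by (simp add: image_Un)
    then show ?thesis using orbit_forward_backward[of x s] by (simp add: image_forward image_backward x)
  qed
  finally show ?thesis by (simp add: flow_image)
qed

lemma exists_source: "\<exists>p\<in>Z. source p"
proof -
  obtain p where p: "p \<in> M" "\<And>x. x \<in> M \<Longrightarrow> F x \<le> F p"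
    using continuous_attains_sup[OF compact_M nonempty_M F_continuous] by blast
  have "p \<in> Z"
  proof (rule ccontr)
    assume "p \<notin> Z"
    then have "F p < F (\<phi> (- 1) p)" using F_strict[OF p(1), of "- 1" 0] p(1) by (simp add: flow_0)
    then show False using p(2)[OF flow_in[OF p(1)], of "- 1"] by simp
  qed
  moreover have "source p"
  proof -
    obtain J1 J2 where J: "openin (top_of_set M) J1" "p \<in> closure J1" "openin (top_of_set M) (insert p (J1 \<union> J2))"
      "(\<forall>x\<in>J1 \<union> J2. F x < F p) \<or> (\<forall>x\<in>J1 \<union> J2. F p < F x)"
      using two_sided[OF \<open>p \<in> Z\<close>] unfolding two_sided_def by metis
    obtain x where x: "x \<in> J1" using J(2) by (metis all_not_in_conv closure_empty)
    then have "x \<in> M" using openin_imp_subset[OF J(1)] by blast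
    then have "\<not> F p < F x" using p(2)[of x] by simp
    then have "\<forall>x\<in>J1 \<union> J2. F x < F p" using J(4) x by blast
    then show ?thesis unfolding source_def using J(3) by (metis DiffE insertE insertI1 singletonI)
  qed
  ultimately show ?thesis by blast
qed

text \<open>The arc \<open>U n\<close> is \<open>M\<close> without the part of \<open>\<gamma>\<close> after time \<open>n\<close>, and \<open>D n\<close> is \<open>M\<close> without the part of \<open>\<gamma>'\<close> before
  time \<open>n\<close>. Points of \<open>\<gamma>\<close> that are far down at time 0 come from the middle of \<open>\<gamma>\<close>, which is far from \<open>U n\<close> for
  negative \<open>n\<close>; so a shadowing continuum does not contain them. In the same way it contains no points of \<open>\<gamma>'\<close>
  close to \<open>p\<close>. These two bounds make the sets \<open>C\<close> and \<open>C'\<close>, which separate the continuum, closed.\<close>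

theorem one_dimensional_not_shadowing:
  "\<not> shadowing_property (subcontinua M) (hausdorff_dist M) (induced_map (\<phi> 1))"
proof
  assume shadowing: "shadowing_property (subcontinua M) (hausdorff_dist M) (induced_map (\<phi> 1))"
  obtain p where p: "p \<in> Z" "source p" using exists_source by blast
  obtain e e' where e: "e \<noteq> e'" "outgoing p = {e, e'}" using outgoing_source(1)[OF p] by (auto simp: card_2_iff)
  have "e \<in> outgoing p" "e' \<in> outgoing p" using e(2) by simp_all
  then obtain y y' where y: "e = orbit y" "y \<in> M" "y \<notin> Z" "starts_at y p"
    and y': "e' = orbit y'" "y' \<in> M" "y' \<notin> Z" "starts_at y' p"
    unfolding outgoing_def by blast
  obtain q where q: "q \<in> Z" "ends_at y q" using converges_at_top[OF y(2)] by blast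
  obtain q' where q': "q' \<in> Z" "ends_at y' q'" using converges_at_top[OF y'(2)] by blast
  define \<gamma> \<gamma>' where "\<gamma> = orbit y" and "\<gamma>' = orbit y'"
  have disj: "\<gamma> \<inter> \<gamma>' = {}" using orbit_disjoint[OF y(2) y'(2)] e(1) y(1) y'(1) by (simp add: \<gamma>_def \<gamma>'_def)
  have ZM: "p \<in> M" "q \<in> M" "q' \<in> M" using p q q' Z_subset by auto
  have no_Z: "\<gamma> \<inter> Z = {}" "\<gamma>' \<inter> Z = {}" using orbit_disjoint_Z y y' by (simp_all add: \<gamma>_def \<gamma>'_def)
  have sub: "\<gamma> \<subseteq> M" "\<gamma>' \<subseteq> M" using orbit_subset y y' by (simp_all add: \<gamma>_def \<gamma>'_def)
  define U where "U n = (M - \<gamma>) \<union> insert p (backward y (of_int n))" for n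
  define D where "D n = (M - \<gamma>') \<union> insert q' (forward y' (of_int n))" for n
  have compl: "compact (M - orbit x)" "connected (M - orbit x)" "closed (M - orbit x)" if "x \<in> M" "x \<notin> Z" for x
    using closed_orbit_complement[OF that] connected_orbit_complement[OF that] compact_Int_closed[OF compact_M, of "M - orbit x"]
    by (simp_all add: inf.absorb2)
  have U: "U n \<in> subcontinua M" "\<phi> 1 ` U n = U (n + 1)" for n
  proof -
    have "p \<in> (M - orbit y) \<inter> insert p (backward y (of_int n))" using ZM no_Z p(1) by (auto simp: \<gamma>_def)
    then have "connected (U n)" unfolding U_def \<gamma>_def
      by (intro connected_Un compl(2)[OF y(2,3)] backward_limit(2)[OF y(2,4)]) blast
    moreover have "compact (U n)" unfolding U_def \<gamma>_def
      by (intro compact_Un compl(1)[OF y(2,3)] backward_limit(1)[OF y(2,4)])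
    moreover have "U n \<subseteq> M" "U n \<noteq> {}" using backward_subset[OF y(2)] ZM by (auto simp: U_def)
    ultimately show "U n \<in> subcontinua M" by (simp add: subcontinua_iff[OF compact_M])
    show "\<phi> 1 ` U n = U (n + 1)"
      using y p by (simp add: U_def \<gamma>_def image_Un image_orbit_complement image_backward flow_Z)
  qed
  have D: "D n \<in> subcontinua M" "\<phi> 1 ` D n = D (n + 1)" for n
  proof -
    have "q' \<in> (M - orbit y') \<inter> insert q' (forward y' (of_int n))" using ZM no_Z q'(1) by (auto simp: \<gamma>'_def)
    then have "connected (D n)" unfolding D_def \<gamma>'_def
      by (intro connected_Un compl(2)[OF y'(2,3)] forward_limit(2)[OF y'(2) q'(2)]) blast
    moreover have "compact (D n)" unfolding D_def \<gamma>'_def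
      by (intro compact_Un compl(1)[OF y'(2,3)] forward_limit(1)[OF y'(2) q'(2)])
    moreover have "D n \<subseteq> M" "D n \<noteq> {}" using forward_subset[OF y'(2)] ZM by (auto simp: D_def)
    ultimately show "D n \<in> subcontinua M" by (simp add: subcontinua_iff[OF compact_M])
    show "\<phi> 1 ` D n = D (n + 1)"
      using y' q' by (simp add: D_def \<gamma>'_def image_Un image_orbit_complement image_forward flow_Z)
  qed
  have in_\<gamma>: "\<phi> t y \<in> \<gamma>" "\<phi> t y' \<in> \<gamma>'" for t by (simp_all add: \<gamma>_def \<gamma>'_def flow_in_orbit)
  have gaps: "\<exists>t>of_int n. x = \<phi> t y" if x: "x \<in> M" "x \<notin> U n" for x n
  proof -
    obtain t where t: "x = \<phi> t y" using x by (auto simp: U_def \<gamma>_def orbit_def)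
    then have "\<not> t \<le> of_int n" using x(2) by (auto simp: U_def backward_def)
    then show ?thesis using t by (intro exI[of _ t]) simp
  qed
  have gaps': "\<exists>t<of_int n. x = \<phi> t y'" if x: "x \<in> M" "x \<notin> D n" for x n
  proof -
    obtain t where t: "x = \<phi> t y'" using x by (auto simp: D_def \<gamma>'_def orbit_def)
    then have "\<not> t \<ge> of_int n" using x(2) by (auto simp: D_def forward_def)
    then show ?thesis using t by (intro exI[of _ t]) simp
  qed
  have UM: "U n \<subseteq> M" "D n \<subseteq> M" for n using U(1) D(1) by (auto simp: subcontinua_iff[OF compact_M])
  have jump: "\<exists>k\<ge>0. (\<forall>x\<in>D (- k) - U k. \<exists>y\<in>U k. dist x y < \<delta>) \<and>
      (\<forall>y\<in>U k - D (- k). \<exists>x\<in>D (- k). dist y x < \<delta>)" if "\<delta> > 0" for \<delta>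
  proof -
    obtain N1 where N1: "\<And>t. t \<le> N1 \<Longrightarrow> dist (\<phi> t y') p < \<delta>"
      using tendstoD[OF y'(4) \<open>\<delta> > 0\<close>] by (auto simp: eventually_at_bot_linorder)
    obtain N2 where N2: "\<And>t. t \<ge> N2 \<Longrightarrow> dist (\<phi> t y) q < \<delta>"
      using tendstoD[OF q(2) \<open>\<delta> > 0\<close>] by (auto simp: eventually_at_top_linorder)
    define k where "k = max 0 (max \<lceil>- N1\<rceil> \<lceil>N2\<rceil>)"
    have k: "k \<ge> 0" "of_int k \<ge> - N1" "of_int k \<ge> N2"
      unfolding k_def by (simp_all add: max_def) linarith+
    have "\<exists>y\<in>U k. dist x y < \<delta>" if x: "x \<in> D (- k) - U k" for x
    proof -
      obtain t where "t > of_int k" "x = \<phi> t y" using gaps[of x k] x UM by blast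
      then have "dist x q < \<delta>" using N2[of t] k(3) by simp
      moreover have "q \<in> U k" using ZM q(1) no_Z by (auto simp: U_def)
      ultimately show ?thesis by blast
    qed
    moreover have "\<exists>x\<in>D (- k). dist z x < \<delta>" if z: "z \<in> U k - D (- k)" for z
    proof -
      obtain t where "t < of_int (- k)" "z = \<phi> t y'" using gaps'[of z "- k"] z UM by blast
      then have "dist z p < \<delta>" using N1[of t] k(2) by simp
      moreover have "p \<in> D (- k)" using ZM p(1) no_Z by (auto simp: D_def)
      ultimately show ?thesis by blast
    qed
    ultimately show ?thesis using k(1) by blast
  qed
  have ball: "\<exists>r>0. \<forall>w\<in>M. dist x w < r \<longrightarrow> w \<in> orbit x" if x: "x \<in> M" "x \<notin> Z" for x
    using orbit_open[OF x] orbit_refl[OF x(1)] unfolding openin_euclidean_subtopology_iff by (metis dist_commute)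
  obtain r where r: "r > 0" "\<And>w. w \<in> M \<Longrightarrow> dist y w < r \<Longrightarrow> w \<in> \<gamma>"
    using ball[OF y(2,3)] by (auto simp: \<gamma>_def)
  obtain r' where r': "r' > 0" "\<And>w. w \<in> M \<Longrightarrow> dist y' w < r' \<Longrightarrow> w \<in> \<gamma>'"
    using ball[OF y'(2,3)] by (auto simp: \<gamma>'_def)
  have F_inj: "s = t" if "x \<in> M" "x \<notin> Z" "\<phi> s x = \<phi> t x" for x s t
    using F_strict[OF that(1,2), of s t] F_strict[OF that(1,2), of t s] that(3)
    by (cases s t rule: linorder_cases) auto
  have seg: "compact ((\<lambda>t. \<phi> t x) ` {a..b})" if "x \<in> M" for x a b
    by (rule compact_continuous_image[OF flow_continuous_time[OF that]]) simp
  \<comment> \<open>The piece \<open>{0..1}\<close> is a fundamental domain: the backward orbit of each point of \<open>\<gamma>\<close> further down passes through it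
    at an integer time.\<close>
  obtain d where d: "d > 0" "\<And>t u. t \<in> {0..1} \<Longrightarrow> u \<in> U (- 1) \<Longrightarrow> d \<le> dist (\<phi> t y) u"
  proof (rule compact_closed_apart[OF seg[OF y(2), of 0 1]])
    show "closed (U (- 1))" using U(1)[of "- 1"] by (simp add: subcontinua_iff[OF compact_M] compact_imp_closed)
    have "\<phi> t y \<notin> U (- 1)" if "t \<in> {0..1}" for t
      using that F_inj[OF y(2,3), of t] in_\<gamma>(1)[of t] no_Z p(1) by (fastforce simp: U_def backward_def)
    then show "(\<lambda>t. \<phi> t y) ` {0..1} \<inter> U (- 1) = {}" by blast
  qed blast
  obtain d' where d': "d' > 0" "\<And>t u. t \<in> {-1..0} \<Longrightarrow> u \<in> D 1 \<Longrightarrow> d' \<le> dist (\<phi> t y') u"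
  proof (rule compact_closed_apart[OF seg[OF y'(2), of "- 1" 0]])
    show "closed (D 1)" using D(1)[of 1] by (simp add: subcontinua_iff[OF compact_M] compact_imp_closed)
    have "\<phi> t y' \<notin> D 1" if "t \<in> {-1..0}" for t
      using that F_inj[OF y'(2,3), of t] in_\<gamma>(2)[of t] no_Z q'(1) by (fastforce simp: D_def forward_def)
    then show "(\<lambda>t. \<phi> t y') ` {-1..0} \<inter> D 1 = {}" by blast
  qed blast
  define \<epsilon> where "\<epsilon> = Min {r, r', d, d'}"
  have \<epsilon>: "\<epsilon> > 0" "\<epsilon> \<le> r" "\<epsilon> \<le> r'" "\<epsilon> \<le> d" "\<epsilon> \<le> d'"
    using r(1) r'(1) d(1) d'(1) by (auto simp: \<epsilon>_def)
  obtain A k where A: "A \<in> subcontinua M" "k \<ge> 0"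
    and A_neg: "\<And>n a. n < 0 \<Longrightarrow> a \<in> A \<Longrightarrow> \<exists>u\<in>U (n + k). dist (\<phi> (of_int n) a) u < \<epsilon>"
    and A_pos: "\<And>n a. 0 \<le> n \<Longrightarrow> a \<in> A \<Longrightarrow> \<exists>d\<in>D (n - k). dist (\<phi> (of_int n) a) d < \<epsilon>"
    and A_0: "\<And>d. d \<in> D (- k) \<Longrightarrow> \<exists>a\<in>A. dist d a < \<epsilon>"
    using shadowed_transition[OF shadowing U D jump \<epsilon>(1)] by metis
  have AM: "A \<subseteq> M" "connected A" using A by (auto simp: subcontinua_iff[OF compact_M])
  have U_mono: "U m \<subseteq> U n" if "m \<le> n" for m n using that by (force simp: U_def backward_def)
  have D_mono: "D n \<subseteq> D m" if "m \<le> n" for m n using that by (force simp: D_def forward_def)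
  have bound: "t \<le> of_int (k + 2)" if t: "\<phi> t y \<in> A" for t
  proof (rule ccontr)
    assume "\<not> ?thesis"
    then have far: "of_int k + 2 < t"
      by simp
    define n where "n = \<lfloor>t\<rfloor>"
    have n: "n \<ge> k + 1" "t - of_int n \<in> {0..1}" using far unfolding n_def by (simp_all add: le_floor_iff) linarith+
    obtain u where u: "u \<in> U (- n + k)" "dist (\<phi> (of_int (- n)) (\<phi> t y)) u < \<epsilon>"
      using A_neg[OF _ t, of "- n"] n A(2) by auto
    have "\<phi> (of_int (- n)) (\<phi> t y) = \<phi> (t - of_int n) y" using flow_add[OF y(2), of "of_int (- n)" t] by simp
    moreover have "u \<in> U (- 1)" using U_mono[of "- n + k" "- 1"] n u by auto
    ultimately show False using d(2)[OF n(2), of u] u(2) \<epsilon>(4) by simp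
  qed
  have bound': "of_int (- k - 2) \<le> t" if t: "\<phi> t y' \<in> A" for t
  proof (rule ccontr)
    assume "\<not> ?thesis"
    then have far: "t < - of_int k - 2"
      by simp
    define n where "n = \<lfloor>- t\<rfloor>"
    have n: "n \<ge> k + 1" "t + of_int n \<in> {-1..0}" using far unfolding n_def by (simp_all add: le_floor_iff) linarith+
    obtain u where u: "u \<in> D (n - k)" "dist (\<phi> (of_int n) (\<phi> t y')) u < \<epsilon>"
      using A_pos[OF _ t, of n] n A(2) by auto
    have "\<phi> (of_int n) (\<phi> t y') = \<phi> (t + of_int n) y'" using flow_add[OF y'(2), of "of_int n" t] by (simp add: add.commute)
    moreover have "u \<in> D 1" using D_mono[of 1 "n - k"] n u by auto
    ultimately show False using d'(2)[OF n(2), of u] u(2) \<epsilon>(5) by simp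
  qed
  \<comment> \<open>On the continuum, \<open>C\<close> agrees with \<open>\<gamma>\<close> together with \<open>p\<close>, and \<open>C'\<close> with the rest.\<close>
  define C where "C = insert p (backward y (of_int (k + 2)))"
  define C' where "C' = (M - insert p (\<gamma> \<union> \<gamma>')) \<union> insert q' (forward y' (of_int (- k - 2)))"
  have "closed C" unfolding C_def by (rule compact_imp_closed[OF backward_limit(1)[OF y(2,4)]])
  moreover have "closed C'"
  proof -
    have "openin (top_of_set M) (insert p (\<gamma> \<union> \<gamma>'))"
      using outgoing_source(3)[OF p] e(2) y(1) y'(1) by (simp add: \<gamma>_def \<gamma>'_def)
    then obtain O' where "open O'" "insert p (\<gamma> \<union> \<gamma>') = M \<inter> O'" by (metis openin_open)
    then have "M - insert p (\<gamma> \<union> \<gamma>') = M - O'" "closed (M - O')"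
      using compact_imp_closed[OF compact_M] by blast+
    then show ?thesis
      unfolding C'_def using compact_imp_closed[OF forward_limit(1)[OF y'(2) q'(2)]] by (metis closed_Un)
  qed
  moreover have "A \<subseteq> C \<union> C'"
  proof
    fix a assume a: "a \<in> A"
    have "a \<in> C" if "a \<in> \<gamma>"
    proof -
      obtain t where "a = \<phi> t y" using \<open>a \<in> \<gamma>\<close> by (auto simp: \<gamma>_def orbit_def)
      then show ?thesis using bound[of t] a by (auto simp: C_def backward_def)
    qed
    moreover have "a \<in> C'" if "a \<in> \<gamma>'"
    proof -
      obtain t where "a = \<phi> t y'" using \<open>a \<in> \<gamma>'\<close> by (auto simp: \<gamma>'_def orbit_def)
      then show ?thesis using bound'[of t] a by (auto simp: C'_def forward_def)
    qed
    moreover have "a \<in> M" using a AM(1) by blast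
    ultimately show "a \<in> C \<union> C'" unfolding C_def C'_def by blast
  qed
  moreover have "C \<inter> C' = {}"
  proof -
    have "F q' < F p" using F_limit_less[OF y'(2,3) ZM(3) q'(2), of 0] F_limit_greater[OF y'(2,3) ZM(1) y'(4), of 0] by simp
    moreover have "C \<subseteq> insert p \<gamma>" "forward y' (of_int (- k - 2)) \<subseteq> \<gamma>'"
      using in_\<gamma> by (auto simp: C_def backward_def forward_def)
    ultimately show ?thesis using disj no_Z p(1) q'(1) unfolding C'_def by blast
  qed
  moreover have "A \<inter> C \<noteq> {}" "A \<inter> C' \<noteq> {}"
  proof -
    have yy: "y \<in> \<gamma>" "y' \<in> \<gamma>'" using orbit_refl y y' by (simp_all add: \<gamma>_def \<gamma>'_def)
    have "y \<in> D (- k)" using yy disj y(2) by (auto simp: D_def)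
    then obtain a where a: "a \<in> A" "dist y a < \<epsilon>" using A_0 by blast
    then have "a \<in> \<gamma>" using r(2)[of a] AM(1) \<epsilon>(2) by auto
    have "y' = \<phi> 0 y'" using y'(2) by (simp add: flow_0)
    then have "y' \<in> D (- k)" using A(2) unfolding D_def forward_def by (auto intro!: image_eqI[of _ _ 0])
    then obtain a' where a': "a' \<in> A" "dist y' a' < \<epsilon>" using A_0 by blast
    then have "a' \<in> \<gamma>'" using r'(2)[of a'] AM(1) \<epsilon>(3) by auto
    obtain t where "a = \<phi> t y" using \<open>a \<in> \<gamma>\<close> by (auto simp: \<gamma>_def orbit_def)
    then have "a \<in> C" using bound[of t] a by (auto simp: C_def backward_def)
    obtain t' where "a' = \<phi> t' y'" using \<open>a' \<in> \<gamma>'\<close> by (auto simp: \<gamma>'_def orbit_def)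
    then have "a' \<in> C'" using bound'[of t'] a' by (auto simp: C'_def forward_def)
    show "A \<inter> C \<noteq> {}" "A \<inter> C' \<noteq> {}" using \<open>a \<in> C\<close> \<open>a' \<in> C'\<close> a a' by blast+
  qed
  ultimately show False using connected_closedD[OF AM(2), of C C'] by blast
qed

end

section \<open>Calculus in Euclidean space\<close>

lemma smooth_on_continuous: "smooth_on S f \<Longrightarrow> continuous_on S f"
  unfolding smooth_on_def by (metis Ck_on.simps(1))

lemma smooth_on_has_derivative:
  "smooth_on S f \<Longrightarrow> x \<in> S \<Longrightarrow> (f has_derivative frechet_derivative f (at x)) (at x)"
  unfolding smooth_on_def by (metis Ck_on.simps(2) frechet_derivative_works)

lemma smooth_on_derivative: "smooth_on S f \<Longrightarrow> smooth_on S (\<lambda>x. frechet_derivative f (at x) v)"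
  unfolding smooth_on_def by (metis Ck_on.simps(2))

text \<open>The mean value inequality, with the operator norm of the derivative estimated by the finitely many
  continuous partial derivatives.\<close>

lemma smooth_on_lipschitz:
  fixes f :: "'e::euclidean_space \<Rightarrow> 'f::real_normed_vector"
  assumes f: "smooth_on S f" and K: "compact K" "convex K" "K \<subseteq> S"
  shows "\<exists>L\<ge>0. \<forall>x\<in>K. \<forall>y\<in>K. norm (f x - f y) \<le> L * norm (x - y)"
proof -
  let ?f' = "\<lambda>x. frechet_derivative f (at x)"
  let ?b = "\<lambda>x. \<Sum>i\<in>Basis. norm (?f' x i)"
  have "continuous_on K ?b"
    by (intro continuous_intros continuous_on_subset[OF smooth_on_continuous[OF smooth_on_derivative[OF f]] K(3)])
  then have "bounded (?b ` K)" by (rule compact_imp_bounded[OF compact_continuous_image[OF _ K(1)]])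
  then obtain L where L: "\<And>x. x \<in> K \<Longrightarrow> \<bar>?b x\<bar> \<le> L" unfolding bounded_iff by auto
  have "norm (f x - f y) \<le> \<bar>L\<bar> * norm (x - y)" if "x \<in> K" "y \<in> K" for x y
  proof (rule differentiable_bound[OF K(2) _ _ that])
    fix z assume z: "z \<in> K"
    have d: "(f has_derivative ?f' z) (at z)" using smooth_on_has_derivative[OF f] K(3) z by blast
    then show "(f has_derivative ?f' z) (at z within K)" by (rule has_derivative_at_withinI)
    have "onorm (?f' z) \<le> ?b z" by (rule onorm_componentwise[OF has_derivative_bounded_linear[OF d]])
    then show "onorm (?f' z) \<le> \<bar>L\<bar>" using L[OF z] by linarith
  qed
  then show ?thesis by (intro exI[of _ "\<bar>L\<bar>"]) simp
qed

lemma linear_basis_expansion: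
  fixes l :: "'e::euclidean_space \<Rightarrow> real"
  assumes "linear l"
  shows "l w = (\<Sum>i\<in>Basis. (w \<bullet> i) * l i)"
proof -
  have "l w = l (\<Sum>i\<in>Basis. (w \<bullet> i) *\<^sub>R i)" by (simp add: euclidean_representation)
  also have "\<dots> = (\<Sum>i\<in>Basis. (w \<bullet> i) * l i)" by (simp add: linear_sum[OF assms] linear_cmul[OF assms])
  finally show ?thesis .
qed

lemma bilinear_basis_expansion:
  fixes a :: "'e::euclidean_space \<Rightarrow> 'e \<Rightarrow> real"
  assumes "bilinear a"
  shows "a v w = (\<Sum>i\<in>Basis. \<Sum>j\<in>Basis. (v \<bullet> i) * (w \<bullet> j) * a i j)"
proof -
  have "a v w = (\<Sum>i\<in>Basis. (v \<bullet> i) * a i w)"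
    by (rule linear_basis_expansion) (use assms in \<open>simp add: bilinear_def\<close>)
  also have "\<dots> = (\<Sum>i\<in>Basis. (v \<bullet> i) * (\<Sum>j\<in>Basis. (w \<bullet> j) * a i j))"
    using assms by (intro sum.cong refl arg_cong2[of _ _ _ _ "(*)"] linear_basis_expansion) (simp add: bilinear_def)
  finally show ?thesis by (simp add: sum_distrib_left mult.assoc)
qed

text \<open>A family of linear forms is Lipschitz in the operator norm if its coefficients are; the
  next lemma is the analogue for bilinear forms.\<close>

lemma linear_lipschitz_of_entries:
  fixes l :: "'e::euclidean_space \<Rightarrow> 'e \<Rightarrow> real"
  assumes lin: "\<And>x. x \<in> K \<Longrightarrow> linear (l x)"
    and entries: "\<And>w. \<exists>L\<ge>0. \<forall>x\<in>K. \<forall>y\<in>K. \<bar>l x w - l y w\<bar> \<le> L * norm (x - y)"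
  shows "\<exists>L\<ge>0. \<forall>x\<in>K. \<forall>y\<in>K. \<forall>w. \<bar>l x w - l y w\<bar> \<le> L * norm (x - y) * norm w"
proof -
  obtain L where L: "\<And>w. L w \<ge> 0" "\<And>w x y. x \<in> K \<Longrightarrow> y \<in> K \<Longrightarrow> \<bar>l x w - l y w\<bar> \<le> L w * norm (x - y)"
    using entries by metis
  have "\<bar>l x w - l y w\<bar> \<le> (\<Sum>i\<in>Basis. L i) * norm (x - y) * norm w" if "x \<in> K" "y \<in> K" for x y w
  proof -
    have "l x w - l y w = (\<Sum>i\<in>Basis. (w \<bullet> i) * (l x i - l y i))"
      using linear_basis_expansion[OF lin[OF that(1)], of w] linear_basis_expansion[OF lin[OF that(2)], of w]
      by (simp add: sum_subtractf right_diff_distrib)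
    also have "\<bar>\<dots>\<bar> \<le> (\<Sum>i\<in>Basis. norm w * (L i * norm (x - y)))"
      by (rule order_trans[OF sum_abs])
         (auto simp: abs_mult intro!: sum_mono mult_mono L that Basis_le_norm)
    finally show ?thesis by (simp add: sum_distrib_left sum_distrib_right mult_ac)
  qed
  then show ?thesis using L(1) by (intro exI[of _ "\<Sum>i\<in>Basis. L i"]) (auto intro!: sum_nonneg)
qed

lemma bilinear_lipschitz_of_entries:
  fixes a :: "'e::euclidean_space \<Rightarrow> 'e \<Rightarrow> 'e \<Rightarrow> real"
  assumes bil: "\<And>x. x \<in> K \<Longrightarrow> bilinear (a x)"
    and entries: "\<And>v w. \<exists>L\<ge>0. \<forall>x\<in>K. \<forall>y\<in>K. \<bar>a x v w - a y v w\<bar> \<le> L * norm (x - y)"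
  shows "\<exists>L\<ge>0. \<forall>x\<in>K. \<forall>y\<in>K. \<forall>v w. \<bar>a x v w - a y v w\<bar> \<le> L * norm (x - y) * norm v * norm w"
proof -
  obtain L where L: "\<And>v w. L v w \<ge> 0" "\<And>v w x y. x \<in> K \<Longrightarrow> y \<in> K \<Longrightarrow> \<bar>a x v w - a y v w\<bar> \<le> L v w * norm (x - y)"
    using entries by metis
  have "\<bar>a x v w - a y v w\<bar> \<le> (\<Sum>i\<in>Basis. \<Sum>j\<in>Basis. L i j) * norm (x - y) * norm v * norm w"
    if "x \<in> K" "y \<in> K" for x y v w
  proof -
    have "a x v w - a y v w = (\<Sum>i\<in>Basis. \<Sum>j\<in>Basis. (v \<bullet> i) * (w \<bullet> j) * (a x i j - a y i j))"
      using bilinear_basis_expansion[OF bil[OF that(1)], of v w] bilinear_basis_expansion[OF bil[OF that(2)], of v w]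
      by (simp add: sum_subtractf right_diff_distrib)
    also have "\<bar>\<dots>\<bar> \<le> (\<Sum>i\<in>Basis. \<Sum>j\<in>Basis. norm v * norm w * (L i j * norm (x - y)))"
      by (intro order_trans[OF sum_abs] sum_mono)
         (auto simp: abs_mult intro!: mult_mono L that Basis_le_norm)
    finally show ?thesis by (simp add: sum_distrib_left sum_distrib_right mult_ac)
  qed
  then show ?thesis
    using L(1) by (intro exI[of _ "\<Sum>i\<in>Basis. \<Sum>j\<in>Basis. L i j"]) (auto intro!: sum_nonneg)
qed

lemma uniformly_positive_definite:
  fixes a :: "'e::euclidean_space \<Rightarrow> 'e \<Rightarrow> 'e \<Rightarrow> real"
  assumes K: "compact K" and bil: "\<And>x. x \<in> K \<Longrightarrow> bilinear (a x)"
    and pos: "\<And>x w. x \<in> K \<Longrightarrow> w \<noteq> 0 \<Longrightarrow> 0 < a x w w"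
    and cont: "\<And>v w. continuous_on K (\<lambda>x. a x v w)"
  shows "\<exists>m>0. \<forall>x\<in>K. \<forall>w. m * (norm w)\<^sup>2 \<le> a x w w"
proof (cases "K = {}")
  case False
  let ?h = "\<lambda>(x, w). \<Sum>i\<in>Basis. \<Sum>j\<in>Basis. (w \<bullet> i) * (w \<bullet> j) * a x i j"
  have h: "?h (x, w) = a x w w" if "x \<in> K" for x w
    using bilinear_basis_expansion[OF bil[OF that], of w w] by simp
  have sphere: "sphere (0::'e) 1 \<noteq> {}" by simp
  have "continuous_on (K \<times> sphere 0 1) ?h"
    unfolding case_prod_unfold
    by (intro continuous_intros continuous_on_compose2[OF cont continuous_on_fst[OF continuous_on_id]]) auto
  moreover have "compact (K \<times> sphere (0::'e) 1)" "K \<times> sphere (0::'e) 1 \<noteq> {}"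
    using K False sphere by (simp_all add: compact_Times del: sphere_eq_empty)
  ultimately obtain z where z: "z \<in> K \<times> sphere 0 1" "\<forall>z'\<in>K \<times> sphere 0 1. ?h z \<le> ?h z'"
    using continuous_attains_inf[of "K \<times> sphere 0 1" ?h] by meson
  obtain x0 w0 where z0: "z = (x0, w0)" "x0 \<in> K" "norm w0 = 1" using z(1) by auto
  have "w0 \<noteq> 0" using z0 by auto
  have "a x0 w0 w0 * (norm w)\<^sup>2 \<le> a x w w" if x: "x \<in> K" for x w
  proof (cases "w = 0")
    case True then show ?thesis using bil[OF x] by (simp add: bilinear_lzero)
  next
    case False
    let ?u = "w /\<^sub>R norm w"
    have "a x0 w0 w0 \<le> a x ?u ?u"
      using z(2)[rule_format, of "(x, ?u)"] False x h[OF z0(2), of w0] h[OF x, of ?u]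
      unfolding z0(1) by simp
    then have "a x0 w0 w0 * (norm w)\<^sup>2 \<le> a x ?u ?u * (norm w)\<^sup>2" by (simp add: mult_right_mono)
    also have "\<dots> = a x (norm w *\<^sub>R ?u) (norm w *\<^sub>R ?u)"
      using bil[OF x] by (simp only: bilinear_lmul bilinear_rmul) (simp add: power2_eq_square)
    also have "\<dots> = a x w w" using False by simp
    finally show ?thesis .
  qed
  then show ?thesis using pos[OF z0(2) \<open>w0 \<noteq> 0\<close>] by blast
qed (auto intro: exI[of _ 1])

text \<open>The field \<open>V\<close> is the gradient of \<open>l\<close> with respect to the scalar products \<open>a\<close>. Instead of inverting the
  matrix of \<open>a\<close>, the duality is tested on the difference \<open>d = V x - V y\<close> itself and compared with the
  uniform lower bound for \<open>a x d d\<close>.\<close>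

lemma dual_field_lipschitz:
  fixes a :: "'e::euclidean_space \<Rightarrow> 'e \<Rightarrow> 'e \<Rightarrow> real" and l :: "'e \<Rightarrow> 'e \<Rightarrow> real" and V :: "'e \<Rightarrow> 'e"
  assumes K: "compact K" "convex K" "K \<subseteq> S"
    and bil: "\<And>x. x \<in> K \<Longrightarrow> bilinear (a x)" and pos: "\<And>x w. x \<in> K \<Longrightarrow> w \<noteq> 0 \<Longrightarrow> 0 < a x w w"
    and lin: "\<And>x. x \<in> K \<Longrightarrow> linear (l x)"
    and smooth: "\<And>v w. smooth_on S (\<lambda>x. a x v w)" "\<And>w. smooth_on S (\<lambda>x. l x w)"
    and dual: "\<And>x w. x \<in> K \<Longrightarrow> a x (V x) w = l x w"
  obtains B L where "0 < B" "0 \<le> L" "\<And>x. x \<in> K \<Longrightarrow> norm (V x) \<le> B"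
    "\<And>x y. x \<in> K \<Longrightarrow> y \<in> K \<Longrightarrow> norm (V x - V y) \<le> L * norm (x - y)"
proof -
  obtain m where m: "m > 0" "\<And>x w. x \<in> K \<Longrightarrow> m * (norm w)\<^sup>2 \<le> a x w w"
    using uniformly_positive_definite[OF K(1) bil pos continuous_on_subset[OF smooth_on_continuous[OF smooth(1)] K(3)]]
    by blast
  obtain L1 where L1: "L1 \<ge> 0" "\<And>x y w. x \<in> K \<Longrightarrow> y \<in> K \<Longrightarrow> \<bar>l x w - l y w\<bar> \<le> L1 * norm (x - y) * norm w"
    using linear_lipschitz_of_entries[OF lin smooth_on_lipschitz[OF smooth(2) K, unfolded real_norm_def]] by blast
  obtain L2 where L2: "L2 \<ge> 0"
    "\<And>x y v w. x \<in> K \<Longrightarrow> y \<in> K \<Longrightarrow> \<bar>a x v w - a y v w\<bar> \<le> L2 * norm (x - y) * norm v * norm w"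
    using bilinear_lipschitz_of_entries[OF bil smooth_on_lipschitz[OF smooth(1) K, unfolded real_norm_def]] by blast
  \<comment> \<open>Cancels one factor \<open>norm w\<close>, including the case \<open>w = 0\<close>.\<close>
  have divide: "norm w \<le> C / m" if "m * (norm w)\<^sup>2 \<le> C * norm w" "C \<ge> 0" for w :: 'e and C
    using that m(1) by (cases "w = 0") (simp_all add: power2_eq_square field_simps)
  have "\<exists>B>0. \<forall>x\<in>K. norm (V x) \<le> B"
  proof -
    let ?b = "\<lambda>x. \<Sum>i\<in>Basis. \<bar>l x i\<bar>"
    have "continuous_on K ?b"
      by (intro continuous_intros continuous_on_subset[OF smooth_on_continuous[OF smooth(2)] K(3)])
    then have "bounded (?b ` K)" by (rule compact_imp_bounded[OF compact_continuous_image[OF _ K(1)]])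
    then obtain C where C: "\<And>x. x \<in> K \<Longrightarrow> \<bar>?b x\<bar> \<le> C" unfolding bounded_iff by auto
    have "norm (V x) \<le> \<bar>C\<bar> / m" if x: "x \<in> K" for x
    proof (rule divide)
      have "m * (norm (V x))\<^sup>2 \<le> l x (V x)" using m(2)[OF x] dual[OF x] by metis
      also have "\<dots> = (\<Sum>i\<in>Basis. (V x \<bullet> i) * l x i)" by (rule linear_basis_expansion[OF lin[OF x]])
      also have "\<dots> \<le> (\<Sum>i\<in>Basis. norm (V x) * \<bar>l x i\<bar>)"
      proof (rule sum_mono)
        fix i :: 'e assume i: "i \<in> Basis"
        have "(V x \<bullet> i) * l x i \<le> \<bar>V x \<bullet> i\<bar> * \<bar>l x i\<bar>" by (metis abs_ge_self abs_mult)
        also have "\<dots> \<le> norm (V x) * \<bar>l x i\<bar>" by (intro mult_right_mono Basis_le_norm[OF i]) simp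
        finally show "(V x \<bullet> i) * l x i \<le> norm (V x) * \<bar>l x i\<bar>" .
      qed
      also have "\<dots> = ?b x * norm (V x)" by (simp add: sum_distrib_left mult.commute)
      also have "\<dots> \<le> \<bar>C\<bar> * norm (V x)" using C[OF x] norm_ge_zero[of "V x"] by (intro mult_right_mono) linarith+
      finally show "m * (norm (V x))\<^sup>2 \<le> \<bar>C\<bar> * norm (V x)" .
    qed simp
    then have "\<forall>x\<in>K. norm (V x) \<le> \<bar>C\<bar> / m + 1" by fastforce
    moreover have "\<bar>C\<bar> / m + 1 > 0" using m(1) by (simp add: add_nonneg_pos)
    ultimately show ?thesis by blast
  qed
  then obtain B where B: "B > 0" "\<And>x. x \<in> K \<Longrightarrow> norm (V x) \<le> B" by blast
  have "norm (V x - V y) \<le> (L1 + L2 * B) / m * norm (x - y)" if x: "x \<in> K" and y: "y \<in> K" for x y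
  proof -
    define d where "d = V x - V y"
    have "m * (norm d)\<^sup>2 \<le> a x d d" by (rule m(2)[OF x])
    also have "a x d d = (l x d - l y d) + (a y (V y) d - a x (V y) d)"
      using bilinear_lsub[OF bil[OF x], of "V x" "V y" d] by (simp add: d_def[symmetric] dual x y)
    also have "\<dots> \<le> L1 * norm (x - y) * norm d + L2 * norm (x - y) * norm (V y) * norm d"
      using L1(2)[OF x y, of d] L2(2)[OF x y, of "V y" d] by linarith
    also have "L2 * norm (x - y) * norm (V y) * norm d \<le> L2 * norm (x - y) * B * norm d"
      using L2(1) B(2)[OF y] by (intro mult_right_mono mult_left_mono) auto
    finally have "m * (norm d)\<^sup>2 \<le> ((L1 + L2 * B) * norm (x - y)) * norm d" by (simp add: algebra_simps)
    then have "norm d \<le> (L1 + L2 * B) * norm (x - y) / m"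
      using L1(1) L2(1) B(1) by (intro divide) auto
    then show ?thesis by (simp add: d_def)
  qed
  then show ?thesis
    using that[of B "(L1 + L2 * B) / m"] B L1(1) L2(1) m(1) by simp
qed

text \<open>Gronwall's inequality for the square of the distance, in the form that
  \<open>exp (- 2 * L * t)\<close> times this square is nonincreasing.\<close>

lemma solutions_diverge_exponentially:
  fixes u v :: "real \<Rightarrow> 'e::real_inner"
  assumes "0 \<le> \<tau>"
    and u: "\<And>t. t \<in> {0..\<tau>} \<Longrightarrow> (u has_vector_derivative W (u t)) (at t)"
    and v: "\<And>t. t \<in> {0..\<tau>} \<Longrightarrow> (v has_vector_derivative W (v t)) (at t)"
    and lipschitz: "\<And>t. t \<in> {0..\<tau>} \<Longrightarrow> norm (W (u t) - W (v t)) \<le> L * norm (u t - v t)"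
  shows "norm (u \<tau> - v \<tau>) \<le> exp (L * \<tau>) * norm (u 0 - v 0)"
proof -
  define w where "w t = u t - v t" for t
  define h where "h t = exp (- 2 * L * t) * (w t \<bullet> w t)" for t
  have "h \<tau> \<le> h 0"
  proof (rule DERIV_nonpos_imp_nonincreasing[OF assms(1)])
    fix t assume "0 \<le> t" "t \<le> \<tau>"
    then have t: "t \<in> {0..\<tau>}" by simp
    define w' where "w' = W (u t) - W (v t)"
    let ?D = "exp (- 2 * L * t) * (2 * (w' \<bullet> w t) - 2 * L * (w t \<bullet> w t))"
    have "(w has_vector_derivative w') (at t)"
      unfolding w_def w'_def by (intro has_vector_derivative_diff u v t)
    then have w': "(w has_derivative (\<lambda>s. s *\<^sub>R w')) (at t)" by (simp add: has_vector_derivative_def)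
    have d1: "((\<lambda>t. w t \<bullet> w t) has_real_derivative 2 * (w' \<bullet> w t)) (at t)"
      unfolding has_field_derivative_def
      by (rule has_derivative_eq_rhs[OF has_derivative_inner[OF w' w']]) (simp add: fun_eq_iff inner_commute)
    have d2: "((\<lambda>t. exp (- 2 * L * t)) has_real_derivative exp (- 2 * L * t) * (- 2 * L)) (at t)"
      by (auto intro!: derivative_eq_intros)
    have "(h has_real_derivative ?D) (at t)"
      unfolding h_def by (rule DERIV_cong[OF DERIV_mult[OF d2 d1]]) (simp add: algebra_simps)
    moreover have "w' \<bullet> w t \<le> L * (w t \<bullet> w t)"
    proof -
      have "w' \<bullet> w t \<le> norm w' * norm (w t)" by (rule norm_cauchy_schwarz)
      also have "\<dots> \<le> L * norm (w t) * norm (w t)"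
        using lipschitz[OF t] by (intro mult_right_mono) (simp_all add: w_def w'_def)
      finally show ?thesis by (simp add: power2_norm_eq_inner[symmetric] power2_eq_square)
    qed
    then have "?D \<le> 0" by (intro mult_nonneg_nonpos) auto
    ultimately show "\<exists>y. (h has_real_derivative y) (at t) \<and> y \<le> 0" by blast
  qed
  then have "exp (- 2 * L * \<tau>) * (norm (u \<tau> - v \<tau>))\<^sup>2 \<le> (norm (u 0 - v 0))\<^sup>2"
    by (simp add: h_def w_def power2_norm_eq_inner)
  moreover have "exp (- 2 * L * \<tau>) = inverse ((exp (L * \<tau>))\<^sup>2)"
    by (simp only: exp_double[symmetric] exp_minus[symmetric]) simp
  ultimately have "inverse ((exp (L * \<tau>))\<^sup>2) * (norm (u \<tau> - v \<tau>))\<^sup>2 \<le> (norm (u 0 - v 0))\<^sup>2"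
    by simp
  moreover have "a \<le> c * b" if "inverse c * a \<le> b" "0 < c" for a b c :: real
    using that by (simp add: field_simps)
  ultimately have "(norm (u \<tau> - v \<tau>))\<^sup>2 \<le> (exp (L * \<tau>))\<^sup>2 * (norm (u 0 - v 0))\<^sup>2"
    by simp
  then have "(norm (u \<tau> - v \<tau>))\<^sup>2 \<le> (exp (L * \<tau>) * norm (u 0 - v 0))\<^sup>2"
    by (simp only: power_mult_distrib)
  then show ?thesis by (rule power2_le_imp_le) simp
qed

text \<open>Here only the derivative at 0 of \<open>f'\<close> is known, so its sign near 0 is all that is available; it
  makes \<open>f\<close> monotone on each side of 0.\<close>

lemma second_derivative_test_pos:
  fixes f f' :: "real \<Rightarrow> real"
  assumes r: "0 < r" and f: "\<And>s. \<bar>s\<bar> < r \<Longrightarrow> (f has_real_derivative f' s) (at s)"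
    and "f' 0 = 0" "(f' has_real_derivative k) (at 0)" "0 < k"
  shows "\<exists>d. 0 < d \<and> d \<le> r \<and> (\<forall>s. s \<noteq> 0 \<and> \<bar>s\<bar> < d \<longrightarrow> f 0 < f s)"
proof -
  obtain d1 where d1: "d1 > 0" "\<And>h. 0 < h \<Longrightarrow> h < d1 \<Longrightarrow> f' 0 < f' (0 + h)"
    using DERIV_pos_inc_right[OF assms(4,5)] by blast
  obtain d2 where d2: "d2 > 0" "\<And>h. 0 < h \<Longrightarrow> h < d2 \<Longrightarrow> f' (0 - h) < f' 0"
    using DERIV_pos_inc_left[OF assms(4,5)] by blast
  define d where "d = min r (min d1 d2)"
  have d: "0 < d" "d \<le> r" "d \<le> d1" "d \<le> d2" using r d1(1) d2(1) by (auto simp: d_def)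
  have "f 0 < f s" if s: "s \<noteq> 0" "\<bar>s\<bar> < d" for s
  proof (cases "s > 0")
    case True
    show ?thesis
    proof (rule DERIV_pos_imp_increasing_open[OF True])
      show "\<exists>y. (f has_real_derivative y) (at x) \<and> 0 < y" if "0 < x" "x < s" for x
        using f[of x] d1(2)[of x] that s d assms(3) by (intro exI[of _ "f' x"]) auto
      show "continuous_on {0..s} f"
        using s d by (intro continuous_at_imp_continuous_on ballI DERIV_isCont[OF f]) auto
    qed
  next
    case False
    then have "s < 0" using s by simp
    then show ?thesis
    proof (rule DERIV_neg_imp_decreasing_open)
      show "\<exists>y. (f has_real_derivative y) (at x) \<and> y < 0" if "s < x" "x < 0" for x
        using f[of x] d2(2)[of "- x"] that s d assms(3) by (intro exI[of _ "f' x"]) auto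
      show "continuous_on {s..0} f"
        using s d by (intro continuous_at_imp_continuous_on ballI DERIV_isCont[OF f]) auto
    qed
  qed
  then show ?thesis using d(1,2) by blast
qed

lemma second_derivative_test:
  fixes f f' :: "real \<Rightarrow> real"
  assumes r: "0 < r" and f: "\<And>s. \<bar>s\<bar> < r \<Longrightarrow> (f has_real_derivative f' s) (at s)"
    and f': "f' 0 = 0" "(f' has_real_derivative k) (at 0)" "k \<noteq> 0"
  shows "\<exists>d. 0 < d \<and> d \<le> r \<and>
    ((\<forall>s. s \<noteq> 0 \<and> \<bar>s\<bar> < d \<longrightarrow> f s < f 0) \<or> (\<forall>s. s \<noteq> 0 \<and> \<bar>s\<bar> < d \<longrightarrow> f 0 < f s))"
proof (cases "k > 0")
  case True
  then show ?thesis using second_derivative_test_pos[OF r f f'(1,2)] by blast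
next
  case False
  have "((\<lambda>s. - f s) has_real_derivative - f' s) (at s)" if "\<bar>s\<bar> < r" for s
    using f[OF that] by (rule DERIV_minus)
  from second_derivative_test_pos[OF r this _ DERIV_minus[OF f'(2)]] f'(1,3) False
  show ?thesis by auto
qed

lemma one_dimensional_unit_vector:
  assumes "DIM('e::euclidean_space) = 1"
  obtains b :: "'e::euclidean_space" where "norm b = 1" "\<And>x. x = (x \<bullet> b) *\<^sub>R b" "b \<noteq> 0"
proof -
  obtain b :: 'e where b: "Basis = {b}" using assms card_1_singletonE by blast
  then have "b \<in> (Basis :: 'e set)" by blast
  then have "norm b = 1" "b \<noteq> 0" by (auto simp: nonzero_Basis)
  moreover have "x = (x \<bullet> b) *\<^sub>R b" for x using euclidean_representation[of x] by (simp add: b)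
  ultimately show ?thesis using that b by blast
qed

section \<open>Charts, tangent vectors and gradients\<close>

lemma inner_riesz_vector:
  fixes l :: "'e::euclidean_space \<Rightarrow> real"
  assumes "linear l"
  shows "(\<Sum>i\<in>Basis. l i *\<^sub>R i) \<bullet> w = l w"
  unfolding linear_basis_expansion[OF assms, of w] inner_sum_left
  by (intro sum.cong) (simp_all add: inner_commute)

locale smooth_atlas =
  fixes M :: "'a::metric_space set" and \<A> :: "('a, 'e::euclidean_space) chart set"
  assumes smooth_manifold: "smooth_manifold M \<A>"
begin

lemma chart_dom_open: "c \<in> \<A> \<Longrightarrow> openin (top_of_set M) (chart_dom c)"
  and chart_im_open: "c \<in> \<A> \<Longrightarrow> open (chart_im c)"
  and chart_homeomorphism: "c \<in> \<A> \<Longrightarrow> homeomorphism (chart_dom c) (chart_im c) (chart_map c) (chart_inv c)"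
  and transition_smooth: "c \<in> \<A> \<Longrightarrow> c' \<in> \<A> \<Longrightarrow>
    smooth_on (chart_map c ` (chart_dom c \<inter> chart_dom c')) (transition c c')"
  using smooth_manifold by (auto simp: smooth_manifold_def)

lemma chart_dom_subset: "c \<in> \<A> \<Longrightarrow> chart_dom c \<subseteq> M"
  by (rule openin_imp_subset[OF chart_dom_open])

lemma chart_map_in: "c \<in> \<A> \<Longrightarrow> p \<in> chart_dom c \<Longrightarrow> chart_map c p \<in> chart_im c"
  by (simp add: chart_im_def)

lemma chart_inv_map: "c \<in> \<A> \<Longrightarrow> p \<in> chart_dom c \<Longrightarrow> chart_inv c (chart_map c p) = p"
  using homeomorphism_apply1[OF chart_homeomorphism] .

lemma chart_map_inv: "c \<in> \<A> \<Longrightarrow> x \<in> chart_im c \<Longrightarrow> chart_map c (chart_inv c x) = x"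
  using homeomorphism_apply2[OF chart_homeomorphism] .

lemma chart_inv_in: "c \<in> \<A> \<Longrightarrow> x \<in> chart_im c \<Longrightarrow> chart_inv c x \<in> chart_dom c"
  using homeomorphism_image2[OF chart_homeomorphism, of c] by blast

lemma chart_map_continuous: "c \<in> \<A> \<Longrightarrow> continuous_on (chart_dom c) (chart_map c)"
  by (rule homeomorphism_cont1[OF chart_homeomorphism])

lemma chart_inv_continuous: "c \<in> \<A> \<Longrightarrow> continuous_on (chart_im c) (chart_inv c)"
  by (rule homeomorphism_cont2[OF chart_homeomorphism])

lemma chart_inv_image_open:
  assumes c: "c \<in> \<A>" and U: "open U" "U \<subseteq> chart_im c"
  shows "openin (top_of_set M) (chart_inv c ` U)"
proof -
  have "openin (top_of_set (chart_dom c)) (chart_dom c \<inter> chart_map c -` U)"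
    by (rule continuous_openin_preimage_gen[OF chart_map_continuous[OF c] U(1)])
  moreover have "chart_inv c ` U = chart_dom c \<inter> chart_map c -` U"
    using U(2) chart_inv_in[OF c] chart_map_inv[OF c] chart_inv_map[OF c] by (force simp: image_iff)
  ultimately show ?thesis using chart_dom_open[OF c] openin_trans by metis
qed

lemma overlap_open:
  assumes "c \<in> \<A>" "c' \<in> \<A>"
  shows "open (chart_map c ` (chart_dom c \<inter> chart_dom c'))"
proof -
  have "openin (top_of_set (chart_dom c)) (chart_dom c \<inter> chart_dom c')"
    using chart_dom_open[OF assms(2)] chart_dom_subset[OF assms(1)] by (auto simp: openin_open)
  then have "openin (top_of_set (chart_im c)) (chart_map c ` (chart_dom c \<inter> chart_dom c'))"
    by (rule homeomorphism_imp_open_map[OF chart_homeomorphism[OF assms(1)]])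
  then show ?thesis using chart_im_open[OF assms(1)] openin_open_trans by metis
qed

lemma charts_atD: "c \<in> charts_at \<A> p \<Longrightarrow> c \<in> \<A>" "c \<in> charts_at \<A> p \<Longrightarrow> p \<in> chart_dom c"
  by (simp_all add: charts_at_def)

lemma charts_at_chart_inv: "c \<in> \<A> \<Longrightarrow> x \<in> chart_im c \<Longrightarrow> c \<in> charts_at \<A> (chart_inv c x)"
  by (simp add: charts_at_def chart_inv_in)

lemma chart_at_in: "p \<in> M \<Longrightarrow> chart_at \<A> p \<in> charts_at \<A> p"
  unfolding chart_at_def using smooth_manifold
  by (intro someI_ex[of "\<lambda>c. c \<in> charts_at \<A> p"]) (auto simp: charts_at_def smooth_manifold_def)

abbreviation change :: "'a \<Rightarrow> ('a, 'e) chart \<Rightarrow> ('a, 'e) chart \<Rightarrow> 'e \<Rightarrow> 'e" where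
  "change p c c' \<equiv> frechet_derivative (transition c c') (at (chart_map c p))"

lemma transition_has_derivative:
  assumes "c \<in> charts_at \<A> p" "c' \<in> charts_at \<A> p"
  shows "(transition c c' has_derivative change p c c') (at (chart_map c p))"
  by (rule smooth_on_has_derivative[OF transition_smooth]) (use assms charts_atD in auto)

lemma linear_change: "c \<in> charts_at \<A> p \<Longrightarrow> c' \<in> charts_at \<A> p \<Longrightarrow> linear (change p c c')"
  using transition_has_derivative has_derivative_linear by blast

text \<open>The chain rule for the coordinate representations of a map on \<open>M\<close>. All facts about the dependence of
  tangent vectors and differentials on charts are instances of it.\<close>

lemma has_derivative_change_chart:
  assumes c: "c \<in> charts_at \<A> p" "c' \<in> charts_at \<A> p"
    and h: "(h \<circ> chart_inv c' has_derivative h') (at (chart_map c' p))"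
  shows "(h \<circ> chart_inv c has_derivative h' \<circ> change p c c') (at (chart_map c p))"
proof -
  note A = charts_atD[OF c(1)] charts_atD[OF c(2)]
  let ?S = "chart_map c ` (chart_dom c \<inter> chart_dom c')"
  have tr: "transition c c' (chart_map c p) = chart_map c' p"
    by (simp add: transition_def chart_inv_map A)
  have "(h \<circ> chart_inv c' \<circ> transition c c' has_derivative h' \<circ> change p c c') (at (chart_map c p))"
    using transition_has_derivative[OF c] h by (intro diff_chain_at) (simp_all add: tr)
  then show ?thesis
  proof (rule has_derivative_transform_within_open[OF _ overlap_open[OF A(1,3)]])
    show "chart_map c p \<in> ?S" using A(2,4) by blast
    fix x assume "x \<in> ?S"
    then obtain p' where p': "x = chart_map c p'" "p' \<in> chart_dom c" "p' \<in> chart_dom c'" by blast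
    show "(h \<circ> chart_inv c' \<circ> transition c c') x = (h \<circ> chart_inv c) x"
      by (simp add: transition_def p'(1) chart_inv_map[OF A(1) p'(2)] chart_inv_map[OF A(3) p'(3)])
  qed
qed

lemma change_refl:
  assumes c: "c \<in> charts_at \<A> p"
  shows "change p c c = id"
proof -
  note A = charts_atD[OF c]
  have "(transition c c has_derivative id) (at (chart_map c p))"
  proof (rule has_derivative_transform_within_open[OF has_derivative_id chart_im_open[OF A(1)] chart_map_in[OF A]])
    show "id x = transition c c x" if "x \<in> chart_im c" for x
      using chart_map_inv[OF A(1) that] by (simp add: transition_def)
  qed
  then show ?thesis by (metis frechet_derivative_at)
qed

text \<open>The cocycle condition is the change of charts for the coordinate map of the third chart.\<close>

lemma change_trans:
  assumes c: "c \<in> charts_at \<A> p" "c' \<in> charts_at \<A> p" "c'' \<in> charts_at \<A> p"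
  shows "change p c' c'' (change p c c' v) = change p c c'' v"
proof -
  have "(transition c c'' has_derivative change p c' c'' \<circ> change p c c') (at (chart_map c p))"
    using has_derivative_change_chart[OF c(1,2), of "chart_map c''"] transition_has_derivative[OF c(2,3)]
    by (simp add: transition_def)
  then show ?thesis by (metis comp_apply frechet_derivative_at)
qed

lemma coord_tvec_at:
  assumes "c \<in> charts_at \<A> p"
  shows "coord_tvec \<A> c p v \<in> tangent_space \<A> p" "coord_tvec \<A> c p v c = v"
  using assms change_trans change_refl[OF assms] by (auto simp: tangent_space_def coord_tvec_def)

text \<open>Together with the previous lemma: evaluation in a chart identifies the tangent space with the model space.\<close>

lemma tangent_eq_coord_tvec:
  assumes c: "c \<in> charts_at \<A> p" and v: "v \<in> tangent_space \<A> p"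
  shows "v = coord_tvec \<A> c p (v c)"
proof
  fix c'
  have "v c' = change p c c' (v c)" if "c' \<in> charts_at \<A> p"
    using c v that unfolding tangent_space_def by blast
  moreover have "v c' = 0" if "c' \<notin> charts_at \<A> p"
    using v that unfolding tangent_space_def by blast
  ultimately show "v c' = coord_tvec \<A> c p (v c) c'" by (simp only: coord_tvec_def split: if_splits) blast
qed

lemma coord_tvec_linear:
  assumes c: "c \<in> charts_at \<A> p"
  shows "coord_tvec \<A> c p (a *\<^sub>R v + b *\<^sub>R w) = (\<lambda>c'. a *\<^sub>R coord_tvec \<A> c p v c' + b *\<^sub>R coord_tvec \<A> c p w c')"
  using linear_change[OF c] by (auto simp: coord_tvec_def fun_eq_iff linear_add linear_cmul)

lemma coord_tvec_eq_0_iff: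
  assumes c: "c \<in> charts_at \<A> p"
  shows "coord_tvec \<A> c p v = (\<lambda>_. 0) \<longleftrightarrow> v = 0"
proof
  show "v = 0" if "coord_tvec \<A> c p v = (\<lambda>_. 0)" using coord_tvec_at(2)[OF c, of v] that by simp
  show "coord_tvec \<A> c p v = (\<lambda>_. 0)" if "v = 0"
    unfolding coord_tvec_def that using linear_0[OF linear_change[OF c]] by (intro ext) simp
qed

end

locale riemannian_function = smooth_atlas M \<A>
  for M :: "'a::metric_space set" and \<A> :: "('a, 'e::euclidean_space) chart set" +
  fixes g :: "'a \<Rightarrow> ('a, 'e) tvec \<Rightarrow> ('a, 'e) tvec \<Rightarrow> real" and F :: "'a \<Rightarrow> real"
  assumes riemannian: "riemannian_metric M \<A> g" and smooth_F: "smooth_fun \<A> F"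
begin

definition dF :: "('a, 'e) chart \<Rightarrow> 'e \<Rightarrow> 'e \<Rightarrow> real" where
  "dF c x = frechet_derivative (F \<circ> chart_inv c) (at x)"

text \<open>The coefficients of the Riemannian metric in a chart.\<close>

definition gram :: "('a, 'e) chart \<Rightarrow> 'e \<Rightarrow> 'e \<Rightarrow> 'e \<Rightarrow> real" where
  "gram c x v w = g (chart_inv c x) (coord_tvec \<A> c (chart_inv c x) v) (coord_tvec \<A> c (chart_inv c x) w)"

definition grad :: "('a, 'e) chart \<Rightarrow> 'e \<Rightarrow> 'e" where
  "grad c x = gradient \<A> g F (chart_inv c x) c"

lemma F_chart_smooth: "c \<in> \<A> \<Longrightarrow> smooth_on (chart_im c) (F \<circ> chart_inv c)"
  using smooth_F by (simp add: smooth_fun_def)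

lemma dF_has_derivative: "c \<in> \<A> \<Longrightarrow> x \<in> chart_im c \<Longrightarrow> (F \<circ> chart_inv c has_derivative dF c x) (at x)"
  unfolding dF_def by (rule smooth_on_has_derivative[OF F_chart_smooth])

lemma dF_smooth: "c \<in> \<A> \<Longrightarrow> smooth_on (chart_im c) (\<lambda>x. dF c x w)"
  unfolding dF_def by (rule smooth_on_derivative[OF F_chart_smooth])

lemma linear_dF: "c \<in> \<A> \<Longrightarrow> x \<in> chart_im c \<Longrightarrow> linear (dF c x)"
  using dF_has_derivative has_derivative_linear by blast

lemma differential_eq_dF:
  assumes c: "c \<in> charts_at \<A> p" and v: "v \<in> tangent_space \<A> p"
  shows "differential \<A> F p v = dF c (chart_map c p) (v c)"
proof -
  have p: "p \<in> M" using charts_atD[OF c] chart_dom_subset by blast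
  let ?c = "chart_at \<A> p"
  note A = charts_atD[OF c] charts_atD[OF chart_at_in[OF p]]
  have "(F \<circ> chart_inv ?c has_derivative dF c (chart_map c p) \<circ> change p ?c c) (at (chart_map ?c p))"
    by (rule has_derivative_change_chart[OF chart_at_in[OF p] c dF_has_derivative[OF A(1) chart_map_in[OF A(1,2)]]])
  then have "frechet_derivative (F \<circ> chart_inv ?c) (at (chart_map ?c p)) (v ?c) = dF c (chart_map c p) (change p ?c c (v ?c))"
    by (metis comp_apply frechet_derivative_at)
  moreover have "v c = change p ?c c (v ?c)" using v c chart_at_in[OF p] unfolding tangent_space_def by blast
  ultimately show ?thesis unfolding differential_def Let_def by metis
qed

lemma critical_point_iff:
  assumes c: "c \<in> charts_at \<A> p"
  shows "critical_point M \<A> F p \<longleftrightarrow> (\<forall>w. dF c (chart_map c p) w = 0)"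
proof -
  have "p \<in> M" using charts_atD[OF c] chart_dom_subset by blast
  then show ?thesis
    unfolding critical_point_def using differential_eq_dF[OF c] coord_tvec_at[OF c] by metis
qed

lemma gram_bilinear:
  assumes c: "c \<in> \<A>" and x: "x \<in> chart_im c"
  shows "bilinear (gram c x)"
proof -
  let ?p = "chart_inv c x"
  have c': "c \<in> charts_at \<A> ?p" by (rule charts_at_chart_inv[OF c x])
  have p: "?p \<in> M" using chart_inv_in[OF c x] chart_dom_subset[OF c] by blast
  have sym: "gram c x v w = gram c x w v" for v w
    using riemannian p coord_tvec_at(1)[OF c'] by (simp add: riemannian_metric_def gram_def)
  have lin: "gram c x (a *\<^sub>R u + b *\<^sub>R v) w = a * gram c x u w + b * gram c x v w" for a b u v w
    using riemannian p coord_tvec_at(1)[OF c'] unfolding riemannian_metric_def gram_def coord_tvec_linear[OF c'] by blast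
  have "linear (\<lambda>v. gram c x v w)" for w
    using lin[of 1 _ 1 _ w] lin[of _ _ 0 0 w] by (intro linearI) simp_all
  then show ?thesis unfolding bilinear_def using sym by simp
qed

lemma gram_pos:
  assumes c: "c \<in> \<A>" and x: "x \<in> chart_im c" and "w \<noteq> 0"
  shows "0 < gram c x w w"
proof -
  have c': "c \<in> charts_at \<A> (chart_inv c x)" by (rule charts_at_chart_inv[OF c x])
  have "chart_inv c x \<in> M" using chart_inv_in[OF c x] chart_dom_subset[OF c] by blast
  then show ?thesis
    using riemannian coord_tvec_at(1)[OF c'] coord_tvec_eq_0_iff[OF c'] assms(3)
    unfolding riemannian_metric_def gram_def by blast
qed

lemma gram_smooth: "c \<in> \<A> \<Longrightarrow> smooth_on (chart_im c) (\<lambda>x. gram c x v w)"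
  using riemannian by (simp add: riemannian_metric_def gram_def)

text \<open>In a chart the metric is a positive definite bilinear form, so the map that sends a vector to the
  linear form it represents is injective, hence bijective for reasons of dimension.\<close>

lemma gradient_exists:
  assumes p: "p \<in> M"
  shows "\<exists>!v. v \<in> tangent_space \<A> p \<and> (\<forall>\<xi>\<in>tangent_space \<A> p. g p v \<xi> = differential \<A> F p \<xi>)"
proof -
  define c x where "c = chart_at \<A> p" and "x = chart_map c p"
  have c: "c \<in> charts_at \<A> p" unfolding c_def by (rule chart_at_in[OF p])
  note A = charts_atD[OF c]
  have x: "x \<in> chart_im c" "chart_inv c x = p" by (simp_all add: x_def chart_map_in A chart_inv_map)
  note bil = gram_bilinear[OF A(1) x(1)]
  let ?f = "\<lambda>v. \<Sum>i\<in>Basis. gram c x v i *\<^sub>R i"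
  have lin2: "linear (gram c x v)" for v
    using bil by (simp_all add: bilinear_def)
  have f_inner: "?f v \<bullet> w = gram c x v w" for v w
    by (rule inner_riesz_vector[OF lin2])
  have "linear ?f"
    by (intro linearI)
       (simp_all add: bilinear_ladd[OF bil] bilinear_lmul[OF bil] scaleR_add_left sum.distrib scaleR_sum_right)
  moreover have "inj ?f"
  proof (subst linear_injective_0[OF \<open>linear ?f\<close>], intro allI impI)
    fix v assume "?f v = 0"
    then have "gram c x v v = 0" using f_inner[of v v] by simp
    then show "v = 0" using gram_pos[OF A(1) x(1), of v] by fastforce
  qed
  ultimately have "surj ?f" by (rule linear_inj_imp_surj)
  then obtain v where v: "(\<Sum>i\<in>Basis. dF c x i *\<^sub>R i) = ?f v" by (rule surjE)
  have gram_v: "gram c x v w = dF c x w" for w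
    using f_inner[of v w] inner_riesz_vector[OF linear_dF[OF A(1) x(1)], of w] by (simp only: v[symmetric])
  have g_gram: "g p u w = gram c x (u c) (w c)" if "u \<in> tangent_space \<A> p" "w \<in> tangent_space \<A> p" for u w
    unfolding gram_def x(2) using tangent_eq_coord_tvec[OF c that(1)] tangent_eq_coord_tvec[OF c that(2)] by metis
  show ?thesis
  proof (rule ex1I[of _ "coord_tvec \<A> c p v"], intro conjI ballI)
    show "coord_tvec \<A> c p v \<in> tangent_space \<A> p" by (rule coord_tvec_at(1)[OF c])
    show "g p (coord_tvec \<A> c p v) \<xi> = differential \<A> F p \<xi>" if "\<xi> \<in> tangent_space \<A> p" for \<xi>
      using g_gram[OF coord_tvec_at(1)[OF c] that] differential_eq_dF[OF c that] gram_v
      by (simp add: coord_tvec_at(2)[OF c] x_def)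
    fix u assume u: "u \<in> tangent_space \<A> p \<and> (\<forall>\<xi>\<in>tangent_space \<A> p. g p u \<xi> = differential \<A> F p \<xi>)"
    have "gram c x (u c) w = gram c x v w" for w
      using u g_gram[of u "coord_tvec \<A> c p w"] differential_eq_dF[OF c, of "coord_tvec \<A> c p w"] gram_v coord_tvec_at[OF c]
      by (simp add: x_def)
    then have "?f (u c) = ?f v" by simp
    then have "u c = v" using \<open>inj ?f\<close> by (simp add: inj_def)
    then show "u = coord_tvec \<A> c p v" using tangent_eq_coord_tvec[OF c] u by blast
  qed
qed

lemma gradient_in: "p \<in> M \<Longrightarrow> gradient \<A> g F p \<in> tangent_space \<A> p"
  and gradient_dual: "p \<in> M \<Longrightarrow> \<xi> \<in> tangent_space \<A> p \<Longrightarrow> g p (gradient \<A> g F p) \<xi> = differential \<A> F p \<xi>"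
  using theI'[OF gradient_exists] unfolding gradient_def[symmetric] by blast+

lemma gram_grad:
  assumes c: "c \<in> \<A>" and x: "x \<in> chart_im c"
  shows "gram c x (grad c x) w = dF c x w"
proof -
  let ?p = "chart_inv c x"
  have c': "c \<in> charts_at \<A> ?p" by (rule charts_at_chart_inv[OF c x])
  have p: "?p \<in> M" using chart_inv_in[OF c x] chart_dom_subset[OF c] by blast
  have "gram c x (grad c x) w = g ?p (gradient \<A> g F ?p) (coord_tvec \<A> c ?p w)"
    unfolding gram_def grad_def using tangent_eq_coord_tvec[OF c' gradient_in[OF p]] by metis
  also have "\<dots> = dF c x w"
    using gradient_dual[OF p coord_tvec_at(1)[OF c']] differential_eq_dF[OF c' coord_tvec_at(1)[OF c']]
    by (simp add: coord_tvec_at(2)[OF c'] chart_map_inv[OF c x])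
  finally show ?thesis .
qed

lemma grad_lipschitz:
  assumes c: "c \<in> \<A>" and K: "compact K" "convex K" "K \<subseteq> chart_im c"
  obtains B L where "0 < B" "0 \<le> L" "\<And>x. x \<in> K \<Longrightarrow> norm (grad c x) \<le> B"
    "\<And>x y. x \<in> K \<Longrightarrow> y \<in> K \<Longrightarrow> norm (grad c x - grad c y) \<le> L * norm (x - y)"
proof (rule dual_field_lipschitz[OF K, of "gram c" "dF c" "grad c"])
  fix x assume "x \<in> K"
  then have x: "x \<in> chart_im c" using K(3) by blast
  show "bilinear (gram c x)" "linear (dF c x)" "gram c x (grad c x) w = dF c x w" for w
    by (rule gram_bilinear[OF c x] linear_dF[OF c x] gram_grad[OF c x])+
  show "w \<noteq> 0 \<Longrightarrow> 0 < gram c x w w" for w by (rule gram_pos[OF c x])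
next
  show "smooth_on (chart_im c) (\<lambda>x. gram c x v w)" "smooth_on (chart_im c) (\<lambda>x. dF c x w)" for v w
    by (rule gram_smooth[OF c] dF_smooth[OF c])+
qed (use that in blast)

end

section \<open>The gradient flow\<close>

locale gradient_flow = riemannian_function M \<A> g F
  for M :: "'a::metric_space set" and \<A> :: "('a, 'e::euclidean_space) chart set"
    and g :: "'a \<Rightarrow> ('a, 'e) tvec \<Rightarrow> ('a, 'e) tvec \<Rightarrow> real" and F :: "'a \<Rightarrow> real" +
  fixes \<phi> :: "real \<Rightarrow> 'a \<Rightarrow> 'a"
  assumes compact_M: "compact M" and flow: "negative_gradient_flow M \<A> g F \<phi>"
begin

definition trajectory :: "(real \<Rightarrow> 'a) \<Rightarrow> bool" where
  "trajectory \<gamma> \<longleftrightarrow> (\<forall>t. \<gamma> t \<in> M \<and> has_velocity \<A> \<gamma> t (\<lambda>c. - gradient \<A> g F (\<gamma> t) c))"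

lemma trajectory_flow: "x \<in> M \<Longrightarrow> trajectory (\<lambda>t. \<phi> t x)"
  and flow_zero: "x \<in> M \<Longrightarrow> \<phi> 0 x = x" and flow_in_M: "x \<in> M \<Longrightarrow> \<phi> t x \<in> M"
  using flow by (auto simp: negative_gradient_flow_def trajectory_def)

lemma trajectory_in: "trajectory \<gamma> \<Longrightarrow> \<gamma> t \<in> M"
  by (simp add: trajectory_def)

lemma trajectory_continuous: "trajectory \<gamma> \<Longrightarrow> continuous_on S \<gamma>"
  by (auto simp: trajectory_def has_velocity_def intro: continuous_at_imp_continuous_on)

lemma trajectory_chart_derivative:
  assumes "trajectory \<gamma>" "c \<in> \<A>" "\<gamma> t \<in> chart_dom c"
  shows "((\<lambda>t. chart_map c (\<gamma> t)) has_vector_derivative - grad c (chart_map c (\<gamma> t))) (at t)"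
proof -
  have "c \<in> charts_at \<A> (\<gamma> t)" using assms by (simp add: charts_at_def)
  then have "((chart_map c \<circ> \<gamma>) has_vector_derivative - gradient \<A> g F (\<gamma> t) c) (at t)"
    using assms(1) unfolding trajectory_def has_velocity_def by blast
  then show ?thesis by (simp add: grad_def chart_inv_map assms comp_def)
qed

lemma trajectory_shift:
  assumes "trajectory \<gamma>"
  shows "trajectory (\<lambda>t. \<gamma> (t + s))"
proof -
  have "has_velocity \<A> (\<lambda>t. \<gamma> (t + s)) t v" if v: "has_velocity \<A> \<gamma> (t + s) v" for t v
    unfolding has_velocity_def
  proof (intro conjI ballI)
    have "isCont \<gamma> (t + s)" using v by (simp add: has_velocity_def)
    then show "isCont (\<lambda>t. \<gamma> (t + s)) t" by (intro isCont_o2[of t "\<lambda>t. t + s" \<gamma>]) (auto intro: continuous_intros)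
    show "v \<in> tangent_space \<A> (\<gamma> (t + s))" using v by (simp add: has_velocity_def)
    fix c assume "c \<in> charts_at \<A> (\<gamma> (t + s))"
    then have "((chart_map c \<circ> \<gamma>) has_vector_derivative v c) (at (t + s))" using v by (simp add: has_velocity_def)
    moreover have "((\<lambda>t. t + s) has_vector_derivative 1) (at t)" by (auto intro!: derivative_eq_intros)
    ultimately have "((chart_map c \<circ> \<gamma> \<circ> (\<lambda>t. t + s)) has_vector_derivative (1 *\<^sub>R v c)) (at t)"
      by (intro vector_diff_chain_at)
    then show "((chart_map c \<circ> (\<lambda>t. \<gamma> (t + s))) has_vector_derivative v c) (at t)" by (simp add: comp_def)
  qed
  then show ?thesis using assms by (simp add: trajectory_def)
qed

lemma chart_preimage_open:
  assumes "continuous_on UNIV \<beta>" "range \<beta> \<subseteq> M" "openin (top_of_set M) D"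
  shows "open {s::real. \<beta> s \<in> D}"
proof -
  have "openin (top_of_set UNIV) (UNIV \<inter> \<beta> -` D)"
    by (rule continuous_openin_preimage[OF assms(1) _ assms(3)]) (use assms(2) in auto)
  then show ?thesis by (simp add: vimage_def)
qed

text \<open>The time at which a curve leaves a chart is not known in advance, so its speed cannot be bounded by that
  of its coordinate representation from the start. At the first exit time from the ball, however, the
  speed bound shows that the curve is still in a smaller closed ball. The field \<open>W\<close> will be
  the gradient with either sign, in order to cover both directions of time.\<close>

lemma stays_in_chart:
  assumes c: "c \<in> \<A>" and ball: "cball u R \<subseteq> chart_im c"
    and B: "0 < B" "\<And>x. x \<in> cball u R \<Longrightarrow> norm (W x) \<le> B"
    and \<beta>: "continuous_on UNIV \<beta>" "range \<beta> \<subseteq> M"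
    and deriv: "\<And>t. \<beta> t \<in> chart_dom c \<Longrightarrow>
      ((\<lambda>t. chart_map c (\<beta> t)) has_vector_derivative W (chart_map c (\<beta> t))) (at t)"
    and start: "\<beta> 0 \<in> chart_inv c ` ball u (R / 2)" and t: "0 \<le> t" "t \<le> R / (4 * B)"
  shows "\<beta> t \<in> chart_dom c \<and> chart_map c (\<beta> t) \<in> cball u R \<and>
    norm (chart_map c (\<beta> t) - chart_map c (\<beta> 0)) \<le> B * t"
proof -
  define D where "D = chart_inv c ` ball u R"
  have D_iff: "p \<in> chart_inv c ` X \<longleftrightarrow> p \<in> chart_dom c \<and> chart_map c p \<in> X" if "X \<subseteq> chart_im c" for X p
  proof
    assume "p \<in> chart_inv c ` X"
    then obtain x where "x \<in> X" "p = chart_inv c x" by blast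
    then show "p \<in> chart_dom c \<and> chart_map c p \<in> X"
      using that chart_inv_in[OF c, of x] chart_map_inv[OF c, of x] by (simp add: subset_iff)
  next
    assume p: "p \<in> chart_dom c \<and> chart_map c p \<in> X"
    then show "p \<in> chart_inv c ` X" using chart_inv_map[OF c, of p] by (intro image_eqI[of _ _ "chart_map c p"]) simp_all
  qed
  have subs: "ball u R \<subseteq> chart_im c" "ball u (R / 2) \<subseteq> chart_im c" "cball u (3 * R / 4) \<subseteq> chart_im c" if "R > 0"
  proof -
    show "ball u R \<subseteq> chart_im c" using ball ball_subset_cball by blast
    show "ball u (R / 2) \<subseteq> chart_im c" using ball that by (auto simp: subset_iff)
    show "cball u (3 * R / 4) \<subseteq> chart_im c" using ball that by (auto simp: subset_iff)
  qed
  have R: "R > 0"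
  proof (rule ccontr)
    assume "\<not> ?thesis" then show False using start by (simp add: ball_empty)
  qed
  note subs = subs[OF R]
  have \<beta>0: "\<beta> 0 \<in> chart_dom c" "dist u (chart_map c (\<beta> 0)) < R / 2"
    using start unfolding D_iff[OF subs(2)] by simp_all
  have drift: "norm (chart_map c (\<beta> s) - chart_map c (\<beta> 0)) \<le> B * s"
    if s: "0 \<le> s" "\<And>r. 0 \<le> r \<Longrightarrow> r \<le> s \<Longrightarrow> \<beta> r \<in> D" for s
  proof -
    have "norm (chart_map c (\<beta> s) - chart_map c (\<beta> 0)) \<le> B * norm (s - 0)"
    proof (rule differentiable_bound)
      show "convex {0..s}" "s \<in> {0..s}" "0 \<in> {0..s}" using s by simp_all
      fix r assume r: "r \<in> {0..s}"
      then have "\<beta> r \<in> D" using s by simp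
      then have \<beta>r: "\<beta> r \<in> chart_dom c" "chart_map c (\<beta> r) \<in> cball u R"
        unfolding D_def D_iff[OF subs(1)] by simp_all
      show "((\<lambda>t. chart_map c (\<beta> t)) has_derivative (\<lambda>h. h *\<^sub>R W (chart_map c (\<beta> r)))) (at r within {0..s})"
        using deriv[OF \<beta>r(1)] unfolding has_vector_derivative_def by (rule has_derivative_at_withinI)
      show "onorm (\<lambda>h. h *\<^sub>R W (chart_map c (\<beta> r))) \<le> B"
        using B(1) B(2)[OF \<beta>r(2)] by (intro onorm_bound) (simp_all add: mult.commute[of B] mult_left_mono)
    qed
    then show ?thesis using s by simp
  qed
  have "\<beta> s \<in> D" if s: "0 \<le> s" "s \<le> R / (4 * B)" for s
  proof (rule ccontr)
    assume out: "\<beta> s \<notin> D"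
    define X where "X = {0..s} - {r. \<beta> r \<in> D}"
    have "open {r. \<beta> r \<in> D}"
      unfolding D_def by (rule chart_preimage_open[OF \<beta> chart_inv_image_open[OF c open_ball subs(1)]])
    then have "compact X" unfolding X_def by (intro compact_diff) simp
    moreover have "X \<noteq> {}" using out s by (auto simp: X_def)
    ultimately obtain e where e: "e \<in> X" "\<And>r. r \<in> X \<Longrightarrow> e \<le> r" using compact_attains_inf[of X] by blast
    have before: "\<beta> r \<in> D" if "0 \<le> r" "r < e" for r
      using e that by (force simp: X_def)
    have "\<beta> 0 \<in> D" using \<beta>0 R unfolding D_def D_iff[OF subs(1)] by simp
    then have "e \<noteq> 0" using e(1) by (auto simp: X_def)
    then have e0: "e > 0" "e \<le> s" using e(1) by (auto simp: X_def)
    have near: "\<beta> r \<in> chart_inv c ` cball u (3 * R / 4)" if r: "0 < r" "r < e" for r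
    proof -
      have "norm (chart_map c (\<beta> r) - chart_map c (\<beta> 0)) \<le> B * r" using r before by (intro drift) auto
      also have "\<dots> \<le> B * (R / (4 * B))" using r e0 s B(1) by (intro mult_left_mono) auto
      also have "\<dots> = R / 4" using B(1) by simp
      finally have "dist (chart_map c (\<beta> 0)) (chart_map c (\<beta> r)) \<le> R / 4" by (simp add: dist_norm norm_minus_commute)
      then have "dist u (chart_map c (\<beta> r)) \<le> 3 * R / 4"
        using \<beta>0(2) dist_triangle[of u "chart_map c (\<beta> r)" "chart_map c (\<beta> 0)"] by linarith
      moreover have "\<beta> r \<in> chart_dom c" using before[of r] r unfolding D_def D_iff[OF subs(1)] by simp
      ultimately show ?thesis unfolding D_iff[OF subs(3)] by simp
    qed
    have "compact (chart_inv c ` cball u (3 * R / 4))"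
      by (rule compact_continuous_image[OF continuous_on_subset[OF chart_inv_continuous[OF c] subs(3)]]) simp
    then have "closed (chart_inv c ` cball u (3 * R / 4))" by (rule compact_imp_closed)
    moreover have "\<forall>\<^sub>F r in at_left e. \<beta> r \<in> chart_inv c ` cball u (3 * R / 4)"
      using near e0(1) by (intro eventually_at_leftI[of 0]) auto
    moreover have "(\<beta> \<longlongrightarrow> \<beta> e) (at_left e)"
      using \<beta>(1) by (metis UNIV_I continuous_on_def filterlim_at_split open_UNIV at_within_open)
    ultimately have "\<beta> e \<in> chart_inv c ` cball u (3 * R / 4)"
      by (intro Lim_in_closed_set[of _ \<beta> "at_left e"]) auto
    moreover have "cball u (3 * R / 4) \<subseteq> ball u R" using R by (auto simp: subset_iff)
    ultimately have "\<beta> e \<in> D" unfolding D_def by blast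
    then show False using e(1) by (simp add: X_def)
  qed
  then show ?thesis
    using drift[of t] t D_iff[OF subs(1), of "\<beta> t"] unfolding D_def by auto
qed

text \<open>Up to time \<open>\<tau>\<close>, trajectories from \<open>N\<close> remain in one chart, where they have speed at most \<open>B\<close> and
  the distance between them grows at most by the factor \<open>E\<close>.\<close>

definition flow_box :: "('a, 'e) chart \<Rightarrow> 'a set \<Rightarrow> real \<Rightarrow> real \<Rightarrow> real \<Rightarrow> bool" where
  "flow_box c N \<tau> B E \<longleftrightarrow> openin (top_of_set M) N \<and> N \<subseteq> chart_dom c \<and> 0 < \<tau> \<and>
     (\<forall>\<gamma> t. trajectory \<gamma> \<longrightarrow> \<gamma> 0 \<in> N \<longrightarrow> \<bar>t\<bar> \<le> \<tau> \<longrightarrow>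
        \<gamma> t \<in> chart_dom c \<and> norm (chart_map c (\<gamma> t) - chart_map c (\<gamma> 0)) \<le> B * \<bar>t\<bar>) \<and>
     (\<forall>\<gamma> \<gamma>' t. trajectory \<gamma> \<longrightarrow> trajectory \<gamma>' \<longrightarrow> \<gamma> 0 \<in> N \<longrightarrow> \<gamma>' 0 \<in> N \<longrightarrow> \<bar>t\<bar> \<le> \<tau> \<longrightarrow>
        norm (chart_map c (\<gamma> t) - chart_map c (\<gamma>' t)) \<le> E * norm (chart_map c (\<gamma> 0) - chart_map c (\<gamma>' 0)))"

lemma flow_boxD:
  assumes "flow_box c N \<tau> B E"
  shows "openin (top_of_set M) N" "N \<subseteq> chart_dom c" "0 < \<tau>"
    and "trajectory \<gamma> \<Longrightarrow> \<gamma> 0 \<in> N \<Longrightarrow> \<bar>t\<bar> \<le> \<tau> \<Longrightarrow> \<gamma> t \<in> chart_dom c"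
    and "trajectory \<gamma> \<Longrightarrow> \<gamma> 0 \<in> N \<Longrightarrow> \<bar>t\<bar> \<le> \<tau> \<Longrightarrow> norm (chart_map c (\<gamma> t) - chart_map c (\<gamma> 0)) \<le> B * \<bar>t\<bar>"
    and "trajectory \<gamma> \<Longrightarrow> trajectory \<gamma>' \<Longrightarrow> \<gamma> 0 \<in> N \<Longrightarrow> \<gamma>' 0 \<in> N \<Longrightarrow> \<bar>t\<bar> \<le> \<tau> \<Longrightarrow>
      norm (chart_map c (\<gamma> t) - chart_map c (\<gamma>' t)) \<le> E * norm (chart_map c (\<gamma> 0) - chart_map c (\<gamma>' 0))"
  using assms unfolding flow_box_def by blast+

lemma flow_box_exists:
  assumes p: "p \<in> M"
  obtains c N \<tau> B E where "c \<in> charts_at \<A> p" "p \<in> N" "flow_box c N \<tau> B E"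
proof -
  define c u where "c = chart_at \<A> p" and "u = chart_map c p"
  have c: "c \<in> charts_at \<A> p" unfolding c_def by (rule chart_at_in[OF p])
  note A = charts_atD[OF c]
  have u: "u \<in> chart_im c" unfolding u_def by (rule chart_map_in[OF A])
  obtain R where R: "R > 0" "cball u R \<subseteq> chart_im c"
    using chart_im_open[OF A(1)] u unfolding open_contains_cball by blast
  obtain B L where B: "0 < B" "0 \<le> L" "\<And>x. x \<in> cball u R \<Longrightarrow> norm (grad c x) \<le> B"
    "\<And>x y. x \<in> cball u R \<Longrightarrow> y \<in> cball u R \<Longrightarrow> norm (grad c x - grad c y) \<le> L * norm (x - y)"
    by (rule grad_lipschitz[OF A(1) compact_cball convex_cball R(2)]) blast
  define N where "N = chart_inv c ` ball u (R / 2)"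
  have half: "ball u (R / 2) \<subseteq> chart_im c" using R by (auto simp: subset_iff)
  \<comment> \<open>With speed at most \<open>B\<close>, a trajectory from the ball of radius \<open>R / 2\<close> stays within \<open>3 * R / 4\<close> up to this time.\<close>
  define \<tau> where "\<tau> = R / (4 * B)"
  have \<tau>: "\<tau> > 0" using R B by (simp add: \<tau>_def)
  define W where "W \<sigma> x = \<sigma> *\<^sub>R grad c x" for \<sigma> :: real and x
  have oriented: "\<gamma> (\<sigma> * t) \<in> chart_dom c \<and> chart_map c (\<gamma> (\<sigma> * t)) \<in> cball u R \<and>
      norm (chart_map c (\<gamma> (\<sigma> * t)) - chart_map c (\<gamma> 0)) \<le> B * t \<and>
      ((\<lambda>t. chart_map c (\<gamma> (\<sigma> * t))) has_vector_derivative W (- \<sigma>) (chart_map c (\<gamma> (\<sigma> * t)))) (at t)"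
    if \<gamma>: "trajectory \<gamma>" "\<gamma> 0 \<in> N" and \<sigma>: "\<bar>\<sigma>\<bar> = 1" and t: "0 \<le> t" "t \<le> \<tau>" for \<gamma> \<sigma> t
  proof -
    have deriv: "((\<lambda>t. chart_map c (\<gamma> (\<sigma> * t))) has_vector_derivative W (- \<sigma>) (chart_map c (\<gamma> (\<sigma> * t)))) (at t)"
      if "\<gamma> (\<sigma> * t) \<in> chart_dom c" for t
    proof -
      have "((\<lambda>t. \<sigma> * t) has_vector_derivative \<sigma>) (at t)" by (auto intro!: derivative_eq_intros)
      from vector_diff_chain_at[OF this trajectory_chart_derivative[OF \<gamma>(1) A(1) that]]
      show ?thesis by (simp add: comp_def W_def)
    qed
    have "\<gamma> (\<sigma> * t) \<in> chart_dom c \<and> chart_map c (\<gamma> (\<sigma> * t)) \<in> cball u R \<and>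
        norm (chart_map c (\<gamma> (\<sigma> * t)) - chart_map c (\<gamma> (\<sigma> * 0))) \<le> B * t"
    proof (rule stays_in_chart[OF A(1) R(2) B(1), where W = "W (- \<sigma>)"])
      show "norm (W (- \<sigma>) x) \<le> B" if "x \<in> cball u R" for x using B(3)[OF that] \<sigma> by (simp add: W_def)
      show "continuous_on UNIV (\<lambda>t. \<gamma> (\<sigma> * t))"
        by (rule continuous_on_compose2[OF trajectory_continuous[OF \<gamma>(1), of UNIV]]) (auto intro!: continuous_intros)
      show "range (\<lambda>t. \<gamma> (\<sigma> * t)) \<subseteq> M" using trajectory_in[OF \<gamma>(1)] by auto
      show "\<gamma> (\<sigma> * 0) \<in> chart_inv c ` ball u (R / 2)" using \<gamma>(2) by (simp add: N_def)
    qed (use deriv t \<tau>_def in auto)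
    then show ?thesis using deriv by simp
  qed
  have split: "\<exists>\<sigma> s. \<bar>\<sigma>\<bar> = 1 \<and> t = \<sigma> * s \<and> 0 \<le> s \<and> s \<le> \<tau> \<and> s = \<bar>t\<bar>" if "\<bar>t\<bar> \<le> \<tau>" for t
    using that by (intro exI[of _ "if t < 0 then -1 else 1"] exI[of _ "\<bar>t\<bar>"]) auto
  have "p \<in> N" unfolding N_def using R chart_inv_map[OF A] by (intro image_eqI[of _ _ u]) (simp_all add: u_def)
  moreover have "flow_box c N \<tau> B (exp (L * \<tau>))"
    unfolding flow_box_def
  proof (intro conjI allI impI)
    show "openin (top_of_set M) N" unfolding N_def by (rule chart_inv_image_open[OF A(1) open_ball half])
    show "N \<subseteq> chart_dom c" unfolding N_def using chart_inv_in[OF A(1)] half by blast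
    show "0 < \<tau>" by (rule \<tau>)
    show "\<gamma> t \<in> chart_dom c" "norm (chart_map c (\<gamma> t) - chart_map c (\<gamma> 0)) \<le> B * \<bar>t\<bar>"
      if "trajectory \<gamma>" "\<gamma> 0 \<in> N" "\<bar>t\<bar> \<le> \<tau>" for \<gamma> t
      using split[OF that(3)] oriented[OF that(1,2)] by metis+
    show "norm (chart_map c (\<gamma> t) - chart_map c (\<gamma>' t)) \<le> exp (L * \<tau>) * norm (chart_map c (\<gamma> 0) - chart_map c (\<gamma>' 0))"
      if \<gamma>: "trajectory \<gamma>" "trajectory \<gamma>'" "\<gamma> 0 \<in> N" "\<gamma>' 0 \<in> N" and t: "\<bar>t\<bar> \<le> \<tau>" for \<gamma> \<gamma>' t
    proof -
      obtain \<sigma> s where s: "\<bar>\<sigma>\<bar> = 1" "t = \<sigma> * s" "0 \<le> s" "s \<le> \<tau>" using split[OF t] by blast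
      have "norm (chart_map c (\<gamma> (\<sigma> * s)) - chart_map c (\<gamma>' (\<sigma> * s)))
          \<le> exp (L * s) * norm (chart_map c (\<gamma> (\<sigma> * 0)) - chart_map c (\<gamma>' (\<sigma> * 0)))"
      proof (rule solutions_diverge_exponentially[where W = "W (- \<sigma>)", OF s(3)])
        fix r assume "r \<in> {0..s}"
        then have r: "0 \<le> r" "r \<le> \<tau>" using s(4) by auto
        note o = oriented[OF \<gamma>(1,3) s(1) r] oriented[OF \<gamma>(2,4) s(1) r]
        show "((\<lambda>t. chart_map c (\<gamma> (\<sigma> * t))) has_vector_derivative W (- \<sigma>) (chart_map c (\<gamma> (\<sigma> * r)))) (at r)"
          "((\<lambda>t. chart_map c (\<gamma>' (\<sigma> * t))) has_vector_derivative W (- \<sigma>) (chart_map c (\<gamma>' (\<sigma> * r)))) (at r)"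
          using o by blast+
        show "norm (W (- \<sigma>) (chart_map c (\<gamma> (\<sigma> * r))) - W (- \<sigma>) (chart_map c (\<gamma>' (\<sigma> * r))))
            \<le> L * norm (chart_map c (\<gamma> (\<sigma> * r)) - chart_map c (\<gamma>' (\<sigma> * r)))"
          using B(4)[of "chart_map c (\<gamma> (\<sigma> * r))" "chart_map c (\<gamma>' (\<sigma> * r))"] o s(1)
          unfolding W_def scaleR_diff_right[symmetric] by simp
      qed
      also have "\<dots> \<le> exp (L * \<tau>) * norm (chart_map c (\<gamma> (\<sigma> * 0)) - chart_map c (\<gamma>' (\<sigma> * 0)))"
        using B(2) s(4) by (intro mult_right_mono) (simp_all add: mult_left_mono)
      finally show ?thesis using s(2) by simp
    qed
  qed
  ultimately show ?thesis using that[OF c] by blast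
qed

text \<open>Two trajectories agree on a closed set of times, which is open by the Gronwall estimate in flow boxes.\<close>

lemma trajectory_unique:
  assumes \<gamma>: "trajectory \<gamma>" "trajectory \<gamma>'" "\<gamma> 0 = \<gamma>' 0"
  shows "\<gamma> t = \<gamma>' t"
proof -
  define S where "S = {t. \<gamma> t = \<gamma>' t}"
  have "closed S"
    unfolding S_def using \<gamma>(1,2) by (intro closed_Collect_eq trajectory_continuous)
  moreover have "open S"
  proof (subst open_subopen, intro ballI)
    fix t assume "t \<in> S"
    then have eq: "\<gamma> t = \<gamma>' t" by (simp add: S_def)
    obtain c N \<tau> B E where box: "c \<in> charts_at \<A> (\<gamma> t)" "\<gamma> t \<in> N" "flow_box c N \<tau> B E"
      by (rule flow_box_exists[OF trajectory_in[OF \<gamma>(1), of t]]) blast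
    note fb = flow_boxD[OF box(3)]
    have "\<gamma> (t + s) = \<gamma>' (t + s)" if s: "\<bar>s\<bar> \<le> \<tau>" for s
    proof -
      note sh = trajectory_shift[OF \<gamma>(1), of t] trajectory_shift[OF \<gamma>(2), of t]
      have "norm (chart_map c (\<gamma> (s + t)) - chart_map c (\<gamma>' (s + t))) \<le> 0"
        using fb(6)[OF sh _ _ s] box(2) eq by simp
      then have "chart_map c (\<gamma> (s + t)) = chart_map c (\<gamma>' (s + t))" by simp
      moreover have "\<gamma> (s + t) \<in> chart_dom c" "\<gamma>' (s + t) \<in> chart_dom c"
        using fb(4)[OF sh(1) _ s] fb(4)[OF sh(2) _ s] box(2) eq by simp_all
      ultimately show ?thesis using chart_inv_map[OF charts_atD(1)[OF box(1)]] by (metis add.commute)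
    qed
    then have "ball t \<tau> \<subseteq> S"
      unfolding S_def by (auto simp: dist_real_def) (metis abs_minus_commute add_diff_cancel_left' diff_add_cancel less_imp_le add.commute)
    then show "\<exists>T. open T \<and> t \<in> T \<and> T \<subseteq> S" using fb(3) by (intro exI[of _ "ball t \<tau>"]) simp
  qed
  moreover have "0 \<in> S" using \<gamma>(3) by (simp add: S_def)
  ultimately have "S = UNIV" using clopen[of S] by blast
  then show ?thesis by (auto simp: S_def)
qed

lemma flow_group: "x \<in> M \<Longrightarrow> \<phi> (s + t) x = \<phi> s (\<phi> t x)"
  using trajectory_unique[OF trajectory_shift[OF trajectory_flow, of x t] trajectory_flow[OF flow_in_M, of x t], of s]
  by (simp add: flow_zero flow_in_M)

lemma eventually_in_openin:
  assumes "openin (top_of_set M) N" "x \<in> N"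
  shows "\<forall>\<^sub>F y in at x within M. y \<in> N"
proof -
  obtain O' where "open O'" "N = M \<inter> O'" using assms(1) by (metis openin_open)
  then show ?thesis using assms(2) by (auto simp: eventually_at_topological)
qed

lemma chart_map_tendsto:
  assumes c: "c \<in> charts_at \<A> p"
  shows "(chart_map c \<longlongrightarrow> chart_map c p) (at p within M)"
proof -
  note A = charts_atD[OF c]
  obtain O' where O': "open O'" "chart_dom c = M \<inter> O'" using chart_dom_open[OF A(1)] by (metis openin_open)
  have "(chart_map c \<longlongrightarrow> chart_map c p) (at p within chart_dom c)"
    using chart_map_continuous[OF A(1)] A(2) by (simp add: continuous_on_def)
  moreover have "at p within chart_dom c = at p within M"
    by (rule at_within_nhd[of _ O']) (use O' A(2) in auto)
  ultimately show ?thesis by simp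
qed

lemma tendsto_from_chart:
  assumes c: "c \<in> \<A>" and q: "q \<in> chart_dom c" and dom: "\<forall>\<^sub>F y in G. h y \<in> chart_dom c"
    and lim: "((\<lambda>y. chart_map c (h y)) \<longlongrightarrow> chart_map c q) G"
  shows "(h \<longlongrightarrow> q) G"
proof -
  have "\<forall>\<^sub>F y in G. chart_map c (h y) \<in> chart_im c"
    using dom by eventually_elim (rule chart_map_in[OF c])
  from continuous_on_tendsto_compose[OF chart_inv_continuous[OF c] lim chart_map_in[OF c q] this]
  have "((\<lambda>y. chart_inv c (chart_map c (h y))) \<longlongrightarrow> q) G" by (simp add: chart_inv_map[OF c q])
  moreover have "\<forall>\<^sub>F y in G. chart_inv c (chart_map c (h y)) = h y"
    using dom by eventually_elim (rule chart_inv_map[OF c])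
  ultimately show ?thesis by (rule Lim_transform_eventually)
qed

text \<open>Each flow box gives continuity for a short time near one point; finitely many flow boxes cover \<open>M\<close>,
  so that the time can be chosen uniformly.\<close>

lemma short_time_continuity: "\<exists>\<tau>>0. \<forall>t. \<bar>t\<bar> \<le> \<tau> \<longrightarrow> continuous_on M (\<phi> t)"
proof -
  define good where "good N \<tau> \<longleftrightarrow> 0 < \<tau> \<and> (\<forall>t x. \<bar>t\<bar> \<le> \<tau> \<longrightarrow> x \<in> N \<longrightarrow> (\<phi> t \<longlongrightarrow> \<phi> t x) (at x within M))" for N \<tau>
  have local: "\<exists>N \<tau>. openin (top_of_set M) N \<and> p \<in> N \<and> good N \<tau>" if p: "p \<in> M" for p
  proof -
    obtain c N \<tau> B E where box: "c \<in> charts_at \<A> p" "p \<in> N" "flow_box c N \<tau> B E"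
      by (rule flow_box_exists[OF p]) blast
    note fb = flow_boxD[OF box(3)]
    have "(\<phi> t \<longlongrightarrow> \<phi> t x) (at x within M)" if t: "\<bar>t\<bar> \<le> \<tau>" and x: "x \<in> N" for t x
    proof -
      note A = charts_atD(1)[OF box(1)]
      have NM: "N \<subseteq> M" by (rule openin_imp_subset[OF fb(1)])
      have dom: "\<phi> t y \<in> chart_dom c" if "y \<in> N" for y
        using fb(4)[OF trajectory_flow _ t, of y] that NM flow_zero by auto
      have bound: "norm (chart_map c (\<phi> t y) - chart_map c (\<phi> t x)) \<le> E * norm (chart_map c y - chart_map c x)" if "y \<in> N" for y
        using fb(6)[OF trajectory_flow trajectory_flow _ _ t, of y x] that x NM flow_zero by auto
      have ev: "\<forall>\<^sub>F y in at x within M. y \<in> N" by (rule eventually_in_openin[OF fb(1) x])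
      have cx: "c \<in> charts_at \<A> x" using A fb(2) x by (auto simp: charts_at_def)
      \<comment> \<open>In the chart, the difference at time \<open>t\<close> is controlled by the initial difference.\<close>
      have lim0: "((\<lambda>y. E * norm (chart_map c y - chart_map c x)) \<longlongrightarrow> 0) (at x within M)"
        by (intro tendsto_mult_right_zero tendsto_norm_zero LIM_zero chart_map_tendsto[OF cx])
      have "((\<lambda>y. chart_map c (\<phi> t y) - chart_map c (\<phi> t x)) \<longlongrightarrow> 0) (at x within M)"
        by (rule Lim_null_comparison[OF _ lim0]) (rule eventually_mono[OF ev bound])
      then have "((\<lambda>y. chart_map c (\<phi> t y)) \<longlongrightarrow> chart_map c (\<phi> t x)) (at x within M)" by (rule LIM_zero_cancel)
      moreover have "\<forall>\<^sub>F y in at x within M. \<phi> t y \<in> chart_dom c" by (rule eventually_mono[OF ev dom])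
      ultimately show ?thesis by (intro tendsto_from_chart[OF A dom[OF x]])
    qed
    then show ?thesis using box(2) fb(1,3) by (auto simp: good_def)
  qed
  define C where "C = {N. openin (top_of_set M) N \<and> (\<exists>\<tau>. good N \<tau>)}"
  have "M \<subseteq> \<Union>C" using local unfolding C_def by blast
  moreover have "\<forall>N\<in>C. openin (top_of_set M) N" by (simp add: C_def)
  ultimately obtain D where D: "D \<subseteq> C" "finite D" "M \<subseteq> \<Union>D"
    using compact_M unfolding compact_eq_openin_cover by meson
  have "\<forall>N\<in>D. \<exists>\<tau>. good N \<tau>" using D(1) by (auto simp: C_def)
  then obtain T where T: "\<And>N. N \<in> D \<Longrightarrow> good N (T N)" by metis
  define \<tau> where "\<tau> = Min (insert 1 (T ` D))"
  have "\<tau> > 0" using T D(2) by (auto simp: \<tau>_def good_def)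
  moreover have "continuous_on M (\<phi> t)" if t: "\<bar>t\<bar> \<le> \<tau>" for t
    unfolding continuous_on_def
  proof
    fix x assume "x \<in> M"
    then obtain N where N: "N \<in> D" "x \<in> N" using D(3) by blast
    have "\<tau> \<le> T N" unfolding \<tau>_def using D(2) N(1) by (intro Min_le) auto
    then show "(\<phi> t \<longlongrightarrow> \<phi> t x) (at x within M)" using T[OF N(1)] N(2) t by (auto simp: good_def)
  qed
  ultimately show ?thesis by blast
qed

text \<open>A time-\<open>t\<close> map is an iterate of a map for a short time.\<close>

lemma time_map_continuous: "continuous_on M (\<phi> t)"
proof -
  obtain \<tau> where \<tau>: "\<tau> > 0" "\<And>t. \<bar>t\<bar> \<le> \<tau> \<Longrightarrow> continuous_on M (\<phi> t)" using short_time_continuity by blast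
  define n where "n = nat \<lceil>\<bar>t\<bar> / \<tau>\<rceil> + 1"
  define s where "s = t / real n"
  have "\<bar>t\<bar> / \<tau> \<le> real n" unfolding n_def by linarith
  then have "\<bar>t\<bar> \<le> \<tau> * real n" using \<tau>(1) by (simp add: field_simps)
  moreover have n: "real n > 0" by (simp add: n_def)
  ultimately have s: "\<bar>s\<bar> \<le> \<tau>" by (simp add: s_def field_simps)
  have "continuous_on M (\<phi> (real k * s))" for k
  proof (induction k)
    case 0
    show ?case by (rule continuous_on_eq[OF continuous_on_id]) (simp add: flow_zero)
  next
    case (Suc k)
    have "continuous_on M (\<lambda>x. \<phi> s (\<phi> (real k * s) x))"
      by (rule continuous_on_compose2[OF \<tau>(2)[OF s] Suc]) (auto simp: flow_in_M)
    moreover have "\<phi> s (\<phi> (real k * s) x) = \<phi> (real (Suc k) * s) x" if "x \<in> M" for x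
      using flow_group[OF that, of s "real k * s"] by (simp add: algebra_simps)
    ultimately show ?case by (rule continuous_on_eq)
  qed
  then have "continuous_on M (\<phi> (real n * s))" .
  then show ?thesis using n by (simp add: s_def)
qed

text \<open>Near \<open>(t0, x0)\<close>, flow first for the fixed time \<open>t0\<close>, which is continuous in the point; the remaining short
  time moves points only by the speed bound of a flow box.\<close>

lemma flow_jointly_continuous: "continuous_on (UNIV \<times> M) (\<lambda>(t, x). \<phi> t x)"
  unfolding continuous_on_def
proof
  fix z :: "real \<times> 'a" assume z: "z \<in> UNIV \<times> M"
  obtain t0 x0 where z0: "z = (t0, x0)" "x0 \<in> M" using z by auto
  let ?G = "at z within UNIV \<times> M"
  define y0 where "y0 = \<phi> t0 x0"
  have y0: "y0 \<in> M" by (simp add: y0_def flow_in_M z0)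
  obtain c N \<tau> B E where box: "c \<in> charts_at \<A> y0" "y0 \<in> N" "flow_box c N \<tau> B E"
    by (rule flow_box_exists[OF y0]) blast
  note fb = flow_boxD[OF box(3)]
  note A = charts_atD[OF box(1)]
  have fst_lim: "((\<lambda>w. fst w - t0) \<longlongrightarrow> 0) ?G"
    using tendsto_fst[OF tendsto_ident_at, of z "UNIV \<times> M"] unfolding z0(1) fst_conv by (rule LIM_zero)
  have "continuous_on (UNIV \<times> M) (\<lambda>w. \<phi> t0 (snd w))"
    by (rule continuous_on_compose2[OF time_map_continuous]) (auto intro!: continuous_intros)
  then have snd_lim: "((\<lambda>w. \<phi> t0 (snd w)) \<longlongrightarrow> y0) ?G"
    using z unfolding continuous_on_def y0_def z0(1) by fastforce
  obtain O' where O': "open O'" "N = M \<inter> O'" using fb(1) by (metis openin_open)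
  have "\<forall>\<^sub>F w in ?G. \<phi> t0 (snd w) \<in> O'" using topological_tendstoD[OF snd_lim O'(1)] box(2) O'(2) by blast
  moreover have in_M: "\<forall>\<^sub>F w in ?G. snd w \<in> M" by (auto simp: eventually_at_topological intro!: exI[of _ UNIV])
  ultimately have ev_N: "\<forall>\<^sub>F w in ?G. \<phi> t0 (snd w) \<in> N"
    by eventually_elim (simp add: O'(2) flow_in_M)
  have ev_t: "\<forall>\<^sub>F w in ?G. \<bar>fst w - t0\<bar> \<le> \<tau>"
    using tendstoD[OF fst_lim fb(3)] by eventually_elim simp
  have key: "\<forall>\<^sub>F w in ?G. \<phi> (fst w) (snd w) \<in> chart_dom c \<and>
      norm (chart_map c (\<phi> (fst w) (snd w)) - chart_map c (\<phi> t0 (snd w))) \<le> B * \<bar>fst w - t0\<bar>"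
    using ev_N ev_t in_M
  proof eventually_elim
    case (elim w)
    have "\<phi> (fst w) (snd w) = \<phi> (fst w - t0) (\<phi> t0 (snd w))"
      using flow_group[OF elim(3), of "fst w - t0" t0] by simp
    then show ?case
      using fb(4,5)[OF trajectory_flow[OF flow_in_M[OF elim(3)]], of t0 "fst w - t0"] elim(1,2)
      by (simp add: flow_zero flow_in_M elim(3))
  qed
  have lim0: "((\<lambda>w. B * \<bar>fst w - t0\<bar>) \<longlongrightarrow> 0) ?G"
    using tendsto_mult_right_zero[OF tendsto_rabs_zero[OF fst_lim], of B] .
  have "((\<lambda>w. chart_map c (\<phi> (fst w) (snd w)) - chart_map c (\<phi> t0 (snd w))) \<longlongrightarrow> 0) ?G"
    by (rule Lim_null_comparison[OF _ lim0]) (use key in eventually_elim, blast)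
  moreover have "((\<lambda>w. chart_map c (\<phi> t0 (snd w))) \<longlongrightarrow> chart_map c y0) ?G"
  proof (rule continuous_on_tendsto_compose[OF chart_map_continuous[OF A(1)] snd_lim A(2)])
    obtain O'' where "open O''" "chart_dom c = M \<inter> O''" using chart_dom_open[OF A(1)] by (metis openin_open)
    moreover from this have "\<forall>\<^sub>F w in ?G. \<phi> t0 (snd w) \<in> O''" using topological_tendstoD[OF snd_lim] A(2) by blast
    ultimately show "\<forall>\<^sub>F w in ?G. \<phi> t0 (snd w) \<in> chart_dom c"
      using in_M by (auto elim: eventually_elim2 simp: flow_in_M)
  qed
  ultimately have "((\<lambda>w. chart_map c (\<phi> (fst w) (snd w))) \<longlongrightarrow> chart_map c y0) ?G"
    using tendsto_add by fastforce
  then have "((\<lambda>w. \<phi> (fst w) (snd w)) \<longlongrightarrow> y0) ?G"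
    by (intro tendsto_from_chart[OF A]) (use key in \<open>auto elim: eventually_mono\<close>)
  then show "((\<lambda>(t, x). \<phi> t x) \<longlongrightarrow> (case z of (t, x) \<Rightarrow> \<phi> t x)) ?G"
    by (simp add: case_prod_unfold y0_def z0(1))
qed

lemma grad_eq_0_iff:
  assumes c: "c \<in> charts_at \<A> p"
  shows "grad c (chart_map c p) = 0 \<longleftrightarrow> critical_point M \<A> F p"
proof -
  note A = charts_atD[OF c]
  note im = chart_map_in[OF A]
  show ?thesis
    unfolding critical_point_iff[OF c] gram_grad[OF A(1) im, symmetric]
    using gram_pos[OF A(1) im, of "grad c (chart_map c p)"] bilinear_lzero[OF gram_bilinear[OF A(1) im]]
    by (metis less_irrefl)
qed

text \<open>The constant curve is a trajectory, hence the trajectory.\<close>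

lemma critical_imp_stationary:
  assumes p: "critical_point M \<A> F p"
  shows "\<phi> t p = p"
proof -
  have pM: "p \<in> M" using p by (simp add: critical_point_def)
  have c: "chart_at \<A> p \<in> charts_at \<A> p" by (rule chart_at_in[OF pM])
  have "gradient \<A> g F p (chart_at \<A> p) = 0"
    using grad_eq_0_iff[OF c] p by (simp add: grad_def chart_inv_map charts_atD[OF c])
  then have zero: "gradient \<A> g F p = (\<lambda>_. 0)"
    using tangent_eq_coord_tvec[OF c gradient_in[OF pM]] coord_tvec_eq_0_iff[OF c] by metis
  have "trajectory (\<lambda>_. p)"
    unfolding trajectory_def has_velocity_def zero
    using pM gradient_in[OF pM] zero by (simp add: comp_def)
  from trajectory_unique[OF trajectory_flow[OF pM] this] show ?thesis by (simp add: flow_zero pM)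
qed

lemma F_trajectory_derivative:
  assumes \<gamma>: "trajectory \<gamma>" and c: "c \<in> charts_at \<A> (\<gamma> t)"
  shows "((\<lambda>t. F (\<gamma> t)) has_real_derivative
    - gram c (chart_map c (\<gamma> t)) (grad c (chart_map c (\<gamma> t))) (grad c (chart_map c (\<gamma> t)))) (at t)"
proof -
  note A = charts_atD[OF c]
  define x where "x = chart_map c (\<gamma> t)"
  have x: "x \<in> chart_im c" unfolding x_def by (rule chart_map_in[OF A])
  have "((\<lambda>t. chart_map c (\<gamma> t)) has_derivative (\<lambda>h. h *\<^sub>R - grad c x)) (at t)"
    using trajectory_chart_derivative[OF \<gamma> A] by (simp add: has_vector_derivative_def x_def)
  from diff_chain_at[OF this, of "F \<circ> chart_inv c" "dF c x"] dF_has_derivative[OF A(1) x]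
  have "((F \<circ> chart_inv c) \<circ> (\<lambda>t. chart_map c (\<gamma> t)) has_derivative (\<lambda>h. dF c x (h *\<^sub>R - grad c x))) (at t)"
    by (simp add: x_def comp_def)
  moreover have "(\<lambda>h. dF c x (h *\<^sub>R - grad c x)) = (*) (- gram c x (grad c x) (grad c x))"
    by (simp add: fun_eq_iff linear_cmul[OF linear_dF[OF A(1) x]] linear_neg[OF linear_dF[OF A(1) x]] gram_grad[OF A(1) x])
  ultimately have "((F \<circ> chart_inv c) \<circ> (\<lambda>t. chart_map c (\<gamma> t)) has_real_derivative - gram c x (grad c x) (grad c x)) (at t)"
    by (simp add: has_field_derivative_def)
  then have "((\<lambda>t. F (\<gamma> t)) has_real_derivative - gram c x (grad c x) (grad c x)) (at t)"
  proof (rule has_field_derivative_transform_within_open)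
    show "open {s. \<gamma> s \<in> chart_dom c}"
      by (rule chart_preimage_open[OF trajectory_continuous[OF \<gamma>] _ chart_dom_open[OF A(1)]])
         (use trajectory_in[OF \<gamma>] in auto)
    show "t \<in> {s. \<gamma> s \<in> chart_dom c}" using A(2) by simp
    show "((F \<circ> chart_inv c) \<circ> (\<lambda>t. chart_map c (\<gamma> t))) s = F (\<gamma> s)" if "s \<in> {s. \<gamma> s \<in> chart_dom c}" for s
      using that by (simp add: chart_inv_map[OF A(1)])
  qed
  then show ?thesis by (simp add: x_def)
qed

text \<open>The derivative of \<open>F\<close> along a trajectory is the negative squared length of the gradient, which does not
  vanish because a trajectory through a critical point is constant.\<close>

lemma F_decreasing_along_flow:
  assumes x: "x \<in> M" "\<not> critical_point M \<A> F x" and t: "0 < t"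
  shows "F (\<phi> t x) < F x"
proof -
  have "F (\<phi> t x) < F (\<phi> 0 x)"
  proof (rule DERIV_neg_imp_decreasing[OF t])
    fix s
    have sM: "\<phi> s x \<in> M" by (rule flow_in_M[OF x(1)])
    define c where "c = chart_at \<A> (\<phi> s x)"
    have c: "c \<in> charts_at \<A> (\<phi> s x)" unfolding c_def by (rule chart_at_in[OF sM])
    have "\<not> critical_point M \<A> F (\<phi> s x)"
    proof
      assume crit: "critical_point M \<A> F (\<phi> s x)"
      have "x = \<phi> (- s) (\<phi> s x)" using flow_group[OF x(1), of "- s" s] flow_zero[OF x(1)] by simp
      then show False using critical_imp_stationary[OF crit, of "- s"] crit x(2) by simp
    qed
    then have "grad c (chart_map c (\<phi> s x)) \<noteq> 0" using grad_eq_0_iff[OF c] by simp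
    then show "\<exists>y. ((\<lambda>t. F (\<phi> t x)) has_real_derivative y) (at s) \<and> y < 0"
      using F_trajectory_derivative[OF trajectory_flow[OF x(1)] c] gram_pos[OF charts_atD(1)[OF c] chart_map_in[OF charts_atD[OF c]]]
      by fastforce
  qed
  then show ?thesis by (simp add: flow_zero x(1))
qed

lemma F_continuous: "continuous_on M F"
  unfolding continuous_on_def
proof
  fix p assume p: "p \<in> M"
  define c where "c = chart_at \<A> p"
  have c: "c \<in> charts_at \<A> p" unfolding c_def by (rule chart_at_in[OF p])
  note A = charts_atD[OF c]
  have ev: "\<forall>\<^sub>F y in at p within M. y \<in> chart_dom c" by (rule eventually_in_openin[OF chart_dom_open[OF A(1)] A(2)])
  have "((\<lambda>y. (F \<circ> chart_inv c) (chart_map c y)) \<longlongrightarrow> (F \<circ> chart_inv c) (chart_map c p)) (at p within M)"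
    by (rule continuous_on_tendsto_compose[OF smooth_on_continuous[OF F_chart_smooth[OF A(1)]] chart_map_tendsto[OF c] chart_map_in[OF A]])
       (use ev in eventually_elim, rule chart_map_in[OF A(1)])
  moreover have "\<forall>\<^sub>F y in at p within M. (F \<circ> chart_inv c) (chart_map c y) = F y"
    using ev by eventually_elim (simp add: chart_inv_map[OF A(1)])
  ultimately show "(F \<longlongrightarrow> F p) (at p within M)"
    using chart_inv_map[OF A] by (auto intro: Lim_transform_eventually)
qed

end

section \<open>Critical points and level sets\<close>

locale morse_gradient_flow = gradient_flow M \<A> g F \<phi>
  for M :: "'a::metric_space set" and \<A> :: "('a, 'e::euclidean_space) chart set"
    and g :: "'a \<Rightarrow> ('a, 'e) tvec \<Rightarrow> ('a, 'e) tvec \<Rightarrow> real" and F :: "'a \<Rightarrow> real" and \<phi> +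
  assumes morse: "morse M \<A> F"
begin

definition crit :: "'a set" where
  "crit = {p. critical_point M \<A> F p}"

lemma crit_subset: "crit \<subseteq> M"
  by (auto simp: crit_def critical_point_def)

lemma crit_iff: "c \<in> charts_at \<A> p \<Longrightarrow> p \<in> crit \<longleftrightarrow> (\<forall>w. dF c (chart_map c p) w = 0)"
  using critical_point_iff by (simp add: crit_def)

lemma dF_has_derivative2:
  assumes "c \<in> \<A>" "x \<in> chart_im c"
  shows "((\<lambda>x. dF c x w) has_derivative frechet_derivative (\<lambda>x. dF c x w) (at x)) (at x)"
  by (rule smooth_on_has_derivative[OF dF_smooth]) (use assms in auto)

text \<open>The Morse condition in terms of coordinate vectors.\<close>

lemma hessian_nondegenerate:
  assumes p: "p \<in> crit" and u: "u = chart_map (chart_at \<A> p) p"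
    and zero: "\<And>w. frechet_derivative (\<lambda>x. dF (chart_at \<A> p) x w) (at u) v = 0"
  shows "v = 0"
proof -
  let ?c = "chart_at \<A> p"
  have pM: "p \<in> M" using p crit_subset by blast
  have c: "?c \<in> charts_at \<A> p" by (rule chart_at_in[OF pM])
  let ?\<xi> = "coord_tvec \<A> ?c p v"
  have "hessian \<A> F p ?\<xi> \<eta> = 0" for \<eta>
    using zero unfolding hessian_def Let_def dF_def u coord_tvec_at(2)[OF c] by blast
  moreover have "critical_point M \<A> F p" using p by (simp add: crit_def)
  ultimately have "?\<xi> = (\<lambda>_. 0)" using morse coord_tvec_at(1)[OF c] unfolding morse_def by blast
  then show ?thesis using coord_tvec_eq_0_iff[OF c] by blast
qed

text \<open>At a regular point some partial derivative is nonzero nearby. At a critical point the map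
  \<open>\<Phi>\<close>, the Euclidean gradient in the chart, has the Hessian as its derivative. It is injective and
  therefore bounded below, so that \<open>\<Phi>\<close> has no other zeros nearby.\<close>

lemma crit_isolated:
  assumes p: "p \<in> M"
  shows "\<exists>N. openin (top_of_set M) N \<and> p \<in> N \<and> N \<inter> crit \<subseteq> {p}"
proof -
  define c u where "c = chart_at \<A> p" and "u = chart_map c p"
  have c: "c \<in> charts_at \<A> p" unfolding c_def by (rule chart_at_in[OF p])
  note A = charts_atD[OF c]
  have u: "u \<in> chart_im c" unfolding u_def by (rule chart_map_in[OF A])
  have in_crit: "chart_inv c x \<in> crit \<longleftrightarrow> (\<forall>w. dF c x w = 0)" if "x \<in> chart_im c" for x
    using crit_iff[OF charts_at_chart_inv[OF A(1) that]] by (simp add: chart_map_inv[OF A(1) that])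
  have "\<exists>r>0. \<forall>x\<in>ball u r \<inter> chart_im c. chart_inv c x \<in> crit \<longrightarrow> x = u"
  proof (cases "p \<in> crit")
    case False
    then obtain w where w: "dF c u w \<noteq> 0" using crit_iff[OF c] by (auto simp: u_def)
    have "continuous (at u within chart_im c) (\<lambda>x. dF c x w)"
      using smooth_on_continuous[OF dF_smooth[OF A(1)]] u by (simp add: continuous_on_eq_continuous_within)
    then obtain r where "r > 0" "\<And>x. x \<in> chart_im c \<Longrightarrow> dist x u < r \<Longrightarrow> dist (dF c x w) (dF c u w) < \<bar>dF c u w\<bar>"
      using w unfolding continuous_within_eps_delta by (metis zero_less_abs_iff)
    then show ?thesis using in_crit by (intro exI[of _ r]) (fastforce simp: dist_commute dist_real_def)
  next
    case True
    let ?H = "\<lambda>w. frechet_derivative (\<lambda>x. dF c x w) (at u)"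
    let ?\<Phi> = "\<lambda>x. \<Sum>i\<in>Basis. dF c x i *\<^sub>R i" and ?\<Phi>' = "\<lambda>v. \<Sum>i\<in>Basis. ?H i v *\<^sub>R i"
    have deriv: "(?\<Phi> has_derivative ?\<Phi>') (at u)"
      by (intro has_derivative_sum has_derivative_scaleR_left dF_has_derivative2[OF A(1) u])
    have lin: "linear ?\<Phi>'" by (rule has_derivative_linear[OF deriv])
    have "inj ?\<Phi>'"
    proof (subst linear_injective_0[OF lin], intro allI impI)
      fix v assume v: "?\<Phi>' v = 0"
      have Hi: "?H i v = 0" if "i \<in> Basis" for i
      proof -
        have "?H i v = ?\<Phi>' v \<bullet> i" using that by (simp add: inner_sum_left inner_Basis if_distrib cong: if_cong)
        then show ?thesis by (simp only: v inner_zero_left)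
      qed
      have "?H w v = 0" for w
      proof -
        have "((\<lambda>x. \<Sum>i\<in>Basis. (w \<bullet> i) * dF c x i) has_derivative (\<lambda>v. \<Sum>i\<in>Basis. (w \<bullet> i) * ?H i v)) (at u)"
          by (intro has_derivative_sum has_derivative_mult_right dF_has_derivative2[OF A(1) u])
        then have "((\<lambda>x. dF c x w) has_derivative (\<lambda>v. \<Sum>i\<in>Basis. (w \<bullet> i) * ?H i v)) (at u)"
          by (rule has_derivative_transform_within_open[OF _ chart_im_open[OF A(1)] u])
             (rule linear_basis_expansion[OF linear_dF[OF A(1)], symmetric])
        then have "?H w = (\<lambda>v. \<Sum>i\<in>Basis. (w \<bullet> i) * ?H i v)" by (rule frechet_derivative_at[symmetric])
        then have "?H w v = (\<Sum>i\<in>Basis. (w \<bullet> i) * ?H i v)" by (rule fun_cong)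
        also have "\<dots> = 0" using Hi by simp
        finally show ?thesis .
      qed
      then show "v = 0"
        using hessian_nondegenerate[OF True, of u v] by (simp add: c_def u_def)
    qed
    then obtain m where m: "m > 0" "\<And>v. m * norm v \<le> norm (?\<Phi>' v)"
      using linear_inj_bounded_below_pos[OF lin] by blast
    obtain r where r: "r > 0" "\<And>x. norm (x - u) < r \<Longrightarrow> norm (?\<Phi> x - ?\<Phi> u - ?\<Phi>' (x - u)) \<le> m / 2 * norm (x - u)"
      using deriv[unfolded has_derivative_at_alt] m(1) by (meson half_gt_zero)
    have "x = u" if x: "x \<in> ball u r \<inter> chart_im c" "chart_inv c x \<in> crit" for x
    proof -
      have "?\<Phi> x = 0" using in_crit[of x] x by simp
      moreover have "?\<Phi> u = 0" using crit_iff[OF c] True by (simp add: u_def)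
      ultimately have "norm (?\<Phi>' (x - u)) \<le> m / 2 * norm (x - u)"
        using r(2)[of x] x by (simp add: dist_norm norm_minus_commute)
      then have "m * norm (x - u) \<le> m / 2 * norm (x - u)" using m(2)[of "x - u"] by linarith
      then show ?thesis using m(1) by simp
    qed
    then show ?thesis using r(1) by blast
  qed
  then obtain r where r: "r > 0" "\<And>x. x \<in> ball u r \<inter> chart_im c \<Longrightarrow> chart_inv c x \<in> crit \<Longrightarrow> x = u" by blast
  have pinv: "chart_inv c u = p" unfolding u_def by (rule chart_inv_map[OF A])
  show ?thesis
  proof (intro exI[of _ "chart_inv c ` (ball u r \<inter> chart_im c)"] conjI)
    show "openin (top_of_set M) (chart_inv c ` (ball u r \<inter> chart_im c))"
      by (rule chart_inv_image_open[OF A(1)]) (simp_all add: chart_im_open[OF A(1)] open_Int)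
    show "p \<in> chart_inv c ` (ball u r \<inter> chart_im c)"
      using r(1) u pinv by (intro image_eqI[of _ _ u]) simp_all
    show "chart_inv c ` (ball u r \<inter> chart_im c) \<inter> crit \<subseteq> {p}" using r(2) pinv by blast
  qed
qed

lemma finite_crit: "finite crit"
proof (rule ccontr)
  assume "infinite crit"
  then obtain l where l: "l \<in> M" "l islimpt crit"
    using Heine_Borel_imp_Bolzano_Weierstrass[OF compact_M] crit_subset by blast
  obtain N where N: "openin (top_of_set M) N" "l \<in> N" "N \<inter> crit \<subseteq> {l}" using crit_isolated[OF l(1)] by blast
  obtain O' where O': "open O'" "N = M \<inter> O'" using N(1) by (metis openin_open)
  then obtain y where "y \<in> crit" "y \<in> O'" "y \<noteq> l" using l(2) N(2) unfolding islimpt_def by blast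
  then show False using N(3) O'(2) crit_subset by blast
qed

lemma gradient_like: "gradient_like_flow M \<phi> F crit"
proof
  show "F (\<phi> t x) < F x" if "x \<in> M" "x \<notin> crit" "0 < t" for x t
    using F_decreasing_along_flow that by (simp add: crit_def)
  show "\<phi> t z = z" if "z \<in> crit" for z t
    using critical_imp_stationary that by (simp add: crit_def)
qed (use compact_M flow_jointly_continuous flow_in_M flow_zero flow_group F_continuous finite_crit crit_subset in auto)

text \<open>If all level sets were finite, removing an intermediate one from a ball would leave a connected set on
  which \<open>F\<close> skips a value between two of its values.\<close>

lemma infinite_level:
  assumes dim: "2 \<le> DIM('e)" and "M \<noteq> {}"
  shows "\<exists>v. infinite {x\<in>M. F x = v}"
proof (rule ccontr)
  assume "\<not> ?thesis"
  then have fin: "finite {x\<in>M. F x = v}" for v by blast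
  obtain p where p: "p \<in> M" using assms(2) by blast
  define c where "c = chart_at \<A> p"
  have c: "c \<in> charts_at \<A> p" unfolding c_def by (rule chart_at_in[OF p])
  note A = charts_atD[OF c]
  define f where "f = F \<circ> chart_inv c"
  obtain r where r: "r > 0" "ball (chart_map c p) r \<subseteq> chart_im c"
    using chart_im_open[OF A(1)] chart_map_in[OF A] unfolding open_contains_ball by blast
  let ?B = "ball (chart_map c p) r"
  have "infinite ?B" using r(1) by (intro uncountable_infinite uncountable_ball)
  have fin_B: "finite {x \<in> ?B. f x = v}" for v
  proof (rule finite_imageD)
    have "chart_inv c ` {x \<in> ?B. f x = v} \<subseteq> {x\<in>M. F x = v}"
    proof
      fix y assume "y \<in> chart_inv c ` {x \<in> ?B. f x = v}"
      then obtain x where x: "y = chart_inv c x" "x \<in> ?B" "f x = v" by blast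
      then have "y \<in> chart_dom c" using r(2) chart_inv_in[OF A(1), of x] by blast
      then show "y \<in> {x\<in>M. F x = v}" using chart_dom_subset[OF A(1)] x by (auto simp: f_def)
    qed
    then show "finite (chart_inv c ` {x \<in> ?B. f x = v})" using fin finite_subset by blast
    show "inj_on (chart_inv c) {x \<in> ?B. f x = v}"
      using r(2) chart_map_inv[OF A(1)] by (intro inj_on_inverseI[of _ "chart_map c"]) blast
  qed
  obtain a where a: "a \<in> ?B" using r(1) by (meson centre_in_ball)
  have "\<exists>b\<in>?B. f b \<noteq> f a"
  proof (rule ccontr)
    assume "\<not> ?thesis"
    then have "{x \<in> ?B. f x = f a} = ?B" by blast
    then show False using fin_B[of "f a"] \<open>infinite ?B\<close> by simp
  qed
  then obtain b where b: "b \<in> ?B" "f b \<noteq> f a" by blast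
  define v where "v = (f a + f b) / 2"
  let ?T = "{x \<in> ?B. f x = v}"
  have "connected (?B - ?T)"
    by (rule connected_open_delete_finite[OF open_ball connected_ball dim fin_B])
  moreover have "continuous_on (?B - ?T) f"
    unfolding f_def by (rule continuous_on_subset[OF smooth_on_continuous[OF F_chart_smooth[OF A(1)]]]) (use r(2) in blast)
  ultimately have conn: "connected (f ` (?B - ?T))" by (rule connected_continuous_image[rotated])
  have "f a \<in> f ` (?B - ?T)" "f b \<in> f ` (?B - ?T)" using a b by (auto simp: v_def)
  moreover have "(f a \<le> v \<and> v \<le> f b) \<or> (f b \<le> v \<and> v \<le> f a)" by (auto simp: v_def)
  ultimately have "v \<in> f ` (?B - ?T)" using connectedD_interval[OF conn] by blast
  then show False by blast
qed

text \<open>Two points of a short interval at the same level would give a zero of the derivative of \<open>F\<close> between them, by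
  Rolle's theorem.\<close>

lemma one_dimensional_regular:
  assumes dim: "DIM('e) = 1" and x: "x \<in> M" "x \<notin> crit"
  shows "\<exists>N. openin (top_of_set M) N \<and> x \<in> N \<and> inj_on F N"
proof -
  obtain b :: 'e where b: "norm b = 1" "\<And>y. y = (y \<bullet> b) *\<^sub>R b" by (rule one_dimensional_unit_vector[OF dim]) blast
  define c u where "c = chart_at \<A> x" and "u = chart_map c x"
  have c: "c \<in> charts_at \<A> x" unfolding c_def by (rule chart_at_in[OF x(1)])
  note A = charts_atD[OF c]
  have u: "u \<in> chart_im c" unfolding u_def by (rule chart_map_in[OF A])
  have uinv: "chart_inv c u = x" unfolding u_def by (rule chart_inv_map[OF A])
  obtain w where w: "dF c u w \<noteq> 0" using crit_iff[OF c] x(2) by (auto simp: u_def)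
  define G where "G = {y \<in> chart_im c. dF c y w \<noteq> 0}"
  have "openin (top_of_set (chart_im c)) (chart_im c \<inter> (\<lambda>y. dF c y w) -` (- {0}))"
    by (rule continuous_openin_preimage_gen[OF smooth_on_continuous[OF dF_smooth[OF A(1)]]]) auto
  moreover have "chart_im c \<inter> (\<lambda>y. dF c y w) -` (- {0}) = G" by (auto simp: G_def)
  ultimately have "open G" using chart_im_open[OF A(1)] openin_open_trans by metis
  then obtain r where r: "r > 0" "ball u r \<subseteq> G" using u w unfolding open_contains_ball G_def by blast
  have "inj_on (F \<circ> chart_inv c) (ball u r)"
  proof (rule inj_onI, rule ccontr)
    fix y z assume yz: "y \<in> ball u r" "z \<in> ball u r" "(F \<circ> chart_inv c) y = (F \<circ> chart_inv c) z" "y \<noteq> z"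
    define h where "h t = (F \<circ> chart_inv c) (y + t *\<^sub>R (z - y))" for t
    have seg: "y + t *\<^sub>R (z - y) \<in> ball u r" if "t \<in> {0..1}" for t
    proof -
      have "(1 - t) *\<^sub>R y + t *\<^sub>R z \<in> ball u r"
        using that yz(1,2) by (intro convexD[OF convex_ball]) auto
      then show ?thesis by (simp add: algebra_simps)
    qed
    have hd: "(h has_real_derivative dF c (y + t *\<^sub>R (z - y)) (z - y)) (at t)" if t: "t \<in> {0..1}" for t
    proof -
      have im: "y + t *\<^sub>R (z - y) \<in> chart_im c" using seg[OF t] r(2) by (auto simp: G_def)
      have "((\<lambda>t. y + t *\<^sub>R (z - y)) has_derivative (\<lambda>s. s *\<^sub>R (z - y))) (at t)"
        by (auto intro!: derivative_eq_intros)
      from diff_chain_at[OF this dF_has_derivative[OF A(1) im]]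
      have "(h has_derivative (\<lambda>s. dF c (y + t *\<^sub>R (z - y)) (s *\<^sub>R (z - y)))) (at t)"
        by (simp add: h_def[abs_def] comp_def)
      then show ?thesis
        unfolding has_field_derivative_def
        by (rule has_derivative_eq_rhs) (simp add: fun_eq_iff linear_cmul[OF linear_dF[OF A(1) im]] mult.commute)
    qed
    have "\<exists>t. 0 < t \<and> t < 1 \<and> dF c (y + t *\<^sub>R (z - y)) (z - y) = 0"
    proof -
      have "\<exists>t>0. t < 1 \<and> (h has_real_derivative 0) (at t)"
      proof (rule Rolle)
        show "h 0 = h 1" using yz(3) by (simp add: h_def)
        show "continuous_on {0..1} h" using hd by (intro continuous_at_imp_continuous_on ballI DERIV_isCont) auto
        show "h differentiable (at t)" if "0 < t" "t < 1" for t
          using hd[of t] that by (auto intro: differentiableI simp: real_differentiable_def)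
      qed simp
      then obtain t where t: "0 < t" "t < 1" "(h has_real_derivative 0) (at t)" by blast
      then show ?thesis using DERIV_unique[OF hd[of t] t(3)] by (intro exI[of _ t]) auto
    qed
    then obtain t where t: "t \<in> {0..1}" "dF c (y + t *\<^sub>R (z - y)) (z - y) = 0"
      by (metis atLeastAtMost_iff less_imp_le)
    have im: "y + t *\<^sub>R (z - y) \<in> G" using seg[OF t(1)] r(2) by blast
    then have lin: "linear (dF c (y + t *\<^sub>R (z - y)))" using linear_dF[OF A(1)] by (simp add: G_def)
    have "(z - y) \<bullet> b \<noteq> 0" using b(2)[of "z - y"] yz(4) by auto
    then have "w = ((w \<bullet> b) / ((z - y) \<bullet> b)) *\<^sub>R (z - y)"
      using b(2)[of w] b(2)[of "z - y"] by (metis nonzero_eq_divide_eq scaleR_scaleR)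
    then have "dF c (y + t *\<^sub>R (z - y)) w = ((w \<bullet> b) / ((z - y) \<bullet> b)) *\<^sub>R dF c (y + t *\<^sub>R (z - y)) (z - y)"
      using linear_cmul[OF lin] by metis
    then show False using t(2) im by (simp add: G_def)
  qed
  then have "inj_on F (chart_inv c ` ball u r)" by (rule inj_on_imageI)
  moreover have "openin (top_of_set M) (chart_inv c ` ball u r)"
    using r(2) by (intro chart_inv_image_open[OF A(1)]) (auto simp: G_def)
  moreover have "x \<in> chart_inv c ` ball u r" using r(1) uinv by (intro image_eqI[of _ _ u]) simp_all
  ultimately show ?thesis by blast
qed

text \<open>The coordinate \<open>\<psi>\<close> of the chart is a real parameter in which \<open>F\<close> has a nonzero second derivative at
  its critical point 0. The halves are the images of the intervals to the right and to the left of 0.\<close>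

lemma one_dimensional_two_sided:
  assumes dim: "DIM('e) = 1" and z: "z \<in> crit"
  shows "two_sided M F crit z"
proof -
  obtain b :: 'e where b: "norm b = 1" "\<And>y. y = (y \<bullet> b) *\<^sub>R b" "b \<noteq> 0" by (rule one_dimensional_unit_vector[OF dim]) blast
  have zM: "z \<in> M" using z crit_subset by blast
  define c u where "c = chart_at \<A> z" and "u = chart_map c z"
  have c: "c \<in> charts_at \<A> z" unfolding c_def by (rule chart_at_in[OF zM])
  note A = charts_atD[OF c]
  have u: "u \<in> chart_im c" unfolding u_def by (rule chart_map_in[OF A])
  have uinv: "chart_inv c u = z" unfolding u_def by (rule chart_inv_map[OF A])
  obtain N where N: "openin (top_of_set M) N" "z \<in> N" "N \<inter> crit \<subseteq> {z}" using crit_isolated[OF zM] by blast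
  have "openin (top_of_set (chart_im c)) (chart_im c \<inter> chart_inv c -` N)"
    by (rule continuous_openin_preimage[OF chart_inv_continuous[OF A(1)] _ N(1)])
       (use chart_inv_in[OF A(1)] chart_dom_subset[OF A(1)] in auto)
  then have "open (chart_im c \<inter> chart_inv c -` N)" using chart_im_open[OF A(1)] openin_open_trans by metis
  moreover have "u \<in> chart_im c \<inter> chart_inv c -` N" using u uinv N(2) by simp
  ultimately obtain r where r: "r > 0" "ball u r \<subseteq> chart_im c \<inter> chart_inv c -` N"
    unfolding open_contains_ball by blast
  define \<psi> where "\<psi> s = u + s *\<^sub>R b" for s :: real
  have \<psi>_ball: "\<psi> s \<in> ball u d \<longleftrightarrow> \<bar>s\<bar> < d" for s d using b(1) by (simp add: \<psi>_def dist_norm)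
  have \<psi>_coord: "y = \<psi> ((y - u) \<bullet> b)" for y unfolding \<psi>_def using b(2)[of "y - u"] by (metis add.commute diff_add_cancel)
  have \<psi>_inner: "(\<psi> s - u) \<bullet> b = s" for s using b(1) by (simp add: \<psi>_def dot_square_norm)
  define f f' where "f s = F (chart_inv c (\<psi> s))" and "f' s = dF c (\<psi> s) b" for s
  define k where "k = frechet_derivative (\<lambda>x. dF c x b) (at u) b"
  have im: "\<psi> s \<in> chart_im c" if "\<bar>s\<bar> < r" for s using \<psi>_ball[of s r] that r(2) by blast
  have \<psi>d: "(\<psi> has_derivative (\<lambda>h. h *\<^sub>R b)) (at s)" for s
    unfolding \<psi>_def by (auto intro!: derivative_eq_intros)
  have f_deriv: "(f has_real_derivative f' s) (at s)" if s: "\<bar>s\<bar> < r" for s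
  proof -
    from diff_chain_at[OF \<psi>d dF_has_derivative[OF A(1) im[OF s]]]
    have "(f has_derivative (\<lambda>h. dF c (\<psi> s) (h *\<^sub>R b))) (at s)" by (simp add: f_def[abs_def] comp_def)
    then show ?thesis
      unfolding has_field_derivative_def f'_def
      by (rule has_derivative_eq_rhs) (simp add: fun_eq_iff linear_cmul[OF linear_dF[OF A(1) im[OF s]]] mult.commute)
  qed
  have \<psi>0: "\<psi> 0 = u" by (simp add: \<psi>_def)
  have f'_deriv: "(f' has_real_derivative k) (at 0)"
  proof -
    note D = dF_has_derivative2[OF A(1) u, of b]
    have lin: "linear (frechet_derivative (\<lambda>x. dF c x b) (at u))" by (rule has_derivative_linear[OF D])
    from diff_chain_at[OF \<psi>d[of 0], of "\<lambda>x. dF c x b"] D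
    have "(f' has_derivative (\<lambda>h. frechet_derivative (\<lambda>x. dF c x b) (at u) (h *\<^sub>R b))) (at 0)"
      by (simp add: f'_def[abs_def] comp_def \<psi>0)
    then show ?thesis
      unfolding has_field_derivative_def k_def
      by (rule has_derivative_eq_rhs) (simp add: fun_eq_iff linear_cmul[OF lin] mult.commute)
  qed
  have f'0: "f' 0 = 0" using crit_iff[OF c] z by (simp add: f'_def \<psi>0 u_def)
  \<comment> \<open>The space is spanned by \<open>b\<close>, so if \<open>k\<close> were 0 then \<open>b\<close> would be in the kernel of the Hessian.\<close>
  have k: "k \<noteq> 0"
  proof
    assume "k = 0"
    have "frechet_derivative (\<lambda>x. dF c x w) (at u) b = 0" for w
    proof -
      have "((\<lambda>x. (w \<bullet> b) * dF c x b) has_derivative (\<lambda>v. (w \<bullet> b) * frechet_derivative (\<lambda>x. dF c x b) (at u) v)) (at u)"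
        by (intro has_derivative_mult_right dF_has_derivative2[OF A(1) u])
      then have "((\<lambda>x. dF c x w) has_derivative (\<lambda>v. (w \<bullet> b) * frechet_derivative (\<lambda>x. dF c x b) (at u) v)) (at u)"
      proof (rule has_derivative_transform_within_open[OF _ chart_im_open[OF A(1)] u])
        show "(w \<bullet> b) * dF c x b = dF c x w" if "x \<in> chart_im c" for x
          using linear_cmul[OF linear_dF[OF A(1) that], of "w \<bullet> b" b] b(2)[of w] by simp
      qed
      then have "frechet_derivative (\<lambda>x. dF c x w) (at u) = (\<lambda>v. (w \<bullet> b) * frechet_derivative (\<lambda>x. dF c x b) (at u) v)"
        by (rule frechet_derivative_at[symmetric])
      then show ?thesis using \<open>k = 0\<close> unfolding k_def by simp
    qed
    then have "b = 0" using hessian_nondegenerate[OF z, of u b] by (simp add: c_def u_def)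
    then show False using b(3) by simp
  qed
  obtain d where d: "0 < d" "d \<le> r"
    "(\<forall>s. s \<noteq> 0 \<and> \<bar>s\<bar> < d \<longrightarrow> f s < f 0) \<or> (\<forall>s. s \<noteq> 0 \<and> \<bar>s\<bar> < d \<longrightarrow> f 0 < f s)"
    using second_derivative_test[OF r(1) f_deriv f'0 f'_deriv k] by blast
  define J where "J S = chart_inv c ` \<psi> ` S" for S
  have im_sub: "\<psi> ` S \<subseteq> chart_im c" if "S \<subseteq> {-d<..<d}" for S using im d(2) that by force
  have J_open: "openin (top_of_set M) (J S)" if S: "open S" "S \<subseteq> {-d<..<d}" for S
  proof -
    have "\<psi> ` S = (\<lambda>y. (y - u) \<bullet> b) -` S"
    proof (intro set_eqI iffI)
      show "y \<in> (\<lambda>y. (y - u) \<bullet> b) -` S" if "y \<in> \<psi> ` S" for y using that \<psi>_inner by auto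
      show "y \<in> \<psi> ` S" if "y \<in> (\<lambda>y. (y - u) \<bullet> b) -` S" for y
        by (rule image_eqI[where f = \<psi>, OF \<psi>_coord]) (use that in simp)
    qed
    moreover have "open ((\<lambda>y. (y - u) \<bullet> b) -` S)"
      by (intro open_vimage[OF S(1)] continuous_intros)
    ultimately show ?thesis unfolding J_def by (intro chart_inv_image_open[OF A(1) _ im_sub[OF S(2)]]) simp
  qed
  have \<psi>_cont: "continuous_on S \<psi>" for S unfolding \<psi>_def by (intro continuous_intros)
  have J_conn: "connected (J S)" if S: "connected S" "S \<subseteq> {-d<..<d}" for S
    unfolding J_def
    by (intro connected_continuous_image continuous_on_subset[OF chart_inv_continuous[OF A(1)] im_sub[OF S(2)]] \<psi>_cont S(1))
  have lim: "((\<lambda>s. chart_inv c (\<psi> s)) \<longlongrightarrow> z) (at 0)"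
  proof -
    have "isCont (chart_inv c) u"
      using chart_inv_continuous[OF A(1)] chart_im_open[OF A(1)] u continuous_on_eq_continuous_at by blast
    moreover have "isCont \<psi> 0" unfolding \<psi>_def by (intro continuous_intros)
    ultimately have "isCont (\<lambda>s. chart_inv c (\<psi> s)) 0" using isCont_o2[of 0 \<psi> "chart_inv c"] \<psi>0 by simp
    then show ?thesis by (simp add: isCont_def \<psi>0 uinv)
  qed
  have cl: "z \<in> closure (J S)" if S: "\<forall>\<^sub>F s in at 0 within T. s \<in> S" "at (0::real) within T \<noteq> bot" for S T
  proof (rule Lim_in_closed_set[OF closed_closure _ S(2)])
    show "((\<lambda>s. chart_inv c (\<psi> s)) \<longlongrightarrow> z) (at 0 within T)" using lim by (rule filterlim_mono) (simp_all add: at_le)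
    show "\<forall>\<^sub>F s in at 0 within T. chart_inv c (\<psi> s) \<in> closure (J S)"
      using S(1) by eventually_elim (rule subsetD[OF closure_subset], simp add: J_def)
  qed
  have inj: "s = t" if "chart_inv c (\<psi> s) = chart_inv c (\<psi> t)" "\<bar>s\<bar> < d" "\<bar>t\<bar> < d" for s t
    using that im d(2) chart_map_inv[OF A(1)] \<psi>_inner by (metis less_le_trans)
  have z\<psi>: "z = chart_inv c (\<psi> 0)" by (simp add: \<psi>0 uinv)
  let ?J1 = "J {0<..<d}" and ?J2 = "J {-d<..<0}"
  have union: "insert z (?J1 \<union> ?J2) = J {-d<..<d}"
  proof -
    have split: "{-d<..<d} = insert 0 ({0<..<d} \<union> {-d<..<0})" using d(1) by auto
    show ?thesis unfolding J_def split z\<psi> by (simp only: image_insert image_Un)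
  qed
  have member: "\<exists>s. s \<noteq> 0 \<and> \<bar>s\<bar> < d \<and> x = chart_inv c (\<psi> s)" if x: "x \<in> ?J1 \<union> ?J2" for x
  proof -
    obtain s where "s \<in> {0<..<d} \<union> {-d<..<0}" "x = chart_inv c (\<psi> s)" using x unfolding J_def by blast
    then show ?thesis by (intro exI[of _ s]) auto
  qed
  show ?thesis
    unfolding two_sided_def
  proof (rule exI[of _ ?J1], rule exI[of _ ?J2], intro conjI)
    show "openin (top_of_set M) ?J1" "openin (top_of_set M) ?J2" "connected ?J1" "connected ?J2"
      using d(1) by (auto intro!: J_open J_conn)
    show "openin (top_of_set M) (insert z (?J1 \<union> ?J2))" unfolding union by (rule J_open) auto
    show "?J1 \<inter> ?J2 = {}"
    proof (rule ccontr)
      assume "?J1 \<inter> ?J2 \<noteq> {}"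
      then obtain s t where st: "s \<in> {0<..<d}" "t \<in> {-d<..<0}" "chart_inv c (\<psi> s) = chart_inv c (\<psi> t)"
        unfolding J_def by blast
      then have "s = t" by (intro inj) auto
      then show False using st by simp
    qed
    show "(?J1 \<union> ?J2) \<inter> crit = {}"
    proof -
      have "x \<notin> crit" if x: "x \<in> ?J1 \<union> ?J2" for x
      proof
        assume "x \<in> crit"
        obtain s where s: "s \<noteq> 0" "\<bar>s\<bar> < d" "x = chart_inv c (\<psi> s)" using member[OF x] by blast
        then have "x \<in> N" using \<psi>_ball[of s r] d(2) r(2) by auto
        then have "chart_inv c (\<psi> s) = chart_inv c (\<psi> 0)" using N(3) \<open>x \<in> crit\<close> s(3) z\<psi> by blast
        then show False using inj[of s 0] s d(1) by simp
      qed
      then show ?thesis by blast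
    qed
    show "z \<in> closure ?J1"
      by (rule cl[of _ "{0<..}"]) (use d(1) in \<open>auto simp: eventually_at_right_field\<close>)
    show "z \<in> closure ?J2"
      by (rule cl[of _ "{..<0}"]) (use d(1) in \<open>auto simp: eventually_at_left_field intro!: exI[of _ "- d"]\<close>)
    show "(\<forall>x\<in>?J1 \<union> ?J2. F x < F z) \<or> (\<forall>x\<in>?J1 \<union> ?J2. F z < F x)"
    proof -
      have "f 0 = F z" by (simp add: f_def z\<psi>[symmetric])
      then show ?thesis using d(3) member unfolding f_def by metis
    qed
  qed
qed

end

section \<open>Failure of shadowing\<close>

theorem theorem1:
  fixes M :: "'a::metric_space set"
    and \<A> :: "('a, 'e::euclidean_space) chart set"
    and g :: "'a \<Rightarrow> ('a, 'e) tvec \<Rightarrow> ('a, 'e) tvec \<Rightarrow> real"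
    and F :: "'a \<Rightarrow> real"
    and \<phi> :: "real \<Rightarrow> 'a \<Rightarrow> 'a"
  assumes "smooth_manifold M \<A>"
    and "compact M" and "connected M" and "M \<noteq> {}"
    and "riemannian_metric M \<A> g"
    and "smooth_fun \<A> F"
    and "morse M \<A> F"
    and "negative_gradient_flow M \<A> g F \<phi>"
    and "morse_smale M \<A> F \<phi>"
  shows "\<not> shadowing_property (subcontinua M) (hausdorff_dist M) (induced_map (\<phi> 1))"
proof -
  interpret morse_gradient_flow M \<A> g F \<phi>
    using assms by unfold_locales
  show ?thesis
  proof (cases "DIM('e) = 1")
    case True
    interpret one_dimensional_flow M \<phi> F crit
      by (intro one_dimensional_flow.intro gradient_like one_dimensional_flow_axioms.intro
          assms(3,4) one_dimensional_regular[OF True] one_dimensional_two_sided[OF True])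
    show ?thesis by (rule one_dimensional_not_shadowing)
  next
    case False
    moreover have "0 < DIM('e)" by (rule DIM_positive)
    ultimately have "2 \<le> DIM('e)" by linarith
    then show ?thesis
      using infinite_level[OF _ assms(4)] gradient_like_flow.infinite_level_imp_not_shadowing[OF gradient_like] by blast
  qed
qed

end
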